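(* Let $M$ be a compact real analytic manifold of real dimension $2n$, let $J_0$ be a (real analytic) complex structure on $M$ and let $X$ be a real analytic vector field on $M$. Then there exists $T>0$ such that for every $\tau\in D_T=\{\tau\in\mathbb{C}:|\tau|<T\}$ there exist a global complex structure $J_\tau$ on $M$, extending the local complex structures for which the functions $z^i_\tau=e^{\tau X}\cdot z^i$, $i=1,\dots,n$ (with $z^1,\dots,z^n$ local $J_0$-holomorphic coordinates) are local holomorphic coordinates, and a unique biholomorphism $$\varphi_\tau:(M,J_\tau)\to(M,J_0)$$ which, on local $J_0$-holomorphic coordinates, acts as $e^{\tau X}$.
   Context: $C^{\rm an}$ denotes complex valued real analytic functions. For a real analytic vector field $X$, a (locally defined) complex valued real analytic function $f$ and $\tau\in\mathbb{C}$, the Lie series is $e^{\tau X}\cdot f:=\sum_{k=0}^\infty \frac{\tau^k}{k!}X^k(f)$, understood where it converges absolutely and uniformly on compact subsets. For every $p\in M$ and local $J_0$-holomorphic coordinates $z^1,\dots,z^n$ near $p$, for $|\tau|$ small enough the functions $z_\tau^i=e^{\tau X}\cdot z^i$ form a system of complex coordinates on a neighbourhood of $p$, and so define a local complex structure for which they are holomorphic. The phrase "acts as $e^{\tau X}$ on local $J_0$-holomorphic coordinates" means: around every $p\in M$ there are $J_0$-holomorphic coordinates $z=(z^1,\dots,z^n)$ on an open set $U\ni p$ and an open set $V$ with $p\in V\subset U$ such that, for all $\tau\in D_T$, the Lie series $e^{\tau X}\cdot z^i$ converge on $V$, $\varphi_\tau(V)\subset U$, and $z^i\circ\varphi_\tau=e^{\tau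 X}\cdot z^i$ on $V$ for $i=1,\dots,n$. That $J_\tau$ extends the local complex structures means that the functions $e^{\tau X}\cdot z^i$ on such $V$ are local $J_\tau$-holomorphic coordinates. *)

theory Defs
  imports "HOL-Analysis.Analysis"
begin

section \<open>Real analytic and holomorphic maps of several variables\<close>

text \<open>Multi-indices are the functions from the basis to the natural numbers.\<close>

definition real_analytic_at ::
    "('e::euclidean_space \<Rightarrow> 'f::euclidean_space) \<Rightarrow> 'e \<Rightarrow> bool" where
  "real_analytic_at f p \<longleftrightarrow>
     (\<exists>a r. r > 0 \<and>
       (\<forall>x\<in>ball p r.
         ((\<lambda>\<alpha>. (\<Prod>b\<in>Basis. ((x - p) \<bullet> b) ^ \<alpha> b) *\<^sub>R a \<alpha>) has_sum f x)
           (Basis \<rightarrow>\<^sub>E (UNIV :: nat set))))"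

definition real_analytic_on ::
    "('e::euclidean_space \<Rightarrow> 'f::euclidean_space) \<Rightarrow> 'e set \<Rightarrow> bool" where
  "real_analytic_on f S \<longleftrightarrow> (\<forall>x\<in>S. real_analytic_at f x)"

definition holomorphic_map_on ::
    "(complex ^ 'n \<Rightarrow> complex ^ 'm) \<Rightarrow> (complex ^ 'n) set \<Rightarrow> bool" where
  "holomorphic_map_on f S \<longleftrightarrow>
     (\<forall>x\<in>S. \<exists>f'. (f has_derivative f') (at x) \<and> (\<forall>c v. f' (c *s v) = c *s f' v))"

section \<open>Charts and maximal atlases\<close>

text \<open>A chart is a pair of a domain and a coordinate map. The coordinate map is a total function,
  but only its values on the domain are ever used.\<close>

type_synonym ('m, 'c) chart = "'m set \<times> ('m \<Rightarrow> 'c)"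

definition is_chart :: "('m::topological_space, 'c::topological_space) chart \<Rightarrow> bool" where
  "is_chart c \<longleftrightarrow> (case c of (U, x) \<Rightarrow>
     open U \<and> open (x ` U) \<and> homeomorphism U (x ` U) x (inv_into U x))"

definition transition :: "('m, 'c) chart \<Rightarrow> ('m, 'd) chart \<Rightarrow> 'c \<Rightarrow> 'd" where
  "transition c c' = snd c' \<circ> inv_into (fst c) (snd c)"

definition compatible ::
    "(('c \<Rightarrow> 'c) \<Rightarrow> 'c set \<Rightarrow> bool) \<Rightarrow> ('m, 'c) chart \<Rightarrow> ('m, 'c) chart \<Rightarrow> bool" where
  "compatible P c c' \<longleftrightarrow>
     P (transition c c') (snd c ` (fst c \<inter> fst c')) \<and>
     P (transition c' c) (snd c' ` (fst c \<inter> fst c'))"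

definition maximal_atlas ::
    "(('c \<Rightarrow> 'c) \<Rightarrow> 'c set \<Rightarrow> bool) \<Rightarrow>
     ('m::topological_space, 'c::topological_space) chart set \<Rightarrow> bool" where
  "maximal_atlas P A \<longleftrightarrow>
     (\<forall>c\<in>A. is_chart c) \<and>
     (\<Union>c\<in>A. fst c) = UNIV \<and>
     (\<forall>c\<in>A. \<forall>c'\<in>A. compatible P c c') \<and>
     (\<forall>c. is_chart c \<and> (\<forall>c'\<in>A. compatible P c c') \<longrightarrow> c \<in> A)"

section \<open>Real analytic manifolds, complex structures and vector fields\<close>

text \<open>The underlying set of the manifold is the whole type \<open>'m\<close>; the manifold is Hausdorff by
  the type class.\<close>

definition real_analytic_structure :: "('m::t2_space, real ^ 'd) chart set \<Rightarrow> bool" where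
  "real_analytic_structure A \<longleftrightarrow> maximal_atlas real_analytic_on A"

text \<open>A complex structure is a maximal holomorphic atlas whose charts are real analytic, with real
  analytic inverses, for the given real analytic structure. The elements \<open>(U, z)\<close> of \<open>J\<close> are the
  \<open>J\<close>-holomorphic coordinate systems.\<close>

definition complex_structure ::
    "('m::t2_space, real ^ 'd) chart set \<Rightarrow> ('m, complex ^ 'n) chart set \<Rightarrow> bool" where
  "complex_structure A J \<longleftrightarrow>
     maximal_atlas holomorphic_map_on J \<and>
     (\<forall>c\<in>A. \<forall>z\<in>J.
        real_analytic_on (transition c z) (snd c ` (fst c \<inter> fst z)) \<and>
        real_analytic_on (transition z c) (snd z ` (fst c \<inter> fst z)))"

text \<open>A tangent vector is given by its components in every chart around its base point, subject to
  the usual transformation law; \<open>X c p\<close> are the components in the chart \<open>c\<close> at \<open>p\<close>.\<close>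

definition real_analytic_vector_field ::
    "('m::t2_space, real ^ 'd) chart set \<Rightarrow>
     (('m, real ^ 'd) chart \<Rightarrow> 'm \<Rightarrow> real ^ 'd) \<Rightarrow> bool" where
  "real_analytic_vector_field A X \<longleftrightarrow>
     (\<forall>c\<in>A. \<forall>c'\<in>A. \<forall>p\<in>fst c \<inter> fst c'.
        X c' p = frechet_derivative (transition c c') (at (snd c p)) (X c p)) \<and>
     (\<forall>c\<in>A. real_analytic_on (X c \<circ> inv_into (fst c) (snd c)) (snd c ` fst c))"

section \<open>Lie series\<close>

text \<open>The derivative of \<open>f\<close> along \<open>X\<close>, computed in some chart around the point. By the
  transformation law it does not depend on the chart if \<open>f\<close> is differentiable near \<open>p\<close>, and it
  depends only on the germ of \<open>f\<close> at \<open>p\<close>, so \<open>f\<close> need only be meaningful locally.\<close>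

definition vf_apply ::
    "('m::t2_space, real ^ 'd) chart set \<Rightarrow> (('m, real ^ 'd) chart \<Rightarrow> 'm \<Rightarrow> real ^ 'd) \<Rightarrow>
     ('m \<Rightarrow> complex) \<Rightarrow> 'm \<Rightarrow> complex" where
  "vf_apply A X f p =
     (let c = (SOME c. c \<in> A \<and> p \<in> fst c)
      in frechet_derivative (f \<circ> inv_into (fst c) (snd c)) (at (snd c p)) (X c p))"

definition lie_term ::
    "('m::t2_space, real ^ 'd) chart set \<Rightarrow> (('m, real ^ 'd) chart \<Rightarrow> 'm \<Rightarrow> real ^ 'd) \<Rightarrow>
     complex \<Rightarrow> ('m \<Rightarrow> complex) \<Rightarrow> nat \<Rightarrow> 'm \<Rightarrow> complex" where
  "lie_term A X \<tau> f k p = \<tau> ^ k / fact k * (vf_apply A X ^^ k) f p"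

definition lie_series ::
    "('m::t2_space, real ^ 'd) chart set \<Rightarrow> (('m, real ^ 'd) chart \<Rightarrow> 'm \<Rightarrow> real ^ 'd) \<Rightarrow>
     complex \<Rightarrow> ('m \<Rightarrow> complex) \<Rightarrow> 'm \<Rightarrow> complex" where
  "lie_series A X \<tau> f p = (\<Sum>k. lie_term A X \<tau> f k p)"

definition lie_series_converges_on ::
    "('m::t2_space, real ^ 'd) chart set \<Rightarrow> (('m, real ^ 'd) chart \<Rightarrow> 'm \<Rightarrow> real ^ 'd) \<Rightarrow>
     complex \<Rightarrow> ('m \<Rightarrow> complex) \<Rightarrow> 'm set \<Rightarrow> bool" where
  "lie_series_converges_on A X \<tau> f V \<longleftrightarrow>
     (\<forall>p\<in>V. summable (\<lambda>k. norm (lie_term A X \<tau> f k p))) \<and>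
     (\<forall>K. compact K \<and> K \<subseteq> V \<longrightarrow>
        uniformly_convergent_on K (\<lambda>N p. \<Sum>k<N. lie_term A X \<tau> f k p))"

definition lie_series_coords ::
    "('m::t2_space, real ^ 'd) chart set \<Rightarrow> (('m, real ^ 'd) chart \<Rightarrow> 'm \<Rightarrow> real ^ 'd) \<Rightarrow>
     complex \<Rightarrow> ('m \<Rightarrow> complex ^ 'n) \<Rightarrow> 'm \<Rightarrow> complex ^ 'n" where
  "lie_series_coords A X \<tau> z p = (\<chi> i. lie_series A X \<tau> (\<lambda>q. z q $ i) p)"

section \<open>Biholomorphisms acting as Lie series\<close>

definition holomorphic_between ::
    "('m::t2_space, complex ^ 'n) chart set \<Rightarrow> ('m, complex ^ 'n) chart set \<Rightarrow>
     ('m \<Rightarrow> 'm) \<Rightarrow> bool" where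
  "holomorphic_between J J' \<phi> \<longleftrightarrow>
     continuous_on UNIV \<phi> \<and>
     (\<forall>(U, z)\<in>J. \<forall>(V, w)\<in>J'.
        holomorphic_map_on (w \<circ> \<phi> \<circ> inv_into U z) (z ` (U \<inter> \<phi> -` V)))"

definition biholomorphism ::
    "('m::t2_space, complex ^ 'n) chart set \<Rightarrow> ('m, complex ^ 'n) chart set \<Rightarrow>
     ('m \<Rightarrow> 'm) \<Rightarrow> bool" where
  "biholomorphism J J' \<phi> \<longleftrightarrow>
     bij \<phi> \<and> holomorphic_between J J' \<phi> \<and> holomorphic_between J' J (inv \<phi>)"

text \<open>The coordinates \<open>z\<close> on \<open>U\<close> and the open set \<open>V\<close> serve all parameters in the disc at once, so
  the following are properties of the whole family \<open>\<phi>\<close>. (For a single parameter the condition would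
  not determine the map: on a complex torus with a constant vector field, the identity satisfies it
  in suitable exponential coordinates.)\<close>

definition acts_on_coords ::
    "('m::t2_space, real ^ 'd) chart set \<Rightarrow> (('m, real ^ 'd) chart \<Rightarrow> 'm \<Rightarrow> real ^ 'd) \<Rightarrow>
     ('m, complex ^ 'n) chart set \<Rightarrow> real \<Rightarrow> (complex \<Rightarrow> 'm \<Rightarrow> 'm) \<Rightarrow>
     'm set \<Rightarrow> ('m \<Rightarrow> complex ^ 'n) \<Rightarrow> 'm set \<Rightarrow> bool" where
  "acts_on_coords A X J\<^sub>0 T \<phi> U z V \<longleftrightarrow>
     (U, z) \<in> J\<^sub>0 \<and> open V \<and> V \<subseteq> U \<and>
     (\<forall>\<tau>\<in>ball 0 T.
        (\<forall>i. lie_series_converges_on A X \<tau> (\<lambda>q. z q $ i) V) \<and>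
        \<phi> \<tau> ` V \<subseteq> U \<and>
        (\<forall>p\<in>V. \<forall>i. z (\<phi> \<tau> p) $ i = lie_series A X \<tau> (\<lambda>q. z q $ i) p))"

definition acts_as_lie_series ::
    "('m::t2_space, real ^ 'd) chart set \<Rightarrow> (('m, real ^ 'd) chart \<Rightarrow> 'm \<Rightarrow> real ^ 'd) \<Rightarrow>
     ('m, complex ^ 'n) chart set \<Rightarrow> real \<Rightarrow> (complex \<Rightarrow> 'm \<Rightarrow> 'm) \<Rightarrow> bool" where
  "acts_as_lie_series A X J\<^sub>0 T \<phi> \<longleftrightarrow>
     (\<forall>p. \<exists>U z V. p \<in> V \<and> acts_on_coords A X J\<^sub>0 T \<phi> U z V)"

definition extends_local_structures ::
    "('m::t2_space, real ^ 'd) chart set \<Rightarrow> (('m, real ^ 'd) chart \<Rightarrow> 'm \<Rightarrow> real ^ 'd) \<Rightarrow>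
     ('m, complex ^ 'n) chart set \<Rightarrow> real \<Rightarrow> (complex \<Rightarrow> 'm \<Rightarrow> 'm) \<Rightarrow>
     (complex \<Rightarrow> ('m, complex ^ 'n) chart set) \<Rightarrow> bool" where
  "extends_local_structures A X J\<^sub>0 T \<phi> J \<longleftrightarrow>
     (\<forall>U z V. acts_on_coords A X J\<^sub>0 T \<phi> U z V \<longrightarrow>
        (\<forall>\<tau>\<in>ball 0 T. (V, lie_series_coords A X \<tau> z) \<in> J \<tau>))"

end

theory Submission
  imports Defs "HOL-Complex_Analysis.Complex_Analysis"
begin

text \<open>
  The idea of the proof is that, for small complex \<open>\<tau>\<close>, the Lie series \<open>e\<^sup>\<tau>\<^sup>X z\<close> of holomorphic coordinates \<open>z\<close>
  converges and is a real analytic perturbation of \<open>z\<close> of size proportional to \<open>\<tau>\<close>. So \<open>z\<^sup>-\<^sup>1 \<circ> e\<^sup>\<tau>\<^sup>X z\<close> is a map close to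
  the identity, defined near a given point. These local maps fit together to a map \<open>\<phi>\<^sub>\<tau>\<close> of the compact manifold to
  itself, which is a real analytic diffeomorphism. The complex structure \<open>J\<^sub>\<tau>\<close> is the pull-back of \<open>J\<^sub>0\<close> under \<open>\<phi>\<^sub>\<tau>\<close>; then
  \<open>\<phi>\<^sub>\<tau>\<close> is biholomorphic for trivial reasons, and the functions \<open>e\<^sup>\<tau>\<^sup>X z = z \<circ> \<phi>\<^sub>\<tau>\<close> are \<open>J\<^sub>\<tau>\<close>-holomorphic coordinates.

  Convergence and analyticity. A map is real analytic if and only if it extends to a holomorphic map on the
  complexification of its domain (\<open>real_analytic_at_iff_complexification\<close>). There the Cauchy estimates on nested balls bound the
  \<open>k\<close>-th derivative along a vector field by \<open>C * fact k * K ^ k\<close> (\<open>lie_deriv_power_bound\<close>), so Lie series converge to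
  holomorphic functions. The same estimate, applied to mixed partial derivatives, yields the power series
  expansion of holomorphic functions. Compositions and inverses of real analytic maps are obtained
  from the complexifications.

  Gluing and uniqueness. Lie series commute with holomorphic changes of coordinates. As an identity of formal power
  series in \<open>\<tau>\<close> this follows from the product rule and the chain rule (\<open>lie_fps_compose\<close>), and it holds for actual
  values if \<open>\<tau>\<close> is small, depending on the point (\<open>lie_series_transition\<close>). For a fixed point \<open>q\<close>, however, the curve \<open>\<tau> \<mapsto> z\<^sup>-\<^sup>1 (e\<^sup>\<tau>\<^sup>X z (q))\<close> is
  a holomorphic map from the disc to the manifold, so two such curves that agree near \<open>0\<close> agree on the whole disc, by the
  identity theorem and the Hausdorff property (\<open>lie_series_curve_unique\<close>). This shows that \<open>\<phi>\<^sub>\<tau>\<close> does not depend on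
  the coordinates, and also that it is unique.

  Bijectivity. In suitable coordinates \<open>\<phi>\<^sub>\<tau>\<close> is the identity plus a map that is small and has Lipschitz constant \<open>1 / 2\<close>
  (\<open>flow_chart_exists\<close>). Hence it is locally injective with a real analytic local inverse. It is surjective by Brouwer's
  fixed point theorem, and injective for all small \<open>\<tau>\<close> by compactness of the square of the manifold.
\<close>

section \<open>Complex differentiable maps\<close>

text \<open>The maps \<open>J\<close> and \<open>K\<close> are multiplication by the imaginary unit on the two real vector spaces, so the
  condition says that the derivative is complex linear. Keeping them as parameters lets \<open>\<complex>\<close>, \<open>\<complex>\<^sup>n\<close> and the
  complexification of a Euclidean space be treated at once.\<close>

definition cdiff_on :: "('v \<Rightarrow> 'v) \<Rightarrow> ('w \<Rightarrow> 'w) \<Rightarrow>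
    ('v::real_normed_vector \<Rightarrow> 'w::real_normed_vector) \<Rightarrow> 'v set \<Rightarrow> bool" where
  "cdiff_on J K F S \<longleftrightarrow>
     (\<forall>w\<in>S. \<exists>F'. (F has_derivative F') (at w) \<and> (\<forall>v. F' (J v) = K (F' v)))"

abbreviation hol_on :: "('v \<Rightarrow> 'v) \<Rightarrow> ('v::real_normed_vector \<Rightarrow> complex) \<Rightarrow> 'v set \<Rightarrow> bool" where
  "hol_on J \<equiv> cdiff_on J ((*) \<i>)"

definition lie_deriv :: "('v \<Rightarrow> 'v) \<Rightarrow> ('v::real_normed_vector \<Rightarrow> complex) \<Rightarrow> 'v \<Rightarrow> complex" where
  "lie_deriv a F w = frechet_derivative F (at w) (a w)"

lemma cdiff_on_has_derivative:
  assumes "cdiff_on J K F S" "w \<in> S"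
  shows "(F has_derivative frechet_derivative F (at w)) (at w)"
  using assms unfolding cdiff_on_def using frechet_derivative_at by metis

lemma cdiff_on_commute:
  assumes "cdiff_on J K F S" "w \<in> S"
  shows "frechet_derivative F (at w) (J v) = K (frechet_derivative F (at w) v)"
  using assms unfolding cdiff_on_def using frechet_derivative_at by metis

lemma cdiff_on_linear_derivative:
  assumes "cdiff_on J K F S" "w \<in> S"
  shows "bounded_linear (frechet_derivative F (at w))"
  using cdiff_on_has_derivative[OF assms] has_derivative_bounded_linear by blast

lemma cdiff_on_subset: "cdiff_on J K F S \<Longrightarrow> T \<subseteq> S \<Longrightarrow> cdiff_on J K F T"
  unfolding cdiff_on_def by blast

lemma cdiff_on_cong:
  assumes "cdiff_on J K F S" "open S" "\<And>w. w \<in> S \<Longrightarrow> F w = G w"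
  shows "cdiff_on J K G S"
  using assms unfolding cdiff_on_def by (metis has_derivative_transform_within_open)

lemma cdiff_on_local:
  assumes "\<And>w. w \<in> S \<Longrightarrow> \<exists>r>0. cdiff_on J K F (ball w r)"
  shows "cdiff_on J K F S"
  using assms unfolding cdiff_on_def by (meson centre_in_ball)

lemma cdiff_on_imp_continuous_on: "cdiff_on J K F S \<Longrightarrow> continuous_on S F"
  by (meson cdiff_on_has_derivative continuous_at_imp_continuous_on has_derivative_continuous)

lemma cdiff_on_compose:
  assumes "cdiff_on J K F S" "cdiff_on K L G T" "F ` S \<subseteq> T"
  shows "cdiff_on J L (\<lambda>w. G (F w)) S"
  unfolding cdiff_on_def
proof
  fix w assume w: "w \<in> S"
  obtain F' where F': "(F has_derivative F') (at w)" "\<And>v. F' (J v) = K (F' v)"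
    using assms(1) w unfolding cdiff_on_def by blast
  obtain G' where G': "(G has_derivative G') (at (F w))" "\<And>v. G' (K v) = L (G' v)"
    using assms(2,3) w unfolding cdiff_on_def by blast
  show "\<exists>H. ((\<lambda>w. G (F w)) has_derivative H) (at w) \<and> (\<forall>v. H (J v) = L (H v))"
    using has_derivative_compose[OF F'(1) G'(1)] F'(2) G'(2) by (intro exI[of _ "\<lambda>v. G' (F' v)"]) auto
qed

lemma cdiff_on_linear:
  assumes "bounded_linear F" "\<And>v. F (J v) = K (F v)"
  shows "cdiff_on J K F S"
  using assms bounded_linear_imp_has_derivative unfolding cdiff_on_def by blast

lemma cdiff_on_const [intro]: "K 0 = 0 \<Longrightarrow> cdiff_on J K (\<lambda>_. c) S"
  unfolding cdiff_on_def by (intro ballI exI[of _ "\<lambda>_. 0"]) auto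

lemma cdiff_on_add:
  assumes "cdiff_on J K F S" "cdiff_on J K G S" "linear K"
  shows "cdiff_on J K (\<lambda>w. F w + G w) S"
  unfolding cdiff_on_def
proof
  fix w assume w: "w \<in> S"
  obtain F' where F': "(F has_derivative F') (at w)" "\<And>v. F' (J v) = K (F' v)"
    using assms(1) w unfolding cdiff_on_def by blast
  obtain G' where G': "(G has_derivative G') (at w)" "\<And>v. G' (J v) = K (G' v)"
    using assms(2) w unfolding cdiff_on_def by blast
  show "\<exists>H. ((\<lambda>w. F w + G w) has_derivative H) (at w) \<and> (\<forall>v. H (J v) = K (H v))"
    using has_derivative_add[OF F'(1) G'(1)] F'(2) G'(2) linear_add[OF assms(3)]
    by (intro exI[of _ "\<lambda>v. F' v + G' v"]) auto
qed

lemma cdiff_on_scaleR: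
  assumes "cdiff_on J K F S" "linear K"
  shows "cdiff_on J K (\<lambda>w. c *\<^sub>R F w) S"
  unfolding cdiff_on_def
proof
  fix w assume w: "w \<in> S"
  obtain F' where F': "(F has_derivative F') (at w)" "\<And>v. F' (J v) = K (F' v)"
    using assms(1) w unfolding cdiff_on_def by blast
  show "\<exists>H. ((\<lambda>w. c *\<^sub>R F w) has_derivative H) (at w) \<and> (\<forall>v. H (J v) = K (H v))"
    using has_derivative_scaleR_right[OF F'(1), of c] F'(2) linear_scale[OF assms(2)]
    by (intro exI[of _ "\<lambda>v. c *\<^sub>R F' v"]) auto
qed

lemma cdiff_on_sum:
  assumes "\<And>i. i \<in> I \<Longrightarrow> cdiff_on J K (F i) S" "linear K"
  shows "cdiff_on J K (\<lambda>w. \<Sum>i\<in>I. F i w) S"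
proof (cases "finite I")
  case True
  then show ?thesis using assms(1)
    by (induction I) (auto intro!: cdiff_on_const cdiff_on_add[OF _ _ assms(2)] simp: linear_0[OF assms(2)])
qed (auto intro!: cdiff_on_const simp: linear_0[OF assms(2)])

lemma linear_mult_complex [simp]: "linear ((*) (c::complex))"
  by (simp add: bounded_linear.linear bounded_linear_mult_right)

lemma hol_on_mult:
  assumes "hol_on J F S" "hol_on J G S"
  shows "hol_on J (\<lambda>w. F w * G w) S"
  unfolding cdiff_on_def
proof
  fix w assume w: "w \<in> S"
  obtain F' where F': "(F has_derivative F') (at w)" "\<And>v. F' (J v) = \<i> * (F' v)"
    using assms(1) w unfolding cdiff_on_def by blast
  obtain G' where G': "(G has_derivative G') (at w)" "\<And>v. G' (J v) = \<i> * (G' v)"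
    using assms(2) w unfolding cdiff_on_def by blast
  show "\<exists>H. ((\<lambda>w. F w * G w) has_derivative H) (at w) \<and> (\<forall>v. H (J v) = \<i> * (H v))"
    using has_derivative_mult[OF F'(1) G'(1)] F'(2) G'(2)
    by (intro exI[of _ "\<lambda>v. F w * G' v + F' v * G w"]) (auto simp: algebra_simps)
qed

lemma hol_on_power: "hol_on J F S \<Longrightarrow> hol_on J (\<lambda>w. F w ^ k) S"
  by (induction k) (auto intro: hol_on_mult)

lemma hol_on_prod:
  assumes "\<And>i. i \<in> I \<Longrightarrow> hol_on J (F i) S"
  shows "hol_on J (\<lambda>w. \<Prod>i\<in>I. F i w) S"
proof (cases "finite I")
  case True
  then show ?thesis using assms by (induction I) (auto intro: hol_on_mult)
qed auto

lemma hol_on_diff: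
  assumes "hol_on J F S" "hol_on J G S"
  shows "hol_on J (\<lambda>w. F w - G w) S"
  using cdiff_on_add[OF assms(1) cdiff_on_scaleR[OF assms(2), of "-1"]] by simp

lemma hol_on_cmult: "hol_on J F S \<Longrightarrow> hol_on J (\<lambda>w. c * F w) S"
  by (rule hol_on_mult) auto

text \<open>The norm identity says that every complex line is embedded isometrically up to scale. Hence one-variable
  Cauchy estimates on complex lines hold with the radii of the ambient balls.\<close>

locale complex_space =
  fixes J :: "'v::euclidean_space \<Rightarrow> 'v"
  assumes linear_J: "linear J"
    and norm_comb: "norm (s *\<^sub>R v + t *\<^sub>R J v) = sqrt (s\<^sup>2 + t\<^sup>2) * norm v"
begin

definition scal :: "complex \<Rightarrow> 'v \<Rightarrow> 'v" where
  "scal c v = Re c *\<^sub>R v + Im c *\<^sub>R J v"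

lemma norm_scal: "norm (scal c v) = norm c * norm v"
  by (simp add: scal_def norm_comb cmod_def)

lemma bounded_linear_scal: "bounded_linear (\<lambda>c. scal c v)"
  unfolding scal_def
  by (intro bounded_linear_add bounded_linear_compose[OF bounded_linear_scaleR_left]
        bounded_linear_Re bounded_linear_Im)

lemma slice_has_field_derivative:
  assumes "hol_on J F S" "w + scal c v \<in> S"
  shows "((\<lambda>c. F (w + scal c v)) has_field_derivative
           frechet_derivative F (at (w + scal c v)) v) (at c)"
proof -
  let ?F' = "frechet_derivative F (at (w + scal c v))"
  interpret F': bounded_linear ?F'
    using cdiff_on_linear_derivative[OF assms] .
  have "((\<lambda>c. w + scal c v) has_derivative (\<lambda>h. 0 + scal h v)) (at c)"
    by (intro derivative_intros bounded_linear_imp_has_derivative bounded_linear_scal)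
  from has_derivative_compose[OF this cdiff_on_has_derivative[OF assms]]
  have "((\<lambda>c. F (w + scal c v)) has_derivative (\<lambda>h. ?F' (scal h v))) (at c)" by simp
  moreover have "?F' (scal h v) = ?F' v * h" for h
  proof -
    have "?F' (scal h v) = of_real (Re h) * ?F' v + of_real (Im h) * (\<i> * ?F' v)"
      unfolding scal_def[of h] F'.add F'.scaleR cdiff_on_commute[OF assms]
      by (simp add: scaleR_conv_of_real)
    also have "\<dots> = (of_real (Re h) + \<i> * of_real (Im h)) * ?F' v" by (simp add: algebra_simps)
    finally show ?thesis by (simp add: complex_eq[symmetric])
  qed
  ultimately show ?thesis unfolding has_field_derivative_def by simp
qed

text \<open>The restriction of \<open>F\<close> to the complex line through \<open>w\<close> in the direction \<open>v\<close> is a holomorphic function on a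
  disc of radius \<open>r / norm v\<close>; the estimate is the one-variable Cauchy inequality for it.\<close>

lemma Cauchy_derivative_bound:
  assumes F: "hol_on J F (ball w r)" and B: "\<And>x. x \<in> ball w r \<Longrightarrow> norm (F x) \<le> B" and r: "r > 0"
  shows "norm (frechet_derivative F (at w) v) \<le> B / r * norm v"
proof (cases "v = 0")
  case True
  then show ?thesis
    using linear_0[OF bounded_linear.linear[OF cdiff_on_linear_derivative[OF F]]] r by simp
next
  case False
  let ?y = "norm (frechet_derivative F (at w) v)"
  have B0: "B \<ge> 0" using order_trans[OF norm_ge_zero B[of w]] r by simp
  have *: "?y * s \<le> B * norm v" if s: "0 < s" "s < r" for s
  proof -
    define g where "g c = F (w + scal c v)" for c
    have in_ball: "w + scal c v \<in> ball w r" if "norm c \<le> s / norm v" for c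
    proof -
      have "norm (scal c v) \<le> s" using that False by (simp add: norm_scal pos_le_divide_eq)
      then show ?thesis using s by (simp add: dist_norm)
    qed
    have der: "(g has_field_derivative frechet_derivative F (at (w + scal c v)) v) (at c)"
      if "norm c \<le> s / norm v" for c
      unfolding g_def using slice_has_field_derivative[OF F in_ball[OF that]] .
    have "g holomorphic_on cball 0 (s / norm v)"
      unfolding holomorphic_on_def
    proof
      fix c :: complex assume "c \<in> cball 0 (s / norm v)"
      then have "norm c \<le> s / norm v" by simp
      from has_field_derivative_at_within[OF der[OF this]]
      show "g field_differentiable at c within cball 0 (s / norm v)"
        unfolding field_differentiable_def by blast
    qed
    moreover have "norm (g c) \<le> B" if "norm (0 - c) = s / norm v" for c
      unfolding g_def by (rule B, rule in_ball) (use that in simp)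
    ultimately have "norm ((deriv ^^ 1) g 0) \<le> fact 1 * B / (s / norm v) ^ 1"
      using s False
      by (intro Cauchy_inequality holomorphic_on_imp_continuous_on)
         (auto intro: holomorphic_on_subset)
    moreover have "deriv g 0 = frechet_derivative F (at w) v"
      using der[of 0] s by (intro DERIV_imp_deriv) (simp add: scal_def)
    ultimately have "?y \<le> B / (s / norm v)" by simp
    then show ?thesis using s False by (simp add: field_simps)
  qed
  show ?thesis
  proof (cases "?y = 0")
    case True
    then show ?thesis using B0 r by simp
  next
    case False
    have "r \<le> B * norm v / ?y"
    proof (rule dense_le_bounded[OF r])
      fix s assume "0 < s" "s < r"
      from *[OF this] show "s \<le> B * norm v / ?y" using False by (simp add: field_simps)
    qed
    then show ?thesis using r False by (simp add: field_simps)
  qed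
qed

lemma hol_lipschitz:
  assumes F: "hol_on J F (ball x (r + d))" and B: "\<And>y. y \<in> ball x (r + d) \<Longrightarrow> norm (F y) \<le> B"
    and d: "d > 0" and yz: "y \<in> ball x r" "z \<in> ball x r"
  shows "norm (F y - F z) \<le> B / d * norm (y - z)"
proof (rule differentiable_bound[OF convex_ball _ _ yz])
  fix u assume u: "u \<in> ball x r"
  then have u': "u \<in> ball x (r + d)" using d by simp
  have sub: "ball u d \<subseteq> ball x (r + d)"
    using u by (simp add: ball_subset_ball_iff dist_commute)
  show "(F has_derivative frechet_derivative F (at u)) (at u within ball x r)"
    using cdiff_on_has_derivative[OF F u'] has_derivative_at_withinI by blast
  show "onorm (frechet_derivative F (at u)) \<le> B / d"
    by (rule onorm_le, rule Cauchy_derivative_bound[OF cdiff_on_subset[OF F sub] _ d])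
       (use B sub in blast)
qed

text \<open>The difference of \<open>F\<close> and its translate by \<open>z - y\<close> is bounded by a multiple of \<open>norm (y - z)\<close>, and the
  Cauchy estimate applied to this difference compares the two derivatives.\<close>

lemma derivative_lipschitz:
  assumes F: "hol_on J F (ball x (4*r))" and B: "\<And>y. y \<in> ball x (4*r) \<Longrightarrow> norm (F y) \<le> B"
    and r: "r > 0" and yz: "y \<in> ball x (2*r)" "z \<in> ball x (2*r)"
  shows "norm (frechet_derivative F (at y) v - frechet_derivative F (at z) v)
           \<le> B / r\<^sup>2 * norm (y - z) * norm v"
proof -
  define H where "H u = F u - F (u + (z - y))" for u
  have b1: "u \<in> ball x (3*r)" if "u \<in> ball y r" for u
    using that yz r dist_triangle[of x u y] by (simp add: dist_commute)
  have b2: "u + (z - y) \<in> ball x (3*r)" if "u \<in> ball y r" for u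
  proof -
    have "dist x (u + (z - y)) \<le> dist x z + dist z (u + (z - y))" by (rule dist_triangle)
    also have "dist z (u + (z - y)) = dist y u" by (simp add: dist_norm algebra_simps norm_minus_commute)
    finally show ?thesis using that yz r by simp
  qed
  have F3: "hol_on J F (ball x (3*r + r))" using F by simp
  have sub: "ball x (3*r) \<subseteq> ball x (4*r)" using r by (simp add: subset_ball)
  have sh: "cdiff_on J J (\<lambda>u. u + (z - y)) (ball y r)"
    by (rule cdiff_on_add[OF cdiff_on_linear[OF bounded_linear_ident] cdiff_on_const])
       (auto simp: linear_J linear_0[OF linear_J])
  have F3': "hol_on J F (ball x (3*r))" using cdiff_on_subset[OF F sub] .
  have sub1: "ball y r \<subseteq> ball x (3*r)" using b1 by blast
  have sub2: "(\<lambda>u. u + (z - y)) ` ball y r \<subseteq> ball x (3*r)" using b2 by blast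
  have H: "hol_on J H (ball y r)"
    unfolding H_def using hol_on_diff[OF cdiff_on_subset[OF F3' sub1] cdiff_on_compose[OF sh F3' sub2]] .
  have HB: "norm (H u) \<le> B / r * norm (y - z)" if "u \<in> ball y r" for u
  proof -
    have "norm (F u - F (u + (z - y))) \<le> B / r * norm (u - (u + (z - y)))"
      by (rule hol_lipschitz[OF F3 _ r b1[OF that] b2[OF that]]) (use B in simp)
    then show ?thesis by (simp add: H_def norm_minus_commute)
  qed
  have yb: "y \<in> ball x (4*r)" "z \<in> ball x (4*r)" using yz r by auto
  have "(F has_derivative frechet_derivative F (at z)) (at (y + (z - y)))"
    using cdiff_on_has_derivative[OF F yb(2)] by simp
  moreover have "((\<lambda>u. u + (z - y)) has_derivative (\<lambda>v. v)) (at y)"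
    by (auto intro!: derivative_eq_intros)
  ultimately have "((\<lambda>u. F (u + (z - y))) has_derivative frechet_derivative F (at z)) (at y)"
    using has_derivative_compose by fastforce
  then have "(H has_derivative (\<lambda>v. frechet_derivative F (at y) v - frechet_derivative F (at z) v)) (at y)"
    unfolding H_def using has_derivative_diff[OF cdiff_on_has_derivative[OF F yb(1)]] by blast
  then have "frechet_derivative H (at y) v = frechet_derivative F (at y) v - frechet_derivative F (at z) v"
    using frechet_derivative_at by metis
  then have "norm (frechet_derivative F (at y) v - frechet_derivative F (at z) v)
       \<le> (B / r * norm (y - z)) / r * norm v"
    using Cauchy_derivative_bound[OF H HB r, of v] by simp
  then show ?thesis by (simp add: power2_eq_square)
qed

text \<open>By the Cauchy estimates the derivatives of a uniformly convergent sequence converge uniformly on smaller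
  balls, so the limit may be differentiated termwise.\<close>

lemma hol_on_uniform_limit:
  assumes F: "\<And>n. hol_on J (F n) (ball x r)" and lim: "uniform_limit (ball x r) F G sequentially"
  shows "hol_on J G (ball x r)"
proof (rule cdiff_on_local)
  fix w assume w: "w \<in> ball x r"
  define d where "d = (r - dist x w) / 2"
  have d: "d > 0" using w by (simp add: d_def)
  have sub: "ball w d \<subseteq> ball x r" "\<And>u. u \<in> ball w d \<Longrightarrow> ball u d \<subseteq> ball x r"
  proof -
    have r: "r = dist x w + 2 * d" unfolding d_def by argo
    show "ball w d \<subseteq> ball x r"
      using d by (simp add: r ball_subset_ball_iff dist_commute)
    fix u assume u: "u \<in> ball w d"
    have "dist u x + d \<le> r"
      using u dist_triangle[of u x w] by (simp add: r dist_commute)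
    then show "ball u d \<subseteq> ball x r" by (simp add: ball_subset_ball_iff)
  qed
  define D where "D n u = frechet_derivative (F n) (at u)" for n u
  have der: "(F n has_derivative D n u) (at u)" if "u \<in> ball x r" for n u
    unfolding D_def by (rule cdiff_on_has_derivative[OF F that])
  have Cau: "\<exists>N. \<forall>m\<ge>N. \<forall>n\<ge>N. \<forall>u\<in>ball w d. \<forall>h. norm (D m u h - D n u h) \<le> e * norm h"
    if e: "e > 0" for e
  proof -
    have "uniformly_Cauchy_on (ball x r) F" using lim
      using uniformly_convergent_Cauchy uniformly_convergent_on_def by metis
    then obtain N where N: "\<And>m n u. m \<ge> N \<Longrightarrow> n \<ge> N \<Longrightarrow> u \<in> ball x r \<Longrightarrow> dist (F m u) (F n u) < e * d"
      unfolding uniformly_Cauchy_on_def using e d by (metis mult_pos_pos)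
    have "norm (D m u h - D n u h) \<le> e * norm h" if mn: "m \<ge> N" "n \<ge> N" and u: "u \<in> ball w d" for m n u h
    proof -
      have hd: "hol_on J (\<lambda>u. F m u - F n u) (ball u d)"
        using hol_on_diff F cdiff_on_subset sub(2)[OF u] by metis
      have ub: "u \<in> ball x r" using sub(1) u by blast
      have "frechet_derivative (\<lambda>u. F m u - F n u) (at u) = (\<lambda>h. D m u h - D n u h)"
        using has_derivative_diff[OF der[OF ub] der[OF ub]] frechet_derivative_at by metis
      moreover have "norm (frechet_derivative (\<lambda>u. F m u - F n u) (at u) h) \<le> e * d / d * norm h"
        by (rule Cauchy_derivative_bound[OF hd _ d])
           (use N[OF mn] sub(2)[OF u] in \<open>fastforce simp: dist_norm intro: less_imp_le\<close>)
      ultimately show ?thesis using d by simp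
    qed
    then show ?thesis by blast
  qed
  have conv: "convergent (\<lambda>n. D n u h)" if u: "u \<in> ball w d" for u h
  proof -
    have "Cauchy (\<lambda>n. D n u h)"
    proof (rule metric_CauchyI)
      fix e :: real assume e: "e > 0"
      define e' where "e' = e / (norm h + 1)"
      have e': "e' > 0" "e' * norm h < e" using e
        by (auto simp: e'_def field_simps add_pos_nonneg)
      then obtain N where N: "\<forall>m\<ge>N. \<forall>n\<ge>N. \<forall>u\<in>ball w d. \<forall>h. norm (D m u h - D n u h) \<le> e' * norm h"
        using Cau by blast
      then show "\<exists>M. \<forall>m\<ge>M. \<forall>n\<ge>M. dist (D m u h) (D n u h) < e"
        using u e'(2) unfolding dist_norm by (meson order_le_less_trans)
    qed
    then show ?thesis by (simp add: Cauchy_convergent_iff)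
  qed
  define D' where "D' u h = lim (\<lambda>n. D n u h)" for u h
  have D': "(\<lambda>n. D n u h) \<longlonglongrightarrow> D' u h" if "u \<in> ball w d" for u h
    using conv[OF that] unfolding D'_def by (simp add: convergent_LIMSEQ_iff)
  have Glim: "(\<lambda>n. F n u) \<longlonglongrightarrow> G u" if "u \<in> ball x r" for u
    using tendsto_uniform_limitI[OF lim that] .
  have "\<exists>g. \<forall>u\<in>ball w d. (\<lambda>n. F n u) \<longlonglongrightarrow> g u \<and> (g has_derivative D' u) (at u within ball w d)"
  proof (rule has_derivative_sequence)
    show "(\<lambda>n. F n w) \<longlonglongrightarrow> G w" using Glim w by blast
    show "w \<in> ball w d" using d by simp
    show "(F n has_derivative D n u) (at u within ball w d)" if "u \<in> ball w d" for n u
      using der sub(1) that has_derivative_at_withinI by blast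
    fix e :: real assume "e > 0"
    then obtain N where N: "\<forall>m\<ge>N. \<forall>n\<ge>N. \<forall>u\<in>ball w d. \<forall>h. norm (D m u h - D n u h) \<le> e * norm h"
      using Cau by blast
    have "norm (D n u h - D' u h) \<le> e * norm h" if "n \<ge> N" "u \<in> ball w d" for n u h
    proof (rule tendsto_upperbound[where F = sequentially and f = "\<lambda>m. norm (D n u h - D m u h)"])
      show "(\<lambda>m. norm (D n u h - D m u h)) \<longlonglongrightarrow> norm (D n u h - D' u h)"
        by (intro tendsto_intros D' that)
      show "\<forall>\<^sub>F m in sequentially. norm (D n u h - D m u h) \<le> e * norm h"
        using N that unfolding eventually_sequentially by blast
    qed auto
    then show "\<forall>\<^sub>F n in sequentially. \<forall>u\<in>ball w d. \<forall>h. norm (D n u h - D' u h) \<le> e * norm h"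
      unfolding eventually_sequentially by blast
  qed auto
  then obtain g where g: "\<And>u. u \<in> ball w d \<Longrightarrow> (\<lambda>n. F n u) \<longlonglongrightarrow> g u"
     "\<And>u. u \<in> ball w d \<Longrightarrow> (g has_derivative D' u) (at u within ball w d)" by blast
  have gG: "g u = G u" if "u \<in> ball w d" for u
    using g(1)[OF that] Glim[of u] sub(1) that LIMSEQ_unique by blast
  have "cdiff_on J ((*) \<i>) g (ball w d)"
    unfolding cdiff_on_def
  proof
    fix u assume u: "u \<in> ball w d"
    have "D' u (J v) = \<i> * D' u v" for v
    proof (rule LIMSEQ_unique[OF D'[OF u]])
      have "D n u (J v) = \<i> * D n u v" for n
        unfolding D_def using cdiff_on_commute[OF F] u sub(1) by blast
      then show "(\<lambda>n. D n u (J v)) \<longlonglongrightarrow> \<i> * D' u v" 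
        using tendsto_mult_left[OF D'[OF u]] by simp
    qed
    then show "\<exists>F'. (g has_derivative F') (at u) \<and> (\<forall>v. F' (J v) = \<i> * F' v)"
      using g(2)[OF u] at_within_open[OF u open_ball] by auto
  qed
  from cdiff_on_cong[OF this open_ball gG] have "hol_on J G (ball w d)" .
  then show "\<exists>r>0. hol_on J G (ball w r)" using d by blast
qed

end

context complex_space
begin

lemma taylor_remainder:
  assumes F: "hol_on J F (ball x (4*r))" and B: "\<And>y. y \<in> ball x (4*r) \<Longrightarrow> norm (F y) \<le> B"
    and r: "r > 0" and w: "w \<in> ball x (2*r)" "w + u \<in> ball x (2*r)"
  shows "norm (F (w + u) - F w - frechet_derivative F (at w) u) \<le> B / r\<^sup>2 * (norm u)\<^sup>2"
proof -
  define S where "S = closed_segment w (w + u)"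
  have S: "S \<subseteq> ball x (2*r)"
    unfolding S_def by (rule closed_segment_subset[OF w convex_ball])
  have sub: "ball x (2*r) \<subseteq> ball x (4*r)" using r by (simp add: subset_ball)
  have w4: "w \<in> ball x (4*r)" using w sub by blast
  have x4: "x \<in> ball x (4*r)" using r by simp
  have B0: "B \<ge> 0" using order_trans[OF norm_ge_zero B[OF x4]] .
  interpret D: bounded_linear "frechet_derivative F (at w)"
    using cdiff_on_linear_derivative[OF F w4] .
  define G where "G y = F y - frechet_derivative F (at w) y" for y
  have der: "(G has_derivative (\<lambda>v. frechet_derivative F (at y) v - frechet_derivative F (at w) v)) (at y within S)"
    if "y \<in> S" for y
  proof -
    have "y \<in> ball x (4*r)" using that S sub by blast
    from has_derivative_diff[OF cdiff_on_has_derivative[OF F this] D.has_derivative[OF has_derivative_ident]]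
    show ?thesis unfolding G_def by (rule has_derivative_at_withinI)
  qed
  have "norm (G (w + u) - G w) \<le> (B / r\<^sup>2 * norm u) * norm (w + u - w)"
  proof (rule differentiable_bound[OF _ der])
    show "convex S" by (simp add: S_def convex_closed_segment)
    fix y assume y: "y \<in> S"
    show "onorm (\<lambda>v. frechet_derivative F (at y) v - frechet_derivative F (at w) v) \<le> B / r\<^sup>2 * norm u"
    proof (rule onorm_le)
      fix v
      have "norm (frechet_derivative F (at y) v - frechet_derivative F (at w) v)
              \<le> B / r\<^sup>2 * norm (y - w) * norm v"
        by (rule derivative_lipschitz[OF F B r]) (use y S w in auto)
      also have "norm (y - w) \<le> norm u"
        using segment_bound(1)[OF y[unfolded S_def]] by simp
      finally show "norm (frechet_derivative F (at y) v - frechet_derivative F (at w) v)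
              \<le> B / r\<^sup>2 * norm u * norm v"
        using B0 r by (simp add: mult_left_mono mult_right_mono divide_right_mono)
    qed
  qed (auto simp: S_def)
  then show ?thesis by (simp add: G_def D.add power2_eq_square algebra_simps)
qed

text \<open>The derivative along \<open>a\<close> is the locally uniform limit of the difference quotients
  \<open>n * (F (w + a w / n) - F w)\<close>, which are holomorphic by the chain rule. In this way neither coordinates
  nor second derivatives enter.\<close>

lemma hol_on_lie_deriv:
  assumes F: "hol_on J F S" and a: "cdiff_on J J a S" and S: "open S"
  shows "hol_on J (lie_deriv a F) S"
proof (rule cdiff_on_local)
  fix x assume x: "x \<in> S"
  obtain e where e: "e > 0" "cball x e \<subseteq> S" using S x open_contains_cball by blast
  define r where "r = e / 4"
  have r: "r > 0" "e = 4 * r" using e by (auto simp: r_def)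
  have sub: "ball x (4*r) \<subseteq> S" "ball x r \<subseteq> ball x (4*r)" "cball x (4*r) \<subseteq> S"
    using e r by (auto simp: subset_ball intro: order.trans[OF ball_subset_cball])
  have bounded: "\<exists>B>0. \<forall>y\<in>cball x (4*r). norm (H y) \<le> B" if "continuous_on S H" for H :: "_ \<Rightarrow> 'z::real_normed_vector"
  proof -
    have "compact (H ` cball x (4*r))"
      by (intro compact_continuous_image continuous_on_subset[OF that] sub compact_cball)
    then have "bounded (H ` cball x (4*r))" by (rule compact_imp_bounded)
    then show ?thesis unfolding bounded_pos by blast
  qed
  obtain C where C: "C > 0" "\<And>y. y \<in> cball x (4*r) \<Longrightarrow> norm (F y) \<le> C"
    using bounded[OF cdiff_on_imp_continuous_on[OF F]] by blast
  obtain B where B: "B > 0" "\<And>y. y \<in> cball x (4*r) \<Longrightarrow> norm (a y) \<le> B"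
    using bounded[OF cdiff_on_imp_continuous_on[OF a]] by blast
  \<comment> \<open>The steps \<open>t n\<close> are so short that the shifted points stay in the ball of radius \<open>2 * r\<close>.\<close>
  obtain N :: nat where N: "B / r < real N" using reals_Archimedean2 by blast
  define t where "t n = inverse (real (n + N + 1))" for n
  have t: "t n > 0" "B * t n < r" for n
  proof -
    show "t n > 0" unfolding t_def by (rule positive_imp_inverse_positive) linarith
    have "B < real N * r" using N r by (simp add: field_simps)
    also have "\<dots> \<le> real (n + N + 1) * r" using r by (intro mult_right_mono) auto
    finally have "B < real (n + N + 1) * r" .
    then show "B * t n < r" unfolding t_def by (simp add: field_simps)
  qed
  have shift: "w + t n *\<^sub>R a w \<in> ball x (2*r)" if "w \<in> ball x r" for w n
  proof -
    have "norm (t n *\<^sub>R a w) = t n * norm (a w)" using t(1)[of n] by simp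
    also have "\<dots> \<le> t n * B" using that t(1)[of n] B(2)[of w] r by (intro mult_left_mono) auto
    finally have "norm (t n *\<^sub>R a w) < r" using t(2)[of n] by (simp add: mult.commute)
    moreover have "dist x (w + t n *\<^sub>R a w) \<le> dist x w + norm (t n *\<^sub>R a w)"
      using dist_triangle[of x "w + t n *\<^sub>R a w" w] by (simp add: dist_norm)
    ultimately show ?thesis using that by simp
  qed
  define G where "G n w = inverse (t n) *\<^sub>R (F (w + t n *\<^sub>R a w) - F w)" for n w
  have F4: "hol_on J F (ball x (4*r))" using cdiff_on_subset[OF F sub(1)] .
  have C4: "norm (F y) \<le> C" if "y \<in> ball x (4*r)" for y using C(2) that by auto
  have "hol_on J (lie_deriv a F) (ball x r)"
  proof (rule hol_on_uniform_limit)
    fix n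
    have 1: "cdiff_on J J (\<lambda>w. w + t n *\<^sub>R a w) (ball x r)"
      by (intro cdiff_on_add cdiff_on_scaleR cdiff_on_linear bounded_linear_ident linear_J
            cdiff_on_subset[OF a] order.trans[OF sub(2) sub(1)] refl)
    have "hol_on J (\<lambda>w. F (w + t n *\<^sub>R a w)) (ball x r)"
      by (rule cdiff_on_compose[OF 1 F4]) (use shift[of _ n] r in fastforce)
    then show "hol_on J (G n) (ball x r)"
      unfolding G_def by (intro cdiff_on_scaleR hol_on_diff cdiff_on_subset[OF F4 sub(2)]) auto
  next
    show "uniform_limit (ball x r) G (lie_deriv a F) sequentially"
    proof (rule uniform_limitI)
      fix \<epsilon> :: real assume \<epsilon>: "\<epsilon> > 0"
      have est: "dist (G n w) (lie_deriv a F w) \<le> (C / r\<^sup>2 * B\<^sup>2) * t n" if w: "w \<in> ball x r" for n w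
      proof -
        let ?u = "t n *\<^sub>R a w"
        have w2: "w \<in> ball x (2*r)" "w \<in> ball x (4*r)" using w r by auto
        interpret D: bounded_linear "frechet_derivative F (at w)"
          using cdiff_on_linear_derivative[OF F4 w2(2)] .
        have "G n w - lie_deriv a F w
                = inverse (t n) *\<^sub>R (F (w + ?u) - F w - frechet_derivative F (at w) ?u)"
          using t(1)[of n] by (simp add: G_def lie_deriv_def D.scaleR algebra_simps)
        then have "dist (G n w) (lie_deriv a F w)
                = inverse (t n) * norm (F (w + ?u) - F w - frechet_derivative F (at w) ?u)"
          using t(1)[of n] by (simp add: dist_norm)
        also have "\<dots> \<le> inverse (t n) * (C / r\<^sup>2 * (norm ?u)\<^sup>2)"
          using t(1)[of n] by (intro mult_left_mono taylor_remainder[OF F4 C4 r(1) w2(1) shift[OF w]]) auto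
        also have "\<dots> = (C / r\<^sup>2 * (norm (a w))\<^sup>2) * t n"
          using t(1)[of n] by (simp add: field_simps power2_eq_square)
        also have "\<dots> \<le> (C / r\<^sup>2 * B\<^sup>2) * t n"
          using t(1)[of n] C(1) B(2)[of w] w r by (intro mult_right_mono mult_left_mono power_mono) auto
        finally show ?thesis .
      qed
      have "(\<lambda>n. (C / r\<^sup>2 * B\<^sup>2) * t n) \<longlonglongrightarrow> (C / r\<^sup>2 * B\<^sup>2) * 0"
        unfolding t_def using LIMSEQ_ignore_initial_segment[OF LIMSEQ_inverse_real_of_nat, of N]
        by (intro tendsto_mult_left) (simp add: algebra_simps)
      then have "\<forall>\<^sub>F n in sequentially. (C / r\<^sup>2 * B\<^sup>2) * t n < \<epsilon>"
        using \<epsilon> by (intro order_tendstoD) auto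
      then show "\<forall>\<^sub>F n in sequentially. \<forall>w\<in>ball x r. dist (G n w) (lie_deriv a F w) < \<epsilon>"
        by eventually_elim (use est order_le_less_trans in blast)
    qed
  qed
  then show "\<exists>r>0. hol_on J (lie_deriv a F) (ball x r)" using r by blast
qed

lemma hol_on_foldr_lie_deriv:
  assumes "hol_on J F S" "\<And>a. a \<in> set as \<Longrightarrow> cdiff_on J J a S" "open S"
  shows "hol_on J (foldr lie_deriv as F) S"
  using assms by (induction as) (auto intro: hol_on_lie_deriv)

lemma hol_on_lie_deriv_power:
  assumes "hol_on J F S" "cdiff_on J J a S" "open S"
  shows "hol_on J ((lie_deriv a ^^ k) F) S"
  using assms by (induction k) (auto intro: hol_on_lie_deriv)

text \<open>Each differentiation gives up a shell of width \<open>d\<close> and costs a factor \<open>B / d\<close>. The fields form a list, so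
  that the estimate covers the powers of one field as well as mixed partial derivatives.\<close>

lemma foldr_lie_deriv_bound_step:
  assumes F: "hol_on J F (ball x r)" and C: "\<And>y. y \<in> ball x r \<Longrightarrow> norm (F y) \<le> C"
    and a: "\<And>a. a \<in> set as \<Longrightarrow> cdiff_on J J a (ball x r)"
    and B: "\<And>a y. a \<in> set as \<Longrightarrow> y \<in> ball x r \<Longrightarrow> norm (a y) \<le> B"
    and d: "d > 0" and w: "dist x w + real (length as) * d < r"
  shows "norm (foldr lie_deriv as F w) \<le> C * (B / d) ^ length as"
  using a B w
proof (induction as arbitrary: w)
  case Nil
  then show ?case using C by simp
next
  case (Cons a as)
  let ?G = "foldr lie_deriv as F"
  have sub: "dist x y + real (length as) * d < r" if "y \<in> ball w d" for y
    using that Cons.prems(3) dist_triangle[of x y w] by (simp add: algebra_simps)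
  have in_ball: "y \<in> ball x r" if "y \<in> ball w d" for y
  proof -
    have "0 \<le> real (length as) * d" using d by simp
    then show ?thesis using sub[OF that] by simp
  qed
  have w: "w \<in> ball x r" using in_ball[of w] d by simp
  have bound: "norm (?G y) \<le> C * (B / d) ^ length as" if "y \<in> ball w d" for y
    using Cons.IH[OF _ _ sub[OF that]] Cons.prems by simp
  have "hol_on J ?G (ball x r)"
    using Cons.prems by (intro hol_on_foldr_lie_deriv[OF F]) auto
  then have "hol_on J ?G (ball w d)" by (rule cdiff_on_subset) (use in_ball in blast)
  from Cauchy_derivative_bound[OF this bound d]
  have "norm (lie_deriv a ?G w) \<le> C * (B / d) ^ length as / d * norm (a w)"
    by (simp add: lie_deriv_def)
  also have "\<dots> \<le> C * (B / d) ^ length as / d * B"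
  proof (rule mult_left_mono)
    show "norm (a w) \<le> B" using Cons.prems(2) w by simp
    have "w \<in> ball w d" using d by simp
    from order_trans[OF norm_ge_zero bound[OF this]]
    show "0 \<le> C * (B / d) ^ length as / d" using d by simp
  qed
  finally show ?case by (simp add: mult_ac)
qed

end

text \<open>The left-hand side divided by \<open>fact k\<close> is one term of the exponential series at \<open>k\<close>.\<close>

lemma power_self_le_exp_fact: "real k ^ k \<le> exp (real k) * fact k"
proof -
  have "(\<Sum>n\<in>{k}. inverse (fact n) *\<^sub>R real k ^ n) \<le> exp (real k)"
    unfolding exp_def by (rule sum_le_suminf[OF summable_exp_generic]) auto
  then show ?thesis by (simp add: field_simps)
qed

context complex_space
begin

text \<open>Dividing the distance \<open>d\<close> into as many equal shells as there are fields turns the previous estimate into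
  a factorial times a geometric sequence. This is what makes Lie series converge.\<close>

lemma foldr_lie_deriv_bound:
  assumes F: "hol_on J F (ball x r)" and C: "\<And>y. y \<in> ball x r \<Longrightarrow> norm (F y) \<le> C"
    and a: "\<And>a. a \<in> set as \<Longrightarrow> cdiff_on J J a (ball x r)"
    and B: "\<And>a y. a \<in> set as \<Longrightarrow> y \<in> ball x r \<Longrightarrow> norm (a y) \<le> B" and B0: "B \<ge> 0"
    and d: "0 < d" and w: "dist x w + d < r"
  shows "norm (foldr lie_deriv as F w) \<le> C * fact (length as) * (exp 1 * B / d) ^ length as"
proof (cases "as = []")
  case True
  then show ?thesis using C[of w] w d by simp
next
  case False
  define k where "k = length as"
  have k: "real k > 0" using False by (simp add: k_def)
  have C0: "C \<ge> 0" using order_trans[OF norm_ge_zero C[of w]] w d by simp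
  have "norm (foldr lie_deriv as F w) \<le> C * (B / (d / k)) ^ k"
    unfolding k_def
    by (rule foldr_lie_deriv_bound_step[where as = as and r = r]) (use F C a B w d k k_def in auto)
  also have "\<dots> = C * (real k ^ k * (B / d) ^ k)"
    by (simp add: power_divide power_mult_distrib)
  also have "\<dots> \<le> C * (exp (real k) * fact k * (B / d) ^ k)"
    using C0 B0 d power_self_le_exp_fact[of k] by (intro mult_left_mono mult_right_mono) auto
  also have "\<dots> = C * fact k * (exp 1 * B / d) ^ k"
    by (simp add: power_divide power_mult_distrib exp_of_nat_mult[symmetric] mult_ac)
  finally show ?thesis by (simp add: k_def)
qed

lemma lie_deriv_power_bound:
  assumes F: "hol_on J F (ball x r)" and C: "\<And>y. y \<in> ball x r \<Longrightarrow> norm (F y) \<le> C"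
    and a: "cdiff_on J J a (ball x r)" and B: "\<And>y. y \<in> ball x r \<Longrightarrow> norm (a y) \<le> B" "B \<ge> 0"
    and d: "0 < d" and w: "dist x w + d < r"
  shows "norm ((lie_deriv a ^^ k) F w) \<le> C * fact k * (exp 1 * B / d) ^ k"
proof -
  have "(lie_deriv a ^^ k) F = foldr lie_deriv (replicate k a) F" by (induction k) auto
  then show ?thesis
    using foldr_lie_deriv_bound[OF F C, of "replicate k a" B d w] a B d w by simp
qed

end

section \<open>Formal Lie series\<close>

text \<open>The Lie series at the point \<open>w\<close> as a formal power series in the time. The algebraic properties below
  are identities between coefficients and involve no convergence.\<close>

definition lie_fps :: "('v \<Rightarrow> 'v) \<Rightarrow> ('v::real_normed_vector \<Rightarrow> complex) \<Rightarrow> 'v \<Rightarrow> complex fps" where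
  "lie_fps a F w = Abs_fps (\<lambda>k. (lie_deriv a ^^ k) F w / fact k)"

lemma lie_deriv_cong:
  assumes "open S" "w \<in> S" "\<And>u. u \<in> S \<Longrightarrow> F u = G u"
  shows "lie_deriv a F w = lie_deriv a G w"
proof -
  have "(F has_derivative D) (at w) \<longleftrightarrow> (G has_derivative D) (at w)" for D
    using has_derivative_transform_within_open[of F D w UNIV S G]
      has_derivative_transform_within_open[of G D w UNIV S F] assms by auto
  then show ?thesis by (simp add: lie_deriv_def frechet_derivative_def)
qed

lemma lie_deriv_power_cong:
  assumes "open S" "w \<in> S" "\<And>u. u \<in> S \<Longrightarrow> F u = G u"
  shows "(lie_deriv a ^^ k) F w = (lie_deriv a ^^ k) G w"
  using assms(2)
proof (induction k arbitrary: w)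
  case (Suc k)
  have "lie_deriv a ((lie_deriv a ^^ k) F) w = lie_deriv a ((lie_deriv a ^^ k) G) w"
    by (rule lie_deriv_cong[OF assms(1) Suc.prems Suc.IH])
  then show ?case by simp
qed (use assms in auto)

lemma lie_fps_cong:
  assumes "open S" "w \<in> S" "\<And>u. u \<in> S \<Longrightarrow> F u = G u"
  shows "lie_fps a F w = lie_fps a G w"
  unfolding lie_fps_def by (simp only: lie_deriv_power_cong[OF assms(1,2), of F G, OF assms(3)])

lemma fps_deriv_lie_fps: "fps_deriv (lie_fps a F w) = lie_fps a (lie_deriv a F) w"
  by (rule fps_ext) (simp add: lie_fps_def funpow_Suc_right del: funpow.simps of_nat_Suc)

lemma lie_deriv_add:
  assumes "hol_on J F S" "hol_on J G S" "w \<in> S"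
  shows "lie_deriv a (\<lambda>u. F u + G u) w = lie_deriv a F w + lie_deriv a G w"
  using has_derivative_add[OF cdiff_on_has_derivative[OF assms(1,3)] cdiff_on_has_derivative[OF assms(2,3)]]
  unfolding lie_deriv_def using frechet_derivative_at by metis

lemma lie_deriv_mult:
  assumes "hol_on J F S" "hol_on J G S" "w \<in> S"
  shows "lie_deriv a (\<lambda>u. F u * G u) w = F w * lie_deriv a G w + lie_deriv a F w * G w"
  using has_derivative_mult[OF cdiff_on_has_derivative[OF assms(1,3)] cdiff_on_has_derivative[OF assms(2,3)]]
  unfolding lie_deriv_def using frechet_derivative_at by metis

context complex_space
begin

lemma lie_fps_add:
  assumes "hol_on J F S" "hol_on J G S" "cdiff_on J J a S" "open S" "w \<in> S"
  shows "lie_fps a (\<lambda>u. F u + G u) w = lie_fps a F w + lie_fps a G w"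
proof -
  have "\<forall>u\<in>S. (lie_deriv a ^^ k) (\<lambda>u. F u + G u) u = (lie_deriv a ^^ k) F u + (lie_deriv a ^^ k) G u" for k
  proof (induction k)
    case (Suc k)
    show ?case
    proof
      fix u assume u: "u \<in> S"
      have "lie_deriv a ((lie_deriv a ^^ k) (\<lambda>u. F u + G u)) u =
            lie_deriv a (\<lambda>u. (lie_deriv a ^^ k) F u + (lie_deriv a ^^ k) G u) u"
        using Suc by (intro lie_deriv_cong[OF assms(4) u]) auto
      also have "\<dots> = lie_deriv a ((lie_deriv a ^^ k) F) u + lie_deriv a ((lie_deriv a ^^ k) G) u"
        using assms u by (intro lie_deriv_add[where J = J] hol_on_lie_deriv_power)
      finally show "(lie_deriv a ^^ Suc k) (\<lambda>u. F u + G u) u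
         = (lie_deriv a ^^ Suc k) F u + (lie_deriv a ^^ Suc k) G u" by simp
    qed
  qed simp
  then show ?thesis using assms(5) by (intro fps_ext) (simp add: lie_fps_def add_divide_distrib)
qed

lemma lie_fps_sum:
  assumes "\<And>i. i \<in> I \<Longrightarrow> hol_on J (F i) S" "cdiff_on J J a S" "open S" "w \<in> S" "finite I"
  shows "lie_fps a (\<lambda>u. \<Sum>i\<in>I. F i u) w = (\<Sum>i\<in>I. lie_fps a (F i) w)"
  using assms(5,1)
proof (induction I)
  case empty
  have "(lie_deriv a ^^ k) (\<lambda>u. 0) w = 0" for k
    by (induction k) (auto simp: funpow_Suc_right lie_deriv_def simp del: funpow.simps)
  then show ?case by (intro fps_ext) (simp add: lie_fps_def)
next
  case (insert i I)
  have "lie_fps a (\<lambda>u. F i u + (\<Sum>i\<in>I. F i u)) w = lie_fps a (F i) w + lie_fps a (\<lambda>u. \<Sum>i\<in>I. F i u) w"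
    by (rule lie_fps_add[OF _ _ assms(2,3,4)]) (use insert in \<open>auto intro!: cdiff_on_sum\<close>)
  then show ?case using insert by simp
qed

text \<open>Both sides have the same constant term, and by the product rule their formal derivatives are
  expressed in the same way by Lie series of products, so the coefficients agree by induction.\<close>

lemma lie_fps_mult:
  assumes "hol_on J F S" "hol_on J G S" "cdiff_on J J a S" "open S" "w \<in> S"
  shows "lie_fps a (\<lambda>u. F u * G u) w = lie_fps a F w * lie_fps a G w"
proof (rule fps_ext)
  fix n show "lie_fps a (\<lambda>u. F u * G u) w $ n = (lie_fps a F w * lie_fps a G w) $ n"
    using assms(1,2)
  proof (induction n arbitrary: F G)
    case 0
    then show ?case by (simp add: lie_fps_def)
  next
    case (Suc n)
    note F = Suc.prems(1) and G = Suc.prems(2)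
    note dF = hol_on_lie_deriv[OF F assms(3,4)] and dG = hol_on_lie_deriv[OF G assms(3,4)]
    have "of_nat (Suc n) * lie_fps a (\<lambda>u. F u * G u) w $ Suc n
        = lie_fps a (lie_deriv a (\<lambda>u. F u * G u)) w $ n"
      using arg_cong[OF fps_deriv_lie_fps[of a "\<lambda>u. F u * G u" w], of "\<lambda>f. f $ n"] by simp
    also have "lie_fps a (lie_deriv a (\<lambda>u. F u * G u)) w
        = lie_fps a (\<lambda>u. F u * lie_deriv a G u + lie_deriv a F u * G u) w"
      using lie_deriv_mult[OF F G] by (intro lie_fps_cong[OF assms(4,5)]) auto
    also have "\<dots> = lie_fps a (\<lambda>u. F u * lie_deriv a G u) w + lie_fps a (\<lambda>u. lie_deriv a F u * G u) w"
      by (intro lie_fps_add[OF _ _ assms(3,4,5)] hol_on_mult F G dF dG)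
    also have "\<dots> $ n = (lie_fps a F w * lie_fps a (lie_deriv a G) w
                          + lie_fps a (lie_deriv a F) w * lie_fps a G w) $ n"
      using Suc.IH[OF F dG] Suc.IH[OF dF G] by simp
    also have "\<dots> = fps_deriv (lie_fps a F w * lie_fps a G w) $ n"
      by (simp add: fps_deriv_lie_fps[symmetric])
    also have "\<dots> = of_nat (Suc n) * (lie_fps a F w * lie_fps a G w) $ Suc n"
      by (simp only: fps_deriv_nth Suc_eq_plus1)
    finally show ?case by (metis mult_cancel_left of_nat_neq_0)
  qed
qed

end

section \<open>Lie series and holomorphic substitutions\<close>

(* From here on the dollar sign denotes components of vectors only. *)
no_notation fps_nth (infixl "$" 75)

lemma complex_space_vec: "complex_space ((*s) \<i> :: complex ^ 'n \<Rightarrow> complex ^ 'n)"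
proof (rule complex_space.intro)
  show "linear ((*s) \<i> :: complex ^ 'n \<Rightarrow> complex ^ 'n)"
    by (rule linearI) (auto simp: vec_eq_iff algebra_simps)
next
  fix s t :: real and v :: "complex ^ 'n"
  have "s *\<^sub>R v + t *\<^sub>R (\<i> *s v) = (Complex s t) *s v"
    by (auto simp: vec_eq_iff complex_eq_iff)
  moreover have "norm (c *s v) = norm c * norm v" for c
    by (simp add: norm_vec_def L2_set_def norm_mult power_mult_distrib sum_distrib_left[symmetric]
          real_sqrt_mult)
  ultimately show "norm (s *\<^sub>R v + t *\<^sub>R (\<i> *s v)) = sqrt (s\<^sup>2 + t\<^sup>2) * norm v"
    by (simp add: cmod_def)
qed

lemma bounded_linear_vec_scale: "bounded_linear (\<lambda>v :: complex ^ 'n. c *s v)"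
  by (rule linear_conv_bounded_linear[THEN iffD1], rule linearI) (auto simp: vec_eq_iff algebra_simps)

lemma linear_vec_scale_i: "linear (\<lambda>v :: complex ^ 'n. \<i> *s v)"
  using bounded_linear_vec_scale bounded_linear.linear by blast

lemma cdiff_on_vec_iff:
  fixes F :: "'v::real_normed_vector \<Rightarrow> complex ^ 'n"
  shows "cdiff_on J ((*s) \<i>) F S \<longleftrightarrow> (\<forall>i. hol_on J (\<lambda>w. F w $ i) S)"
proof
  assume F: "cdiff_on J ((*s) \<i>) F S"
  show "\<forall>i. hol_on J (\<lambda>w. F w $ i) S"
  proof
    fix i :: 'n
    have "cdiff_on ((*s) \<i>) ((*) \<i>) (\<lambda>v. v $ i) UNIV"
      by (rule cdiff_on_linear) (auto intro: bounded_linear_vec_nth)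
    from cdiff_on_compose[OF F this] show "hol_on J (\<lambda>w. F w $ i) S" by simp
  qed
next
  assume *: "\<forall>i. hol_on J (\<lambda>w. F w $ i) S"
  have "cdiff_on J ((*s) \<i>) (\<lambda>w. \<Sum>i\<in>UNIV. axis i (F w $ i)) S"
  proof (rule cdiff_on_sum[OF _ linear_vec_scale_i])
    fix i :: 'n
    have "bounded_linear (\<lambda>c :: complex. axis i c :: complex ^ 'n)"
      by (rule linear_conv_bounded_linear[THEN iffD1], rule linearI) (auto simp: vec_eq_iff axis_def)
    then have "cdiff_on ((*) \<i>) ((*s) \<i>) (\<lambda>c. axis i c :: complex ^ 'n) UNIV"
      by (rule cdiff_on_linear) (auto simp: vec_eq_iff axis_def)
    from cdiff_on_compose[OF *[rule_format, of i] this]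
    show "cdiff_on J ((*s) \<i>) (\<lambda>w. axis i (F w $ i) :: complex ^ 'n) S" by simp
  qed
  moreover have "(\<Sum>i\<in>UNIV. axis i (F w $ i)) = F w" for w
    by (simp add: vec_eq_iff axis_def)
  ultimately show "cdiff_on J ((*s) \<i>) F S" by simp
qed

lemma vec_scale_eq: "c *s (v :: complex ^ 'n) = Re c *\<^sub>R v + Im c *\<^sub>R (\<i> *s v)"
  by (auto simp: vec_eq_iff complex_eq_iff)

lemma holomorphic_map_on_iff: "holomorphic_map_on f S \<longleftrightarrow> cdiff_on ((*s) \<i>) ((*s) \<i>) f S"
proof -
  have "(\<forall>v. D (\<i> *s v) = \<i> *s D v) \<longleftrightarrow> (\<forall>c v. D (c *s v) = c *s D v)"
    if "(f has_derivative D) (at x)" for D :: "complex ^ 'a \<Rightarrow> complex ^ 'b" and x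
  proof
    assume *: "\<forall>v. D (\<i> *s v) = \<i> *s D v"
    interpret bounded_linear D using that by (rule has_derivative_bounded_linear)
    show "\<forall>c v. D (c *s v) = c *s D v"
    proof (intro allI)
      fix c v
      have "D (c *s v) = D (Re c *\<^sub>R v + Im c *\<^sub>R (\<i> *s v))"
        by (rule arg_cong[OF vec_scale_eq])
      also have "\<dots> = Re c *\<^sub>R D v + Im c *\<^sub>R (\<i> *s D v)"
        by (simp only: add scaleR *)
      also have "\<dots> = c *s D v" by (rule vec_scale_eq[symmetric])
      finally show "D (c *s v) = c *s D v" .
    qed
  qed auto
  note iff = this
  show ?thesis unfolding holomorphic_map_on_def cdiff_on_def
    by (rule ball_cong[OF refl], rule ex_cong1, rule conj_cong[OF refl], rule sym, erule iff)
qed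

lemma derivative_vec_expansion:
  assumes "hol_on ((*s) \<i>) (h :: complex ^ 'n \<Rightarrow> complex) O'" "y \<in> O'"
  shows "frechet_derivative h (at y) v
           = (\<Sum>i\<in>UNIV. v $ i * lie_deriv (\<lambda>_. axis i 1) h y)"
proof -
  let ?D = "frechet_derivative h (at y)"
  interpret bounded_linear ?D by (rule cdiff_on_linear_derivative[OF assms])
  have D: "?D (c *s u) = c * ?D u" for c u
  proof -
    have "?D (c *s u) = ?D (Re c *\<^sub>R u + Im c *\<^sub>R (\<i> *s u))" by (rule arg_cong[OF vec_scale_eq])
    also have "\<dots> = Re c *\<^sub>R ?D u + Im c *\<^sub>R (\<i> * ?D u)"
      by (simp only: add scaleR cdiff_on_commute[OF assms])
    also have "\<dots> = (of_real (Re c) + \<i> * of_real (Im c)) * ?D u"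
      by (simp add: scaleR_conv_of_real distrib_right)
    also have "\<dots> = c * ?D u" by (simp only: complex_eq[symmetric])
    finally show ?thesis .
  qed
  have "?D v = ?D (\<Sum>i\<in>UNIV. (v $ i) *s axis i 1)" by (simp add: basis_expansion)
  then show ?thesis by (simp add: sum D lie_deriv_def)
qed

lemma lie_deriv_compose:
  fixes h :: "complex ^ 'n \<Rightarrow> complex"
  assumes Z: "\<And>i. hol_on J (\<lambda>u. Z u $ i) S" and h: "hol_on ((*s) \<i>) h O'"
    and ZS: "\<And>u. u \<in> S \<Longrightarrow> Z u \<in> O'" and w: "w \<in> S"
  shows "lie_deriv a (\<lambda>u. h (Z u)) w
           = (\<Sum>i\<in>UNIV. lie_deriv a (\<lambda>u. Z u $ i) w * lie_deriv (\<lambda>_. axis i 1) h (Z w))"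
proof -
  have Z': "cdiff_on J ((*s) \<i>) Z S" using Z cdiff_on_vec_iff by blast
  note dZ = cdiff_on_has_derivative[OF Z' w]
  have "frechet_derivative (\<lambda>u. Z u $ i) (at w) = (\<lambda>v. frechet_derivative Z (at w) v $ i)" for i
    using bounded_linear.has_derivative[OF bounded_linear_vec_nth dZ] frechet_derivative_at by metis
  then have 1: "lie_deriv a (\<lambda>u. Z u $ i) w = frechet_derivative Z (at w) (a w) $ i" for i
    by (simp add: lie_deriv_def)
  have "frechet_derivative (\<lambda>u. h (Z u)) (at w)
      = (\<lambda>v. frechet_derivative h (at (Z w)) (frechet_derivative Z (at w) v))"
    using has_derivative_compose[OF dZ cdiff_on_has_derivative[OF h ZS[OF w]]] frechet_derivative_at
    by metis
  then have "lie_deriv a (\<lambda>u. h (Z u)) w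
      = frechet_derivative h (at (Z w)) (frechet_derivative Z (at w) (a w))"
    by (simp add: lie_deriv_def)
  also note derivative_vec_expansion[OF h ZS[OF w]]
  finally show ?thesis by (simp only: 1)
qed

lemma hol_on_chain_has_field_derivative:
  fixes h :: "complex ^ 'n \<Rightarrow> complex"
  assumes h: "hol_on ((*s) \<i>) h O'" and E: "\<And>i. ((\<lambda>t. E t $ i) has_field_derivative E' $ i) (at t)"
    and t: "E t \<in> O'"
  shows "((\<lambda>t. h (E t)) has_field_derivative
           (\<Sum>i\<in>UNIV. E' $ i * lie_deriv (\<lambda>_. axis i 1) h (E t))) (at t)"
proof -
  have "((\<lambda>t. E t) has_derivative (\<lambda>s. s *s E')) (at t)"
  proof (subst has_derivative_componentwise_within, intro ballI)
    fix b :: "complex ^ 'n" assume "b \<in> Basis"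
    then obtain i c where b: "b = axis i c" by (auto simp: Basis_vec_def)
    have "((\<lambda>t. E t $ i) has_derivative (\<lambda>s. s * E' $ i)) (at t)"
      using E[of i] by (simp add: has_field_derivative_def mult.commute[of "E' $ i"] mult_commute_abs)
    then show "((\<lambda>x. E x \<bullet> b) has_derivative (\<lambda>x. (x *s E') \<bullet> b)) (at t)"
      unfolding b inner_axis by (auto intro: has_derivative_inner_left)
  qed
  from has_derivative_compose[OF this cdiff_on_has_derivative[OF h t]]
  have "((\<lambda>t. h (E t)) has_derivative
      (\<lambda>s. \<Sum>i\<in>UNIV. (s *s E') $ i * lie_deriv (\<lambda>_. axis i 1) h (E t))) (at t)"
    unfolding derivative_vec_expansion[OF h t] .
  moreover have "(\<lambda>s. \<Sum>i\<in>UNIV. (s *s E') $ i * lie_deriv (\<lambda>_. axis i 1) h (E t))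
      = (*) (\<Sum>i\<in>UNIV. E' $ i * lie_deriv (\<lambda>_. axis i 1) h (E t))"
    by (rule ext) (simp add: sum_distrib_left sum_distrib_right mult_ac)
  ultimately show ?thesis unfolding has_field_derivative_def by simp
qed

context complex_space
begin

text \<open>The Lie series commutes with substitution into a holomorphic function \<open>h\<close>. Comparing the coefficients of
  order \<open>n\<close> for all \<open>h\<close> simultaneously, the derivative of \<open>h (E t)\<close> is the sum over \<open>i\<close> of the derivative of \<open>E t $ i\<close>
  times the \<open>i\<close>-th partial derivative of \<open>h\<close> at \<open>E t\<close>. The lower coefficients of the latter are
  known by induction, and multiplicativity recombines the sum into the Lie series of the derivative of
  \<open>h \<circ> Z\<close> along \<open>a\<close>.\<close>

lemma lie_fps_compose:
  fixes h :: "complex ^ 'n \<Rightarrow> complex"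
  assumes S: "open S" "w \<in> S" and a: "cdiff_on J J a S"
    and Z: "\<And>i. hol_on J (\<lambda>u. Z u $ i) S"
    and O': "open O'" "\<And>u. u \<in> S \<Longrightarrow> Z u \<in> O'" and h: "hol_on ((*s) \<i>) h O'"
    and E: "\<And>i. (\<lambda>t. E t $ i) has_fps_expansion lie_fps a (\<lambda>u. Z u $ i) w"
  shows "(\<lambda>t. h (E t)) has_fps_expansion lie_fps a (\<lambda>u. h (Z u)) w"
proof -
  interpret V: complex_space "(*s) \<i> :: complex ^ 'n \<Rightarrow> complex ^ 'n" by (rule complex_space_vec)
  have E0: "E 0 = Z w"
    using has_fps_expansion_imp_0_eq_fps_nth_0[OF E] by (simp add: vec_eq_iff lie_fps_def)
  have E_an: "(\<lambda>t. E t $ i) analytic_on {0}" for i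
    using E has_fps_expansion_imp_analytic_0 by blast
  have ev_diff: "\<forall>\<^sub>F t in nhds 0. \<forall>i. ((\<lambda>t. E t $ i) has_field_derivative deriv (\<lambda>t. E t $ i) t) (at t)"
  proof (rule eventually_all_finite)
    fix i
    obtain e where e: "e > 0" "(\<lambda>t. E t $ i) holomorphic_on ball 0 e"
      using E_an[of i] by (auto simp: analytic_at_ball)
    show "\<forall>\<^sub>F t in nhds 0. ((\<lambda>t. E t $ i) has_field_derivative deriv (\<lambda>t. E t $ i) t) (at t)"
      using holomorphic_derivI[OF e(2) open_ball] e(1) unfolding eventually_nhds
      by (intro exI[of _ "ball 0 e"]) auto
  qed
  have "isCont (\<lambda>t. E t $ i) 0" for i
    using E has_fps_expansion_imp_continuous by blast
  then have "isCont E 0" unfolding isCont_def using vec_tendstoI by blast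
  then have ev_in: "\<forall>\<^sub>F t in nhds 0. E t \<in> O'"
    unfolding isCont_def tendsto_at_iff_tendsto_nhds
    by (rule topological_tendstoD) (use O' S E0 in auto)
  have an: "(\<lambda>t. g (E t)) has_fps_expansion fps_expansion (\<lambda>t. g (E t)) 0"
    if g: "hol_on ((*s) \<i>) g O'" for g
  proof -
    have "\<forall>\<^sub>F t in nhds 0. (\<lambda>t. g (E t)) field_differentiable (at t)"
      using ev_diff ev_in
    proof eventually_elim
      case (elim t)
      then show ?case
        using hol_on_chain_has_field_derivative[OF g, where E' = "\<chi> i. deriv (\<lambda>t. E t $ i) t" and t = t and E = E]
        unfolding field_differentiable_def by auto
    qed
    then have "(\<lambda>t. g (E t)) analytic_on {0}"
      unfolding analytic_at_ball eventually_nhds_metric holomorphic_on_def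
      by (metis field_differentiable_at_within dist_commute mem_ball)
    then show ?thesis by (rule analytic_at_imp_has_fps_expansion_0)
  qed
  have "\<forall>g. hol_on ((*s) \<i>) g O' \<longrightarrow> fps_nth (fps_expansion (\<lambda>t. g (E t)) 0) n = fps_nth (lie_fps a (\<lambda>u. g (Z u)) w) n" for n
  proof (induction n rule: less_induct)
    case (less n)
    show ?case
    proof (intro allI impI)
      fix g assume g: "hol_on ((*s) \<i>) g O'"
      show "fps_nth (fps_expansion (\<lambda>t. g (E t)) 0) n = fps_nth (lie_fps a (\<lambda>u. g (Z u)) w) n"
      proof (cases n)
        case 0
        then show ?thesis by (simp add: fps_expansion_def lie_fps_def E0)
      next
        case (Suc m)
        define D where "D i = lie_deriv (\<lambda>_. axis i 1) g" for i
        have D: "hol_on ((*s) \<i>) (D i) O'" for i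
          unfolding D_def by (rule V.hol_on_lie_deriv[OF g _ O'(1)]) auto
        have ZO: "cdiff_on J ((*s) \<i>) Z S" using Z cdiff_on_vec_iff by blast
        have DZ: "hol_on J (\<lambda>u. D i (Z u)) S" for i
          by (rule cdiff_on_compose[OF ZO D]) (use O' in auto)
        have XZ: "hol_on J (lie_deriv a (\<lambda>u. Z u $ i)) S" for i
          by (rule hol_on_lie_deriv[OF Z a S(1)])
        let ?P = "\<Sum>i\<in>UNIV. fps_deriv (lie_fps a (\<lambda>u. Z u $ i) w) * fps_expansion (\<lambda>t. D i (E t)) 0"
        have 1: "(\<lambda>t. \<Sum>i\<in>UNIV. deriv (\<lambda>t. E t $ i) t * D i (E t)) has_fps_expansion ?P"
          by (intro has_fps_expansion_sum has_fps_expansion_mult has_fps_expansion_deriv E an D)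
        have 2: "\<forall>\<^sub>F t in nhds 0. (\<Sum>i\<in>UNIV. deriv (\<lambda>t. E t $ i) t * D i (E t)) = deriv (\<lambda>t. g (E t)) t"
          using ev_diff ev_in
        proof eventually_elim
          case (elim t)
          then show ?case
            using hol_on_chain_has_field_derivative[OF g, where E' = "\<chi> i. deriv (\<lambda>t. E t $ i) t" and t = t and E = E]
            by (intro DERIV_imp_deriv[symmetric]) (auto simp: D_def)
        qed
        have "deriv (\<lambda>t. g (E t)) has_fps_expansion ?P"
          by (rule has_fps_expansion_cong[THEN iffD1, OF 2 refl 1])
        then have P: "fps_deriv (fps_expansion (\<lambda>t. g (E t)) 0) = ?P"
          using has_fps_expansion_deriv[OF an[OF g]] fps_expansion_unique_complex by blast
        have "of_nat n * fps_nth (fps_expansion (\<lambda>t. g (E t)) 0) n = fps_nth ?P m"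
          using arg_cong[OF P, of "\<lambda>f. fps_nth f m"] by (simp add: Suc)
        also have "\<dots> = fps_nth (\<Sum>i\<in>UNIV. fps_deriv (lie_fps a (\<lambda>u. Z u $ i) w) * lie_fps a (\<lambda>u. D i (Z u)) w) m"
          unfolding fps_sum_nth fps_mult_nth using less D Suc by (intro sum.cong refl) auto
        also have "(\<Sum>i\<in>UNIV. fps_deriv (lie_fps a (\<lambda>u. Z u $ i) w) * lie_fps a (\<lambda>u. D i (Z u)) w)
           = (\<Sum>i\<in>UNIV. lie_fps a (\<lambda>u. lie_deriv a (\<lambda>u. Z u $ i) u * D i (Z u)) w)"
          by (simp add: fps_deriv_lie_fps lie_fps_mult[OF XZ DZ a S])
        also have "\<dots> = lie_fps a (\<lambda>u. \<Sum>i\<in>UNIV. lie_deriv a (\<lambda>u. Z u $ i) u * D i (Z u)) w"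
          by (rule lie_fps_sum[OF _ a S, symmetric]) (auto intro: hol_on_mult XZ DZ)
        also have "\<dots> = lie_fps a (lie_deriv a (\<lambda>u. g (Z u))) w"
          by (rule lie_fps_cong[OF S]) (simp add: lie_deriv_compose[OF Z g O'(2)] D_def)
        also have "fps_nth \<dots> m = of_nat n * fps_nth (lie_fps a (\<lambda>u. g (Z u)) w) n"
          by (simp add: fps_deriv_lie_fps[symmetric] Suc)
        finally show ?thesis using Suc by (metis mult_cancel_left of_nat_neq_0)
      qed
    qed
  qed
  then have "fps_expansion (\<lambda>t. h (E t)) 0 = lie_fps a (\<lambda>u. h (Z u)) w"
    using h by (intro fps_ext) auto
  then show ?thesis using an[OF h] by simp
qed

end

section \<open>Real analytic maps are the restrictions of holomorphic maps\<close>

text \<open>The complexification of a Euclidean space consists of the pairs \<open>(u, v)\<close>, standing for \<open>u + iv\<close>; here is the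
  multiplication by the imaginary unit.\<close>

definition cJ :: "'e::real_vector \<times> 'e \<Rightarrow> 'e \<times> 'e" where
  "cJ w = (- snd w, fst w)"

lemma complex_space_cJ: "complex_space (cJ :: 'e::euclidean_space \<times> 'e \<Rightarrow> 'e \<times> 'e)"
proof (rule complex_space.intro)
  show "linear (cJ :: 'e \<times> 'e \<Rightarrow> 'e \<times> 'e)"
    by (rule linearI) (auto simp: cJ_def)
  fix s t :: real and v :: "'e \<times> 'e"
  obtain a b where v: "v = (a, b)" by fastforce
  have "(norm (s *\<^sub>R v + t *\<^sub>R cJ v))\<^sup>2 = (norm (s *\<^sub>R a - t *\<^sub>R b))\<^sup>2 + (norm (s *\<^sub>R b + t *\<^sub>R a))\<^sup>2"
    by (simp add: v cJ_def norm_Pair)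
  also have "\<dots> = (s\<^sup>2 + t\<^sup>2) * ((norm a)\<^sup>2 + (norm b)\<^sup>2)"
    unfolding power2_norm_eq_inner
    by (simp add: inner_diff_left inner_diff_right inner_add_left inner_add_right inner_commute[of b a]
        power2_eq_square algebra_simps)
  also have "\<dots> = (sqrt (s\<^sup>2 + t\<^sup>2) * norm v)\<^sup>2"
    by (simp add: v norm_Pair power_mult_distrib)
  finally show "norm (s *\<^sub>R v + t *\<^sub>R cJ v) = sqrt (s\<^sup>2 + t\<^sup>2) * norm v"
    by (rule power2_eq_imp_eq) auto
qed

interpretation cJ: complex_space cJ
  by (rule complex_space_cJ)

lemma cJ_0 [simp]: "cJ 0 = 0" by (simp add: cJ_def zero_prod_def)

text \<open>The complex linear extension of the coordinate \<open>\<lambda>u. u \<bullet> b\<close>.\<close>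

definition ccoord :: "'e::euclidean_space \<Rightarrow> 'e \<times> 'e \<Rightarrow> complex" where
  "ccoord b w = Complex (fst w \<bullet> b) (snd w \<bullet> b)"

lemma bounded_linear_ccoord: "bounded_linear (ccoord b)"
  by (rule linear_conv_bounded_linear[THEN iffD1], rule linearI)
     (auto simp: ccoord_def complex_eq_iff inner_add_left)

lemma hol_on_ccoord: "hol_on cJ (ccoord b) S"
  by (rule cdiff_on_linear[OF bounded_linear_ccoord]) (auto simp: ccoord_def cJ_def complex_eq_iff)

lemma norm_ccoord_le:
  assumes "b \<in> Basis" shows "norm (ccoord b w) \<le> norm w"
proof -
  have "(fst w \<bullet> b)\<^sup>2 \<le> (norm (fst w))\<^sup>2" "(snd w \<bullet> b)\<^sup>2 \<le> (norm (snd w))\<^sup>2"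
    using Basis_le_norm[OF assms] by (simp_all add: abs_le_square_iff[symmetric])
  then show ?thesis by (cases w) (auto simp: ccoord_def cmod_def norm_Pair intro!: real_sqrt_le_mono)
qed

subsection \<open>Elementary closure properties\<close>

lemma real_analytic_at_cong:
  assumes "real_analytic_at f p" "open S" "p \<in> S" "\<And>x. x \<in> S \<Longrightarrow> f x = g x"
  shows "real_analytic_at g p"
proof -
  obtain a r where r: "r > 0" "\<And>x. x \<in> ball p r \<Longrightarrow>
      ((\<lambda>\<alpha>. (\<Prod>b\<in>Basis. ((x - p) \<bullet> b) ^ \<alpha> b) *\<^sub>R a \<alpha>) has_sum f x) (Basis \<rightarrow>\<^sub>E (UNIV :: nat set))"
    using assms(1) unfolding real_analytic_at_def by blast
  obtain e where e: "e > 0" "ball p e \<subseteq> S" using assms(2,3) open_contains_ball by blast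
  show ?thesis unfolding real_analytic_at_def
  proof (intro exI conjI ballI)
    show "min r e > 0" using r e by simp
    fix x assume "x \<in> ball p (min r e)"
    then have "x \<in> ball p r" "x \<in> S" using e by auto
    then show "((\<lambda>\<alpha>. (\<Prod>b\<in>Basis. ((x - p) \<bullet> b) ^ \<alpha> b) *\<^sub>R a \<alpha>) has_sum g x) (Basis \<rightarrow>\<^sub>E (UNIV :: nat set))"
      using r(2) assms(4) by metis
  qed
qed

lemma real_analytic_at_linear:
  assumes "real_analytic_at f p" "bounded_linear L"
  shows "real_analytic_at (\<lambda>x. L (f x)) p"
proof -
  interpret bounded_linear L by fact
  obtain a r where r: "r > 0" "\<And>x. x \<in> ball p r \<Longrightarrow>
      ((\<lambda>\<alpha>. (\<Prod>b\<in>Basis. ((x - p) \<bullet> b) ^ \<alpha> b) *\<^sub>R a \<alpha>) has_sum f x) (Basis \<rightarrow>\<^sub>E (UNIV :: nat set))"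
    using assms(1) unfolding real_analytic_at_def by blast
  show ?thesis unfolding real_analytic_at_def
  proof (intro exI conjI ballI)
    show "r > 0" by fact
    fix x assume "x \<in> ball p r"
    from has_sum_bounded_linear[OF assms(2) r(2)[OF this]]
    show "((\<lambda>\<alpha>. (\<Prod>b\<in>Basis. ((x - p) \<bullet> b) ^ \<alpha> b) *\<^sub>R L (a \<alpha>)) has_sum L (f x)) (Basis \<rightarrow>\<^sub>E (UNIV :: nat set))"
      by (simp add: o_def scaleR)
  qed
qed

lemma real_analytic_at_add:
  assumes "real_analytic_at f p" "real_analytic_at g p"
  shows "real_analytic_at (\<lambda>x. f x + g x) p"
proof -
  obtain a r where r: "r > 0" "\<And>x. x \<in> ball p r \<Longrightarrow>
      ((\<lambda>\<alpha>. (\<Prod>b\<in>Basis. ((x - p) \<bullet> b) ^ \<alpha> b) *\<^sub>R a \<alpha>) has_sum f x) (Basis \<rightarrow>\<^sub>E (UNIV :: nat set))"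
    using assms(1) unfolding real_analytic_at_def by blast
  obtain a' r' where r': "r' > 0" "\<And>x. x \<in> ball p r' \<Longrightarrow>
      ((\<lambda>\<alpha>. (\<Prod>b\<in>Basis. ((x - p) \<bullet> b) ^ \<alpha> b) *\<^sub>R a' \<alpha>) has_sum g x) (Basis \<rightarrow>\<^sub>E (UNIV :: nat set))"
    using assms(2) unfolding real_analytic_at_def by blast
  show ?thesis unfolding real_analytic_at_def
  proof (intro exI conjI ballI)
    show "min r r' > 0" using r r' by simp
    fix x assume "x \<in> ball p (min r r')"
    then have "x \<in> ball p r" "x \<in> ball p r'" by auto
    from has_sum_add[OF r(2)[OF this(1)] r'(2)[OF this(2)]]
    show "((\<lambda>\<alpha>. (\<Prod>b\<in>Basis. ((x - p) \<bullet> b) ^ \<alpha> b) *\<^sub>R (a \<alpha> + a' \<alpha>)) has_sum f x + g x) (Basis \<rightarrow>\<^sub>E (UNIV :: nat set))"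
      by (simp add: scaleR_add_right)
  qed
qed

lemma real_analytic_at_zero: "real_analytic_at (\<lambda>x. 0) p"
  unfolding real_analytic_at_def
  by (intro exI[of _ "\<lambda>_. 0"] exI[of _ 1]) (auto intro: has_sum_0)

lemma real_analytic_at_sum:
  assumes "finite I" "\<And>i. i \<in> I \<Longrightarrow> real_analytic_at (f i) p"
  shows "real_analytic_at (\<lambda>x. \<Sum>i\<in>I. f i x) p"
  using assms by (induction I) (auto intro: real_analytic_at_zero real_analytic_at_add)

lemma real_analytic_at_componentwise:
  "real_analytic_at f p \<longleftrightarrow> (\<forall>b\<in>Basis. real_analytic_at (\<lambda>x. complex_of_real (f x \<bullet> b)) p)"
proof (intro iffI ballI)
  fix b :: 'b assume "real_analytic_at f p"
  moreover have "bounded_linear (\<lambda>y. complex_of_real (y \<bullet> b))"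
    by (rule bounded_linear_compose[OF bounded_linear_of_real bounded_linear_inner_left])
  ultimately show "real_analytic_at (\<lambda>x. complex_of_real (f x \<bullet> b)) p"
    by (rule real_analytic_at_linear)
next
  assume *: "\<forall>b\<in>Basis. real_analytic_at (\<lambda>x. complex_of_real (f x \<bullet> b)) p"
  have "real_analytic_at (\<lambda>x. \<Sum>b\<in>Basis. Re (complex_of_real (f x \<bullet> b)) *\<^sub>R b) p"
  proof (intro real_analytic_at_sum finite_Basis)
    fix b :: 'b assume "b \<in> Basis"
    moreover have "bounded_linear (\<lambda>c. Re c *\<^sub>R b)"
      by (rule bounded_linear_compose[OF bounded_linear_scaleR_left bounded_linear_Re])
    ultimately show "real_analytic_at (\<lambda>x. Re (complex_of_real (f x \<bullet> b)) *\<^sub>R b) p"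
      using real_analytic_at_linear[of "\<lambda>x. complex_of_real (f x \<bullet> b)" p "\<lambda>c. Re c *\<^sub>R b"] * by simp
  qed
  then show "real_analytic_at f p" by (simp add: euclidean_representation)
qed

subsection \<open>From power series to holomorphic extensions\<close>

text \<open>Boxes of multi-indices exhaust all finite sets of multi-indices, which replaces the net of finite
  partial sums by a sequence.\<close>

lemma filterlim_box_finite_subsets:
  assumes "finite I"
  shows "filterlim (\<lambda>N::nat. I \<rightarrow>\<^sub>E {..N}) (finite_subsets_at_top (I \<rightarrow>\<^sub>E (UNIV :: nat set))) sequentially"
  unfolding filterlim_finite_subsets_at_top
proof (intro allI impI)
  fix X :: "('a \<Rightarrow> nat) set"
  assume X: "finite X \<and> X \<subseteq> I \<rightarrow>\<^sub>E UNIV"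
  define m where "m = Max (insert 0 ((\<lambda>(\<alpha>, i). \<alpha> i) ` (X \<times> I)))"
  have m: "\<alpha> i \<le> m" if "\<alpha> \<in> X" "i \<in> I" for \<alpha> i
    unfolding m_def by (rule Max_ge) (use that X assms in force)+
  have "X \<subseteq> I \<rightarrow>\<^sub>E {..N}" if "m \<le> N" for N
  proof
    fix \<alpha> assume \<alpha>: "\<alpha> \<in> X"
    then have "\<alpha> \<in> I \<rightarrow>\<^sub>E UNIV" using X by blast
    then show "\<alpha> \<in> I \<rightarrow>\<^sub>E {..N}"
      using m[OF \<alpha>] that by (auto simp: PiE_iff intro: order_trans)
  qed
  then show "\<forall>\<^sub>F N in sequentially. finite (I \<rightarrow>\<^sub>E {..N}) \<and> X \<subseteq> I \<rightarrow>\<^sub>E {..N} \<and> I \<rightarrow>\<^sub>E {..N} \<subseteq> I \<rightarrow>\<^sub>E UNIV"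
    unfolding eventually_sequentially using assms
    by (intro exI[of _ m]) (auto intro: finite_PiE simp: PiE_iff)
qed

text \<open>Evaluating the power series at the single point whose coordinates all exceed those of \<open>p\<close> by \<open>s\<close> gives
  a convergent majorant for it on the complex ball of radius \<open>s\<close>, because complex coordinates are
  bounded by the norm.\<close>

lemma real_analytic_at_imp_extension:
  fixes f :: "'e::euclidean_space \<Rightarrow> complex"
  assumes "real_analytic_at f p"
  shows "\<exists>r>0. \<exists>F. hol_on cJ F (ball (p, 0) r) \<and> (\<forall>x\<in>ball p r. F (x, 0) = f x)"
proof -
  let ?X = "Basis \<rightarrow>\<^sub>E (UNIV :: nat set) :: ('e \<Rightarrow> nat) set"
  obtain a r where r: "r > 0" "\<And>x. x \<in> ball p r \<Longrightarrow>
      ((\<lambda>\<alpha>. (\<Prod>b\<in>Basis. ((x - p) \<bullet> b) ^ \<alpha> b) *\<^sub>R a \<alpha>) has_sum f x) ?X"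
    using assms unfolding real_analytic_at_def by blast
  \<comment> \<open>The point \<open>p + s *\<^sub>R One\<close> has to lie in the ball of radius \<open>r\<close>.\<close>
  define s where "s = r / (2 * (norm (One :: 'e) + 1))"
  have n1: "2 * (norm (One :: 'e) + 1) > 0" by (smt (verit) norm_ge_zero)
  have s: "s > 0" "s \<le> r" "norm (s *\<^sub>R (One :: 'e)) < r"
  proof -
    show s0: "s > 0" unfolding s_def using r n1 by simp
    have eq: "s * (2 * (norm (One :: 'e) + 1)) = r" unfolding s_def using n1 by simp
    have h0: "s * norm (One :: 'e) \<ge> 0" using s0 by simp
    have "r = 2 * (s * norm (One :: 'e)) + 2 * s" using eq by (simp add: algebra_simps)
    then have "s \<le> r" "s * norm (One :: 'e) < r" using s0 h0 by linarith+
    then show "s \<le> r" "norm (s *\<^sub>R (One :: 'e)) < r" using s0 by simp_all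
  qed
  have "((\<lambda>\<alpha>. (\<Prod>b\<in>Basis. s ^ \<alpha> b) *\<^sub>R a \<alpha>) has_sum f (p + s *\<^sub>R One)) ?X"
  proof -
    have "p + s *\<^sub>R One \<in> ball p r" using s(3) by (simp add: dist_norm)
    from r(2)[OF this] show ?thesis
      by (rule has_sum_cong[THEN iffD1, rotated]) (auto intro!: arg_cong2[where f = scaleR] prod.cong)
  qed
  then have "(\<lambda>\<alpha>. (\<Prod>b\<in>Basis. s ^ \<alpha> b) *\<^sub>R a \<alpha>) summable_on ?X"
    unfolding summable_on_def by blast
  then have M: "(\<lambda>\<alpha>. norm ((\<Prod>b\<in>Basis. s ^ \<alpha> b) *\<^sub>R a \<alpha>)) summable_on ?X"
    by (simp only: summable_on_iff_abs_summable_on_complex)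
  define trm where "trm \<alpha> w = a \<alpha> * (\<Prod>b\<in>Basis. ccoord b (w - (p, 0)) ^ \<alpha> b)" for \<alpha> w
  define F where "F w = (\<Sum>\<^sub>\<infinity>\<alpha>\<in>?X. trm \<alpha> w)" for w
  have bound: "norm (trm \<alpha> w) \<le> norm ((\<Prod>b\<in>Basis. s ^ \<alpha> b) *\<^sub>R a \<alpha>)" if w: "w \<in> ball (p, 0) s" for \<alpha> w
  proof -
    have "norm (ccoord b (w - (p, 0))) \<le> s" if "b \<in> Basis" for b
      using norm_ccoord_le[OF that, of "w - (p, 0)"] w by (simp add: dist_norm norm_minus_commute)
    then have "(\<Prod>b\<in>Basis. norm (ccoord b (w - (p, 0))) ^ \<alpha> b) \<le> (\<Prod>b\<in>Basis. s ^ \<alpha> b)"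
      by (intro prod_mono) (auto intro: power_mono)
    moreover have "(\<Prod>b\<in>(Basis :: 'e set). s ^ \<alpha> b) \<ge> 0" using s(1) by (intro prod_nonneg) auto
    moreover have "norm (trm \<alpha> w) = norm (a \<alpha>) * (\<Prod>b\<in>Basis. norm (ccoord b (w - (p, 0))) ^ \<alpha> b)"
      unfolding trm_def norm_mult by (subst prod_norm[symmetric]) (simp add: norm_power)
    ultimately show ?thesis by (simp add: mult.commute mult_left_mono)
  qed
  have lim: "uniform_limit (ball (p, 0) s) (\<lambda>X w. \<Sum>\<alpha>\<in>X. trm \<alpha> w) F (finite_subsets_at_top ?X)"
    unfolding F_def by (rule Weierstrass_m_test_general[OF bound M])
  have "hol_on cJ F (ball (p, 0) s)"
  proof (rule cJ.hol_on_uniform_limit)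
    show "uniform_limit (ball (p, 0) s) (\<lambda>N w. \<Sum>\<alpha>\<in>Basis \<rightarrow>\<^sub>E {..N}. trm \<alpha> w) F sequentially"
      by (rule filterlim_compose[OF lim filterlim_box_finite_subsets]) simp
    fix N
    have "cdiff_on cJ cJ (\<lambda>w. w - (p, 0)) UNIV"
      using cdiff_on_add[OF cdiff_on_linear[OF bounded_linear_ident] cdiff_on_const[of cJ cJ "- (p, 0)"] cJ.linear_J]
      by (simp del: uminus_Pair)
    from cdiff_on_compose[OF this hol_on_ccoord]
    have "hol_on cJ (\<lambda>w. ccoord b (w - (p, 0))) (ball (p, 0) s)" for b
      using cdiff_on_subset by blast
    then show "hol_on cJ (\<lambda>w. \<Sum>\<alpha>\<in>Basis \<rightarrow>\<^sub>E {..N}. trm \<alpha> w) (ball (p, 0) s)"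
      unfolding trm_def
      by (intro cdiff_on_sum hol_on_cmult hol_on_prod hol_on_power) auto
  qed
  moreover have "F (x, 0) = f x" if x: "x \<in> ball p s" for x
  proof -
    have "ccoord b ((x, 0) - (p, 0)) = of_real ((x - p) \<bullet> b)" for b :: 'e
      by (simp add: ccoord_def complex_eq_iff)
    then have "trm \<alpha> (x, 0) = (\<Prod>b\<in>Basis. ((x - p) \<bullet> b) ^ \<alpha> b) *\<^sub>R a \<alpha>" for \<alpha>
      by (simp add: trm_def scaleR_conv_of_real mult.commute)
    then show ?thesis unfolding F_def using infsumI[OF r(2)[of x]] x s(2) by simp
  qed
  ultimately show ?thesis using s(1) by blast
qed

subsection \<open>From holomorphic extensions to power series\<close>

lemma (in complex_space) higher_deriv_slice:
  assumes F: "hol_on J F S" and S: "open S" and T: "open T" "\<And>c. c \<in> T \<Longrightarrow> w + scal c v \<in> S"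
    and c: "c \<in> T"
  shows "(deriv ^^ k) (\<lambda>c. F (w + scal c v)) c = (lie_deriv (\<lambda>_. v) ^^ k) F (w + scal c v)"
  using c
proof (induction k arbitrary: c)
  case (Suc k)
  have "hol_on J ((lie_deriv (\<lambda>_. v) ^^ k) F) S"
    by (rule hol_on_lie_deriv_power[OF F _ S]) (auto simp: linear_0[OF linear_J])
  from slice_has_field_derivative[OF this T(2)[OF Suc.prems]]
  have "((\<lambda>c. (lie_deriv (\<lambda>_. v) ^^ k) F (w + scal c v)) has_field_derivative
      (lie_deriv (\<lambda>_. v) ^^ Suc k) F (w + scal c v)) (at c)"
    by (simp add: lie_deriv_def)
  then have "((deriv ^^ k) (\<lambda>c. F (w + scal c v)) has_field_derivative
      (lie_deriv (\<lambda>_. v) ^^ Suc k) F (w + scal c v)) (at c)"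
    by (rule has_field_derivative_transform_within_open[OF _ T(1) Suc.prems]) (simp add: Suc.IH)
  then show ?case by (simp add: DERIV_imp_deriv)
qed auto

text \<open>The \<open>k\<close>-th derivative in a real direction expands into a sum over the lists of \<open>k\<close> basis vectors. Sums over
  lists need neither the symmetry of mixed partial derivatives nor multinomial coefficients; the
  multi-index of a list counts its entries.\<close>

abbreviation basis_lists :: "'e::euclidean_space list set" where
  "basis_lists \<equiv> {l. set l \<subseteq> Basis}"

definition list_monomial :: "'e::euclidean_space \<Rightarrow> 'e list \<Rightarrow> real" where
  "list_monomial u l = prod_list (map ((\<bullet>) u) l)"

definition list_deriv :: "('e::euclidean_space \<times> 'e \<Rightarrow> complex) \<Rightarrow> 'e list \<Rightarrow> 'e \<times> 'e \<Rightarrow> complex" where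
  "list_deriv F l = foldr lie_deriv (map (\<lambda>b _. (b, 0)) l) F"

definition multi_index :: "'e::euclidean_space list \<Rightarrow> 'e \<Rightarrow> nat" where
  "multi_index l = (\<lambda>b\<in>Basis. count_list l b)"

lemma multi_index_in_PiE: "multi_index l \<in> Basis \<rightarrow>\<^sub>E UNIV"
  by (simp add: multi_index_def)

lemma list_monomial_multi_index:
  assumes "set l \<subseteq> Basis"
  shows "list_monomial u l = (\<Prod>b\<in>Basis. (u \<bullet> b) ^ multi_index l b)"
  using assms
proof (induction l)
  case Nil
  then show ?case by (simp add: list_monomial_def multi_index_def)
next
  case (Cons c l)
  have "(\<Prod>b\<in>Basis. (u \<bullet> b) ^ multi_index (c # l) b)
      = (\<Prod>b\<in>Basis. (if c = b then u \<bullet> b else 1) * (u \<bullet> b) ^ multi_index l b)"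
    by (intro prod.cong) (auto simp: multi_index_def)
  also have "\<dots> = (u \<bullet> c) * (\<Prod>b\<in>Basis. (u \<bullet> b) ^ multi_index l b)"
    using Cons.prems by (simp add: prod.distrib prod.delta')
  finally show ?case using Cons by (simp add: list_monomial_def)
qed

lemma norm_list_monomial_le:
  assumes "set l \<subseteq> Basis"
  shows "\<bar>list_monomial u l\<bar> \<le> norm u ^ length l"
  using assms
proof (induction l)
  case (Cons b l)
  have "\<bar>u \<bullet> b\<bar> * \<bar>list_monomial u l\<bar> \<le> norm u * norm u ^ length l"
    using Cons by (intro mult_mono) (auto intro: Basis_le_norm)
  then show ?case by (simp add: list_monomial_def abs_mult)
qed (simp add: list_monomial_def)

lemma finite_multi_index_fibre: "finite {l \<in> basis_lists. multi_index l = \<alpha>}"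
proof (rule finite_subset)
  have "length l = (\<Sum>b\<in>Basis. \<alpha> b)" if "l \<in> basis_lists" "multi_index l = \<alpha>" for l
  proof -
    have "length l = (\<Sum>b\<in>Basis. count_list l b)"
      using sum_list_map_eq_sum_count2[of l Basis "\<lambda>_. 1"] that by (simp add: sum_list_triv)
    then show ?thesis using that(2) by (auto simp: multi_index_def)
  qed
  then show "{l \<in> basis_lists. multi_index l = \<alpha>} \<subseteq> {l. set l \<subseteq> Basis \<and> length l = (\<Sum>b\<in>Basis. \<alpha> b)}"
    by blast
  show "finite {l. set l \<subseteq> Basis \<and> length l = (\<Sum>b\<in>Basis. \<alpha> b)}"
    by (rule finite_lists_length_eq) simp
qed

lemma hol_on_list_deriv:
  "hol_on cJ F S \<Longrightarrow> open S \<Longrightarrow> hol_on cJ (list_deriv F l) S"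
  unfolding list_deriv_def by (rule cJ.hol_on_foldr_lie_deriv) auto

lemma real_direction_power_expansion:
  assumes F: "hol_on cJ F S" and S: "open S" "w \<in> S"
  shows "(lie_deriv (\<lambda>_. (u, 0)) ^^ k) F w
    = (\<Sum>l | set l \<subseteq> Basis \<and> length l = k. of_real (list_monomial u l) * list_deriv F l w)"
  using S(2)
proof (induction k arbitrary: w)
  case 0
  have "{l :: 'a list. set l \<subseteq> Basis \<and> length l = 0} = {[]}" by auto
  then show ?case by (simp add: list_monomial_def list_deriv_def)
next
  case (Suc k)
  let ?L = "{l :: 'a list. set l \<subseteq> Basis \<and> length l = k}"
  let ?G = "\<lambda>l w. of_real (list_monomial u l) * list_deriv F l w"
  have fin: "finite ?L" by (rule finite_lists_length_eq) simp
  have der: "((\<lambda>w. \<Sum>l\<in>?L. ?G l w) has_derivative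
     (\<lambda>v. \<Sum>l\<in>?L. of_real (list_monomial u l) * frechet_derivative (list_deriv F l) (at w) v)) (at w)"
    by (intro has_derivative_sum has_derivative_mult_right cdiff_on_has_derivative[OF hol_on_list_deriv[OF F S(1)] Suc.prems])
  have "(lie_deriv (\<lambda>_. (u, 0)) ^^ Suc k) F w = lie_deriv (\<lambda>_. (u, 0)) (\<lambda>w. \<Sum>l\<in>?L. ?G l w) w"
    using lie_deriv_cong[OF S(1) Suc.prems Suc.IH] by simp
  also have "\<dots> = (\<Sum>l\<in>?L. of_real (list_monomial u l) * frechet_derivative (list_deriv F l) (at w) (u, 0))"
    by (simp only: lie_deriv_def frechet_derivative_at[OF der, symmetric])
  also have "\<dots> = (\<Sum>l\<in>?L. \<Sum>b\<in>Basis. ?G (b # l) w)"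
  proof (intro sum.cong refl)
    fix l
    interpret bounded_linear "frechet_derivative (list_deriv F l) (at w)"
      by (rule cdiff_on_linear_derivative[OF hol_on_list_deriv[OF F S(1)] Suc.prems])
    have "(u, 0) = (\<Sum>b\<in>Basis. (u \<bullet> b) *\<^sub>R (b, 0 :: 'a))"
      by (intro prod_eqI) (simp_all add: fst_sum snd_sum euclidean_representation)
    then have "frechet_derivative (list_deriv F l) (at w) (u, 0)
        = (\<Sum>b\<in>Basis. of_real (u \<bullet> b) * list_deriv F (b # l) w)"
      by (simp only: sum scaleR) (simp add: list_deriv_def lie_deriv_def scaleR_conv_of_real)
    then show "of_real (list_monomial u l) * frechet_derivative (list_deriv F l) (at w) (u, 0)
        = (\<Sum>b\<in>Basis. ?G (b # l) w)"
      by (simp add: sum_distrib_left list_monomial_def mult_ac)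
  qed
  also have "\<dots> = (\<Sum>(l, b)\<in>?L \<times> Basis. ?G (b # l) w)"
    by (rule sum.cartesian_product)
  also have "\<dots> = (\<Sum>l\<in>(\<lambda>(l, b). b # l) ` (?L \<times> Basis). ?G l w)"
    by (subst sum.reindex) (auto simp: inj_on_def case_prod_unfold)
  also have "(\<lambda>(l, b). b # l) ` (?L \<times> Basis) = {l. set l \<subseteq> Basis \<and> length l = Suc k}"
    by (rule lists_length_Suc_eq[symmetric])
  finally show ?case .
qed

text \<open>By Taylor's formula on the complex line through \<open>(p, 0)\<close> and \<open>(p + u, 0)\<close>, the value \<open>f (p + u)\<close> is a series
  over lists of basis vectors. A list of length \<open>k\<close> contributes at most a multiple of \<open>(norm u * e / d) ^ k\<close>
  and there are \<open>N ^ k\<close> of them, where \<open>N\<close> is the dimension. So the series converges absolutely for small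
  \<open>u\<close> and may be rearranged according to multi-indices.\<close>

lemma extension_imp_real_analytic_at:
  fixes f :: "'e::euclidean_space \<Rightarrow> complex"
  assumes r: "r > 0" and F: "hol_on cJ F (ball (p, 0) r)" and f: "\<And>x. x \<in> ball p r \<Longrightarrow> F (x, 0) = f x"
  shows "real_analytic_at f p"
proof -
  have "continuous_on (ball (p, 0) r) F" using F by (rule cdiff_on_imp_continuous_on)
  then have "isCont F (p, 0)" using r by (simp add: continuous_on_eq_continuous_at)
  then obtain e where e: "e > 0" "\<And>w. dist w (p, 0) < e \<Longrightarrow> dist (F w) (F (p, 0)) < 1"
    unfolding continuous_at_eps_delta by (metis zero_less_one)
  define R where "R = min r e"
  have R: "R > 0" "R \<le> r" "R \<le> e" using r e by (auto simp: R_def)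
  define C where "C = norm (F (p, 0)) + 1"
  have C0: "C > 0" unfolding C_def by (smt (verit) norm_ge_zero)
  have C: "norm (F w) \<le> C" if "w \<in> ball (p, 0) R" for w
  proof -
    have "dist (F w) (F (p, 0)) < 1" using that R by (intro e) (auto simp: dist_commute)
    then show ?thesis
      unfolding C_def dist_norm using norm_triangle_ineq2[of "F w" "F (p, 0)"] by linarith
  qed
  have FR: "hol_on cJ F (ball (p, 0) R)"
    by (rule cdiff_on_subset[OF F subset_ball[OF R(2)]])
  define d where "d = R / 2"
  have d: "d > 0" "d < R" using R by (auto simp: d_def)
  define N where "N = real (card (Basis :: 'e set))"
  have N: "N \<ge> 1" unfolding N_def using DIM_positive[where 'a = 'e] by simp
  have Dl: "norm (list_deriv F l (p, 0)) \<le> C * fact (length l) * (exp 1 / d) ^ length l"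
    if l: "set l \<subseteq> Basis" for l
  proof -
    have fields: "cdiff_on cJ cJ a S \<and> norm (a y) \<le> 1" if "a \<in> set (map (\<lambda>b _. (b, 0)) l)" for a :: "'e \<times> 'e \<Rightarrow> 'e \<times> 'e" and S y
      using that l by (auto simp: norm_Pair)
    have "norm (foldr lie_deriv (map (\<lambda>b _. (b, 0)) l) F (p, 0))
        \<le> C * fact (length (map (\<lambda>b _ :: 'e \<times> 'e. (b, 0 :: 'e)) l))
            * (exp 1 * 1 / d) ^ length (map (\<lambda>b _ :: 'e \<times> 'e. (b, 0 :: 'e)) l)"
      by (rule cJ.foldr_lie_deriv_bound[OF FR C]) (use fields d in auto)
    then show ?thesis by (simp add: list_deriv_def)
  qed
  \<comment> \<open>For this radius the lists of length \<open>k\<close> together contribute at most \<open>C * (1 / 2) ^ k\<close>.\<close>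
  define \<epsilon> where "\<epsilon> = d / (2 * exp 1 * N)"
  have \<epsilon>: "\<epsilon> > 0" "\<epsilon> \<le> d"
  proof -
    show "\<epsilon> > 0" using d N by (simp add: \<epsilon>_def)
    have "1 * 1 \<le> (2 * exp 1) * N" using N exp_ge_add_one_self[of 1] by (intro mult_mono) auto
    then have "d * 1 \<le> d * (2 * exp 1 * N)" using d by (intro mult_left_mono) auto
    then show "\<epsilon> \<le> d" using N by (simp add: \<epsilon>_def divide_le_eq)
  qed
  let ?L = "\<lambda>k. {l :: 'e list. set l \<subseteq> Basis \<and> length l = k}"
  let ?X = "Basis \<rightarrow>\<^sub>E (UNIV :: nat set) :: ('e \<Rightarrow> nat) set"
  have finL: "finite (?L k)" for k by (rule finite_lists_length_eq) simp
  define t where "t u l = list_monomial u l *\<^sub>R (list_deriv F l (p, 0) / fact (length l))" for u l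
  define a where "a \<alpha> = (\<Sum>l | l \<in> basis_lists \<and> multi_index l = \<alpha>. list_deriv F l (p, 0) / fact (length l))" for \<alpha>
  have main: "((\<lambda>\<alpha>. (\<Prod>b\<in>Basis. (u \<bullet> b) ^ \<alpha> b) *\<^sub>R a \<alpha>) has_sum f (p + u)) ?X" if u: "norm u < \<epsilon>" for u
  proof -
    have tb: "norm (t u l) \<le> C * (norm u * exp 1 / d) ^ k" if "l \<in> ?L k" for l k
    proof -
      have "norm (list_deriv F l (p, 0)) / norm (fact (length l) :: complex)
          \<le> C * fact (length l) * (exp 1 / d) ^ length l / fact (length l)"
        unfolding norm_fact by (rule divide_right_mono[OF Dl]) (use that in auto)
      then have "norm (t u l) \<le> norm u ^ length l * (C * fact (length l) * (exp 1 / d) ^ length l / fact (length l))"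
        unfolding t_def norm_scaleR norm_divide using that
        by (intro mult_mono norm_list_monomial_le) auto
      then show ?thesis using that by (simp add: power_mult_distrib power_divide mult_ac)
    qed
    have sum_norm: "(\<Sum>l\<in>?L k. norm (t u l)) \<le> C * (1 / 2) ^ k" for k
    proof -
      have "(\<Sum>l\<in>?L k. norm (t u l)) \<le> real (card (?L k)) * (C * (norm u * exp 1 / d) ^ k)"
        by (rule sum_bounded_above[OF tb])
      also have "real (card (?L k)) = N ^ k"
        using card_lists_length_eq[of "Basis :: 'e set" k] by (simp add: N_def)
      also have "N ^ k * (C * (norm u * exp 1 / d) ^ k) = C * (N * (norm u * exp 1 / d)) ^ k"
        by (simp only: power_mult_distrib mult_ac)
      also have "\<dots> \<le> C * (1 / 2) ^ k"
      proof (intro mult_left_mono power_mono)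
        have "norm u * (2 * exp 1 * N) \<le> d" using u N by (simp add: \<epsilon>_def pos_less_divide_eq less_imp_le)
        then show "N * (norm u * exp 1 / d) \<le> 1 / 2" using d by (simp add: field_simps)
      qed (use C0 N d in auto)
      finally show ?thesis .
    qed
    define G where "G k = (\<Sum>l\<in>?L k. t u l)" for k
    have sG: "summable (\<lambda>k. norm (G k))"
    proof (rule summable_comparison_test)
      show "\<exists>N. \<forall>n\<ge>N. norm (norm (G n)) \<le> C * (1 / 2) ^ n"
        using order_trans[OF norm_sum sum_norm] unfolding G_def real_norm_def abs_norm_cancel by blast
    qed (intro summable_mult summable_geometric, simp)
    have "G sums f (p + u)"
    proof -
      define g where "g c = F ((p, 0) + cJ.scal c (u, 0))" for c
      have in_ball: "(p, 0) + cJ.scal c (u, 0) \<in> ball (p, 0) R" if c: "c \<in> ball 0 2" for c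
      proof -
        have "norm (cJ.scal c (u, 0)) = norm c * norm u" by (simp add: cJ.norm_scal norm_Pair)
        also have "\<dots> \<le> 2 * norm u" using c by (intro mult_right_mono) auto
        also have "\<dots> < R" using u \<epsilon> d_def by linarith
        finally show ?thesis by (simp add: dist_norm)
      qed
      have der: "(deriv ^^ k) g c = (lie_deriv (\<lambda>_. (u, 0)) ^^ k) F ((p, 0) + cJ.scal c (u, 0))"
        if "c \<in> ball 0 2" for c k
        unfolding g_def by (rule cJ.higher_deriv_slice[OF FR open_ball open_ball in_ball that])
      have "g holomorphic_on ball 0 2"
      proof (rule holomorphic_onI)
        fix c :: complex assume c: "c \<in> ball 0 2"
        show "g field_differentiable at c within ball 0 2"
          unfolding g_def field_differentiable_def
          using has_field_derivative_at_within[OF cJ.slice_has_field_derivative[OF FR in_ball[OF c]]] by blast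
      qed
      from holomorphic_power_series[OF this, of 1]
      have "(\<lambda>k. (deriv ^^ k) g 0 / fact k) sums g 1" by simp
      moreover have "(deriv ^^ k) g 0 / fact k = G k" for k
      proof -
        have "(deriv ^^ k) g 0 = (\<Sum>l\<in>?L k. of_real (list_monomial u l) * list_deriv F l (p, 0))"
          using der[of 0 k] real_direction_power_expansion[OF FR open_ball, where w = "(p, 0)" and u = u and k = k] R
          by (simp add: cJ.scal_def zero_prod_def)
        then show ?thesis
          by (simp add: G_def t_def sum_divide_distrib scaleR_conv_of_real)
      qed
      moreover have "g 1 = f (p + u)"
      proof -
        have "p + u \<in> ball p r" using u \<epsilon> d R by (simp add: dist_norm)
        from f[OF this] show ?thesis by (simp add: g_def cJ.scal_def)
      qed
      ultimately show ?thesis by simp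
    qed
    then have Gsum: "(G has_sum f (p + u)) UNIV"
      using sG norm_summable_imp_has_sum by blast
    have "(\<lambda>x. norm (case x of (k, l) \<Rightarrow> t u l)) summable_on (SIGMA k:UNIV. ?L k)"
    proof (rule Infinite_Sum.abs_summable_on_Sigma_iff[THEN iffD2], intro conjI ballI)
      fix k show "(\<lambda>l. norm (case (k, l) of (k, l) \<Rightarrow> t u l)) summable_on ?L k"
        by (rule summable_on_finite[OF finL])
      have nn: "0 \<le> (\<Sum>l\<in>?L k. norm (t u l))" for k by (intro sum_nonneg) auto
      have "summable (\<lambda>k. norm (\<Sum>l\<in>?L k. norm (t u l)))"
      proof (rule summable_comparison_test)
        show "\<exists>N. \<forall>n\<ge>N. norm (norm (\<Sum>l\<in>?L n. norm (t u l))) \<le> C * (1 / 2) ^ n"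
          using sum_norm nn by (auto simp: abs_of_nonneg)
      qed (intro summable_mult summable_geometric, simp)
      then have "(\<lambda>k. norm (\<Sum>l\<in>?L k. norm (t u l))) summable_on UNIV"
        using summable_on_UNIV_nonneg_real_iff[of "\<lambda>k. norm (\<Sum>l\<in>?L k. norm (t u l))"] by simp
      then show "(\<lambda>k. norm (\<Sum>\<^sub>\<infinity>l\<in>?L k. norm (case (k, l) of (k, l) \<Rightarrow> t u l))) summable_on UNIV"
        by (simp add: infsum_finite[OF finL])
    qed
    then have "(\<lambda>(k, l). t u l) summable_on (SIGMA k:UNIV. ?L k)"
      by (rule abs_summable_summable)
    then have "((\<lambda>(k, l). t u l) has_sum f (p + u)) (SIGMA k:UNIV. ?L k)"
      by (intro has_sum_SigmaI[OF _ Gsum]) (auto simp: G_def intro: has_sum_finite[OF finL])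
    then have 1: "((\<lambda>(k, l). t u l) has_sum f (p + u)) (SIGMA k:UNIV. ?L k)" .
    have bij: "bij_betw (\<lambda>(k, l). (multi_index l, l)) (SIGMA k:UNIV. ?L k)
                (SIGMA \<alpha>:?X. {l \<in> basis_lists. multi_index l = \<alpha>})"
      by (rule bij_betwI[where g = "\<lambda>(\<alpha>, l). (length l, l)"]) (use multi_index_in_PiE in auto)
    have 2: "((\<lambda>(\<alpha>, l). t u l) has_sum f (p + u)) (SIGMA \<alpha>:?X. {l \<in> basis_lists. multi_index l = \<alpha>})"
      using has_sum_reindex_bij_betw[OF bij, of "\<lambda>(\<alpha>, l). t u l"] 1 by (simp add: case_prod_unfold)
    show ?thesis
    proof (rule has_sum_SigmaD[OF 2])
      fix \<alpha> assume "\<alpha> \<in> ?X"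
      have "(\<Prod>b\<in>Basis. (u \<bullet> b) ^ \<alpha> b) *\<^sub>R a \<alpha> = (\<Sum>l | l \<in> basis_lists \<and> multi_index l = \<alpha>. t u l)"
        unfolding a_def scaleR_sum_right t_def
        by (intro sum.cong refl) (auto simp: list_monomial_multi_index)
      then show "((\<lambda>l. case (\<alpha>, l) of (\<alpha>, l) \<Rightarrow> t u l) has_sum (\<Prod>b\<in>Basis. (u \<bullet> b) ^ \<alpha> b) *\<^sub>R a \<alpha>)
              {l \<in> basis_lists. multi_index l = \<alpha>}"
        using has_sum_finite[OF finite_multi_index_fibre, of "t u" \<alpha>] by simp
    qed
  qed
  show ?thesis unfolding real_analytic_at_def
  proof (intro exI conjI ballI)
    show "\<epsilon> > 0" by fact
    fix x assume "x \<in> ball p \<epsilon>"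
    then show "((\<lambda>\<alpha>. (\<Prod>b\<in>Basis. ((x - p) \<bullet> b) ^ \<alpha> b) *\<^sub>R a \<alpha>) has_sum f x) ?X"
      using main[of "x - p"] by (simp add: dist_norm norm_minus_commute)
  qed
qed

subsection \<open>Composition and inverses\<close>

theorem real_analytic_at_iff_extension:
  fixes f :: "'e::euclidean_space \<Rightarrow> complex"
  shows "real_analytic_at f p \<longleftrightarrow>
    (\<exists>r>0. \<exists>F. hol_on cJ F (ball (p, 0) r) \<and> (\<forall>x\<in>ball p r. F (x, 0) = f x))"
  using real_analytic_at_imp_extension[of f p] extension_imp_real_analytic_at[of _ _ p f] by metis

text \<open>The multiple of a real vector by a complex number, in the complexification.\<close>

definition cscale :: "'e::euclidean_space \<Rightarrow> complex \<Rightarrow> 'e \<times> 'e" where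
  "cscale b c = (Re c *\<^sub>R b, Im c *\<^sub>R b)"

lemma cdiff_on_cscale: "cdiff_on ((*) \<i>) cJ (cscale b) S"
proof (rule cdiff_on_linear)
  show "bounded_linear (cscale b)"
    by (rule linear_conv_bounded_linear[THEN iffD1], rule linearI)
       (auto simp: cscale_def scaleR_add_left)
qed (auto simp: cscale_def cJ_def)

lemma sum_cscale_ccoord: "(\<Sum>b\<in>Basis. cscale b (ccoord b w)) = w"
  by (intro prod_eqI) (simp_all add: cscale_def ccoord_def fst_sum snd_sum euclidean_representation)

theorem real_analytic_at_iff_complexification:
  fixes f :: "'e::euclidean_space \<Rightarrow> 'f::euclidean_space"
  shows "real_analytic_at f p \<longleftrightarrow>
    (\<exists>r>0. \<exists>F. cdiff_on cJ cJ F (ball (p, 0) r) \<and> (\<forall>x\<in>ball p r. F (x, 0) = (f x, 0)))"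
proof
  assume "real_analytic_at f p"
  then have "\<forall>b\<in>Basis. \<exists>r F. r > 0 \<and> hol_on cJ F (ball (p, 0) r) \<and> (\<forall>x\<in>ball p r. F (x, 0) = of_real (f x \<bullet> b))"
    unfolding real_analytic_at_componentwise[of f] real_analytic_at_iff_extension by blast
  then obtain r F where rF: "\<And>b. b \<in> Basis \<Longrightarrow> r b > 0" "\<And>b. b \<in> Basis \<Longrightarrow> hol_on cJ (F b) (ball (p, 0) (r b))"
      "\<And>b x. b \<in> Basis \<Longrightarrow> x \<in> ball p (r b) \<Longrightarrow> F b (x, 0) = of_real (f x \<bullet> b)"
    by metis
  define R where "R = Min (r ` Basis)"
  have R: "R > 0" "\<And>b. b \<in> Basis \<Longrightarrow> R \<le> r b"
    using rF(1) unfolding R_def by auto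
  define G where "G w = (\<Sum>b\<in>Basis. cscale b (F b w))" for w
  have "cdiff_on cJ cJ G (ball (p, 0) R)"
    unfolding G_def
  proof (rule cdiff_on_sum[OF _ cJ.linear_J])
    fix b :: 'f assume b: "b \<in> Basis"
    show "cdiff_on cJ cJ (\<lambda>w. cscale b (F b w)) (ball (p, 0) R)"
      by (rule cdiff_on_compose[OF cdiff_on_subset[OF rF(2)[OF b] subset_ball[OF R(2)[OF b]]] cdiff_on_cscale])
         (rule subset_UNIV)
  qed
  moreover have "G (x, 0) = (f x, 0)" if x: "x \<in> ball p R" for x
  proof -
    have "G (x, 0) = (\<Sum>b\<in>Basis. cscale b (of_real (f x \<bullet> b)))"
      unfolding G_def by (intro sum.cong refl arg_cong[where f = "cscale _"] rF(3)) (use x R(2) in fastforce)+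
    also have "\<dots> = (\<Sum>b\<in>Basis. cscale b (ccoord b (f x, 0)))"
      by (intro sum.cong refl) (simp add: ccoord_def complex_of_real_def)
    also have "\<dots> = (f x, 0)" by (rule sum_cscale_ccoord)
    finally show ?thesis .
  qed
  ultimately show "\<exists>r>0. \<exists>F. cdiff_on cJ cJ F (ball (p, 0) r) \<and> (\<forall>x\<in>ball p r. F (x, 0) = (f x, 0))"
    using R(1) by blast
next
  assume "\<exists>r>0. \<exists>F. cdiff_on cJ cJ F (ball (p, 0) r) \<and> (\<forall>x\<in>ball p r. F (x, 0) = (f x, 0))"
  then obtain r F where r: "r > 0" and F: "cdiff_on cJ cJ F (ball (p, 0) r)"
      "\<And>x. x \<in> ball p r \<Longrightarrow> F (x, 0) = (f x, 0)" by blast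
  show "real_analytic_at f p"
    unfolding real_analytic_at_componentwise[of f]
  proof
    fix b :: 'f assume "b \<in> Basis"
    have "hol_on cJ (\<lambda>w. ccoord b (F w)) (ball (p, 0) r)"
      by (rule cdiff_on_compose[OF F(1) hol_on_ccoord]) (rule subset_UNIV)
    then show "real_analytic_at (\<lambda>x. complex_of_real (f x \<bullet> b)) p"
      by (rule extension_imp_real_analytic_at[OF r]) (simp add: F(2) ccoord_def complex_of_real_def)
  qed
qed

lemma dist_Pair_0 [simp]: "dist (p, 0) (x, 0) = dist p x"
  by (simp add: dist_Pair_Pair)

lemma ball_Pair_0_iff: "(x, 0) \<in> ball (p, 0) r \<longleftrightarrow> x \<in> ball p r"
  by simp

text \<open>The composition of the complexifications is a complexification of the composition.\<close>

theorem real_analytic_at_compose: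
  assumes f: "real_analytic_at f p" and g: "real_analytic_at g (f p)"
  shows "real_analytic_at (\<lambda>x. g (f x)) p"
proof -
  obtain r F where r: "r > 0" and F: "cdiff_on cJ cJ F (ball (p, 0) r)"
      "\<And>x. x \<in> ball p r \<Longrightarrow> F (x, 0) = (f x, 0)"
    using f unfolding real_analytic_at_iff_complexification by blast
  obtain s G where s: "s > 0" and G: "cdiff_on cJ cJ G (ball (f p, 0) s)"
      "\<And>x. x \<in> ball (f p) s \<Longrightarrow> G (x, 0) = (g x, 0)"
    using g unfolding real_analytic_at_iff_complexification by blast
  have "isCont F (p, 0)"
    using cdiff_on_imp_continuous_on[OF F(1)] r by (simp add: continuous_on_eq_continuous_at)
  then obtain e where e: "e > 0" "\<And>w. dist w (p, 0) < e \<Longrightarrow> dist (F w) (F (p, 0)) < s"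
    unfolding continuous_at_eps_delta using s by metis
  define t where "t = min r e"
  have t: "t > 0" "t \<le> r" "t \<le> e" using r e by (auto simp: t_def)
  have into: "F w \<in> ball (f p, 0) s" if "w \<in> ball (p, 0) t" for w
    using e(2)[of w] that t F(2)[of p] r by (simp add: dist_commute)
  have "cdiff_on cJ cJ (\<lambda>w. G (F w)) (ball (p, 0) t)"
    by (rule cdiff_on_compose[OF cdiff_on_subset[OF F(1) subset_ball[OF t(2)]] G(1)]) (use into in blast)
  moreover have "G (F (x, 0)) = (g (f x), 0)" if x: "x \<in> ball p t" for x
  proof -
    have "x \<in> ball p r" using x t by simp
    then have "F (x, 0) = (f x, 0)" by (rule F(2))
    moreover have "f x \<in> ball (f p) s" using into[of "(x, 0)"] x calculation by (simp add: dist_Pair_Pair)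
    ultimately show ?thesis using G(2) by simp
  qed
  ultimately show ?thesis
    unfolding real_analytic_at_iff_complexification using t(1) by blast
qed

lemma has_derivative_real_slice:
  assumes "(F has_derivative F') (at (p, 0))"
  shows "((\<lambda>x. F (x, 0)) has_derivative (\<lambda>u. F' (u, 0))) (at p)"
proof -
  have "((\<lambda>x. (x, 0)) has_derivative (\<lambda>u. (u, 0))) (at p)"
    by (intro has_derivative_Pair has_derivative_ident has_derivative_const)
  from has_derivative_compose[OF this assms] show ?thesis .
qed

lemma real_analytic_at_imp_differentiable:
  assumes "real_analytic_at f p"
  shows "f differentiable (at p)"
proof -
  obtain r F where r: "r > 0" and F: "cdiff_on cJ cJ F (ball (p, 0) r)"
      "\<And>x. x \<in> ball p r \<Longrightarrow> F (x, 0) = (f x, 0)"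
    using assms unfolding real_analytic_at_iff_complexification by blast
  have "((\<lambda>x. fst (F (x, 0))) has_derivative (\<lambda>u. fst (frechet_derivative F (at (p, 0)) (u, 0)))) (at p)"
    using r by (intro has_derivative_fst has_derivative_real_slice cdiff_on_has_derivative[OF F(1)]) simp
  then have "(f has_derivative (\<lambda>u. fst (frechet_derivative F (at (p, 0)) (u, 0)))) (at p)"
    by (rule has_derivative_transform_within_open[OF _ open_ball[of p r]]) (use r F(2) in auto)
  then show ?thesis unfolding differentiable_def by blast
qed

lemma real_analytic_at_vec:
  fixes f :: "'e::euclidean_space \<Rightarrow> complex ^ 'n"
  assumes "\<And>i. real_analytic_at (\<lambda>x. f x $ i) p"
  shows "real_analytic_at f p"
proof -
  have "real_analytic_at (\<lambda>x. \<Sum>i\<in>UNIV. axis i (f x $ i)) p"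
  proof (rule real_analytic_at_sum[OF finite_class.finite_UNIV])
    fix i :: 'n
    have "bounded_linear (\<lambda>c :: complex. axis i c :: complex ^ 'n)"
      by (rule linear_conv_bounded_linear[THEN iffD1], rule linearI) (auto simp: vec_eq_iff axis_def)
    with assms show "real_analytic_at (\<lambda>x. axis i (f x $ i)) p"
      by (rule real_analytic_at_linear)
  qed
  moreover have "(\<Sum>i\<in>UNIV. axis i (f x $ i)) = f x" for x
    by (simp add: vec_eq_iff axis_def)
  ultimately show ?thesis by simp
qed

lemma real_analytic_at_vec_nth:
  "real_analytic_at f p \<Longrightarrow> real_analytic_at (\<lambda>x. f x $ i) p"
  by (rule real_analytic_at_linear[OF _ bounded_linear_vec_nth])

lemma hol_on_locally_bounded:
  assumes F: "cdiff_on J K F S" and S: "open S" "w \<in> S"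
  shows "\<exists>r C. r > 0 \<and> ball w r \<subseteq> S \<and> (\<forall>y\<in>ball w r. norm (F y) \<le> C)"
proof -
  have "isCont F w"
    using cdiff_on_imp_continuous_on[OF F] S continuous_on_eq_continuous_at by blast
  then obtain e where e: "e > 0" "\<And>y. dist y w < e \<Longrightarrow> dist (F y) (F w) < 1"
    unfolding continuous_at_eps_delta by (metis zero_less_one)
  obtain e' where e': "e' > 0" "ball w e' \<subseteq> S" using S open_contains_ball by blast
  have "norm (F y) \<le> norm (F w) + 1" if "y \<in> ball w (min e e')" for y
  proof -
    have "norm (F y - F w) < 1" using e(2)[of y] that by (simp add: dist_norm norm_minus_commute)
    then show ?thesis using norm_triangle_ineq2[of "F y" "F w"] by linarith
  qed
  moreover have "ball w (min e e') \<subseteq> S" using e'(2) by auto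
  ultimately show ?thesis using e(1) e'(1) by (metis min_less_iff_conj)
qed

lemma real_analytic_at_locally_lipschitz:
  assumes "real_analytic_at f p"
  shows "\<exists>r>0. \<exists>L\<ge>0. \<forall>x\<in>ball p r. \<forall>y\<in>ball p r. norm (f x - f y) \<le> L * norm (x - y)"
proof -
  have "\<exists>r L. r > 0 \<and> L \<ge> 0 \<and> (\<forall>x\<in>ball p r. \<forall>y\<in>ball p r. \<bar>(f x - f y) \<bullet> b\<bar> \<le> L * norm (x - y))"
    if b: "b \<in> Basis" for b
  proof -
    have "real_analytic_at (\<lambda>x. complex_of_real (f x \<bullet> b)) p"
      using assms b real_analytic_at_componentwise by blast
    then obtain r F where r: "r > 0" and F: "hol_on cJ F (ball (p, 0) r)"
        "\<And>x. x \<in> ball p r \<Longrightarrow> F (x, 0) = of_real (f x \<bullet> b)"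
      unfolding real_analytic_at_iff_extension by blast
    have "(p, 0) \<in> ball (p, 0 :: 'a) r" using r by simp
    from hol_on_locally_bounded[OF F(1) open_ball this]
    obtain s C where s: "s > 0" "ball (p, 0) s \<subseteq> ball (p, 0 :: 'a) r" and C: "\<And>y. y \<in> ball (p, 0) s \<Longrightarrow> norm (F y) \<le> C"
      by blast
    have C0: "C \<ge> 0" using order_trans[OF norm_ge_zero C[of "(p, 0)"]] s by simp
    have "\<bar>(f x - f y) \<bullet> b\<bar> \<le> C / (s / 2) * norm (x - y)" if xy: "x \<in> ball p (s/2)" "y \<in> ball p (s/2)" for x y
    proof -
      have sub: "x' \<in> ball p r" if "x' \<in> ball p (s/2)" for x'
      proof -
        have "(x', 0) \<in> ball (p, 0 :: 'a) s" using that s(1) by (simp add: dist_Pair_Pair)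
        then show ?thesis using s(2) by (metis ball_Pair_0_iff subsetD)
      qed
      have Fs: "hol_on cJ F (ball (p, 0) (s/2 + s/2))" using cdiff_on_subset[OF F(1) s(2)] by simp
      have "norm (F (x, 0) - F (y, 0)) \<le> C / (s / 2) * norm ((x, 0) - (y, 0 :: 'a))"
        by (rule cJ.hol_lipschitz[OF Fs]) (use C s(1) xy in auto)
      also have "F (x, 0) - F (y, 0) = of_real ((f x - f y) \<bullet> b)"
        using F(2) sub xy by (simp add: inner_diff_left)
      finally show ?thesis by (simp add: norm_Pair)
    qed
    moreover have "s / 2 > 0" "C / (s / 2) \<ge> 0" using s C0 by auto
    ultimately show ?thesis by blast
  qed
  then obtain r L where rL: "\<And>b. b \<in> Basis \<Longrightarrow> r b > 0" "\<And>b. b \<in> Basis \<Longrightarrow> L b \<ge> 0"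
      "\<And>b x y. b \<in> Basis \<Longrightarrow> x \<in> ball p (r b) \<Longrightarrow> y \<in> ball p (r b) \<Longrightarrow> \<bar>(f x - f y) \<bullet> b\<bar> \<le> L b * norm (x - y)"
    by metis
  define R where "R = Min (r ` Basis)"
  have R: "R > 0" "\<And>b. b \<in> Basis \<Longrightarrow> R \<le> r b"
    using rL(1) unfolding R_def by auto
  have "norm (f x - f y) \<le> (\<Sum>b\<in>Basis. L b) * norm (x - y)" if xy: "x \<in> ball p R" "y \<in> ball p R" for x y
  proof -
    have "norm (f x - f y) \<le> (\<Sum>b\<in>Basis. \<bar>(f x - f y) \<bullet> b\<bar>)" by (rule norm_le_l1)
    also have "\<dots> \<le> (\<Sum>b\<in>Basis. L b * norm (x - y))"
      by (intro sum_mono rL(3)) (use xy R(2) in fastforce)+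
    finally show ?thesis by (simp add: sum_distrib_right)
  qed
  moreover have "(\<Sum>b\<in>Basis. L b) \<ge> 0" using rL(2) by (rule sum_nonneg)
  ultimately show ?thesis using R(1) by blast
qed

text \<open>The derivative is complex linear, and on real vectors it is \<open>f'\<close>.\<close>

lemma complexified_derivative:
  assumes r: "r > 0" and F: "cdiff_on cJ cJ F (ball (p, 0) r)" "\<And>x. x \<in> ball p r \<Longrightarrow> F (x, 0) = (f x, 0)"
    and f': "(f has_derivative f') (at p)"
  shows "frechet_derivative F (at (p, 0)) (u, v) = (f' u, f' v)"
proof -
  let ?D = "frechet_derivative F (at (p, 0))"
  have p: "(p, 0) \<in> ball (p, 0 :: 'a) r" using r by simp
  interpret D: bounded_linear ?D by (rule cdiff_on_linear_derivative[OF F(1) p])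
  have "((\<lambda>x. F (x, 0)) has_derivative (\<lambda>u. ?D (u, 0))) (at p)"
    by (rule has_derivative_real_slice[OF cdiff_on_has_derivative[OF F(1) p]])
  moreover have "((\<lambda>x. F (x, 0)) has_derivative (\<lambda>u. (f' u, 0))) (at p)"
    by (rule has_derivative_transform_within_open[OF has_derivative_Pair[OF f' has_derivative_const] open_ball[of p r]])
       (use r F(2) in auto)
  ultimately have eq: "?D (u, 0) = (f' u, 0)" for u
    by (metis has_derivative_unique)
  have "(u, v) = (u, 0) + cJ (v, 0)" by (simp add: cJ_def)
  then have "?D (u, v) = ?D (u, 0) + cJ (?D (v, 0))"
    by (metis D.add cdiff_on_commute[OF F(1) p])
  then show ?thesis by (simp add: eq cJ_def)
qed

text \<open>The derivative of the complexification of \<open>g\<close> is the complexification of \<open>g'\<close>, hence invertible, and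
  the inverse of a complex linear map is complex linear. So the local inverse of the complexified map
  is holomorphic; on real points it coincides with \<open>h\<close>.\<close>

theorem real_analytic_at_inverse:
  fixes g :: "'e::euclidean_space \<Rightarrow> 'e"
  assumes g: "real_analytic_at g p" and g': "(g has_derivative g') (at p)" "inj g'"
    and S: "open S" "p \<in> S" and h: "\<And>x. x \<in> S \<Longrightarrow> h (g x) = x"
  shows "real_analytic_at h (g p)"
proof -
  obtain r G where r: "r > 0" and G: "cdiff_on cJ cJ G (ball (p, 0) r)"
      "\<And>x. x \<in> ball p r \<Longrightarrow> G (x, 0) = (g x, 0)"
    using g unfolding real_analytic_at_iff_complexification by blast
  define B where "B = ball (p, 0 :: 'e) r"
  have B: "open B" "(p, 0) \<in> B" using r by (auto simp: B_def)
  note GB = G(1)[folded B_def]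
  define DG where "DG w = Blinfun (frechet_derivative G (at w))" for w
  have DG: "blinfun_apply (DG w) = frechet_derivative G (at w)" if "w \<in> B" for w
    unfolding DG_def by (rule bounded_linear_Blinfun_apply[OF cdiff_on_linear_derivative[OF GB that]])
  have der: "(G has_derivative blinfun_apply (DG w)) (at w)" if "w \<in> B" for w
    using cdiff_on_has_derivative[OF GB that] DG[OF that] by simp
  have "continuous_on B DG"
  proof (rule continuous_on_blinfun_componentwise)
    fix i :: "'e \<times> 'e"
    have "continuous_on B (\<lambda>w. \<Sum>b\<in>Basis. cscale b (lie_deriv (\<lambda>_. i) (\<lambda>w. ccoord b (G w)) w))"
    proof (intro continuous_on_sum)
      fix b :: 'e
      have "hol_on cJ (\<lambda>w. ccoord b (G w)) B"
        by (rule cdiff_on_compose[OF GB hol_on_ccoord]) (rule subset_UNIV)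
      from cJ.hol_on_lie_deriv[OF this cdiff_on_const[of cJ, OF cJ_0] B(1)]
      have "hol_on cJ (lie_deriv (\<lambda>_. i) (\<lambda>w. ccoord b (G w))) B" .
      from cdiff_on_compose[OF this cdiff_on_cscale subset_UNIV]
      show "continuous_on B (\<lambda>w. cscale b (lie_deriv (\<lambda>_. i) (\<lambda>w. ccoord b (G w)) w))"
        by (rule cdiff_on_imp_continuous_on)
    qed
    moreover have "(\<Sum>b\<in>Basis. cscale b (lie_deriv (\<lambda>_. i) (\<lambda>w. ccoord b (G w)) w)) = blinfun_apply (DG w) i"
      if w: "w \<in> B" for w
    proof -
      have "frechet_derivative (\<lambda>w. ccoord b (G w)) (at w) = (\<lambda>v. ccoord b (blinfun_apply (DG w) v))" for b
        by (rule frechet_derivative_at[symmetric],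
            rule bounded_linear.has_derivative[OF bounded_linear_ccoord der[OF w]])
      then have "lie_deriv (\<lambda>_. i) (\<lambda>w. ccoord b (G w)) w = ccoord b (blinfun_apply (DG w) i)" for b
        by (simp add: lie_deriv_def)
      then show ?thesis by (simp add: sum_cscale_ccoord)
    qed
    ultimately show "continuous_on B (\<lambda>w. blinfun_apply (DG w) i)"
      by (simp cong: continuous_on_cong_simp)
  qed
  have Dp: "blinfun_apply (DG (p, 0)) (u, v) = (g' u, g' v)" for u v
    using complexified_derivative[OF r G g'(1)] DG[OF B(2)] by simp
  have lin: "linear g'" using g'(1) has_derivative_linear by blast
  obtain k where k: "linear k" "k \<circ> g' = id"
    using linear_injective_left_inverse[OF lin g'(2)] by blast
  have kg: "k (g' u) = u" for u using k(2) by (metis comp_apply id_apply)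
  define K where "K = Blinfun (\<lambda>w :: 'e \<times> 'e. (k (fst w), k (snd w)))"
  have "linear (\<lambda>w :: 'e \<times> 'e. (k (fst w), k (snd w)))"
    by (rule linearI) (simp_all add: linear_add[OF k(1)] linear_scale[OF k(1)])
  then have K: "blinfun_apply K w = (k (fst w), k (snd w))" for w
    unfolding K_def by (simp add: bounded_linear_Blinfun_apply linear_conv_bounded_linear)
  have "K o\<^sub>L DG (p, 0) = id_blinfun"
  proof (rule blinfun_eqI)
    fix w :: "'e \<times> 'e"
    show "blinfun_apply (K o\<^sub>L DG (p, 0)) w = blinfun_apply id_blinfun w"
      using Dp[of "fst w" "snd w"] by (simp add: K kg)
  qed
  from inverse_function_theorem[OF B(1) der \<open>continuous_on B DG\<close> B(2) this]
  obtain U V H H' where H: "open U" "U \<subseteq> B" "(p, 0) \<in> U" "open V" "G (p, 0) \<in> V" "homeomorphism U V G H"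
      "\<And>y. y \<in> V \<Longrightarrow> (H has_derivative (H' y)) (at y)"
      "\<And>y. y \<in> V \<Longrightarrow> H' y = inv (blinfun_apply (DG (H y)))"
      "\<And>y. y \<in> V \<Longrightarrow> bij (blinfun_apply (DG (H y)))" by metis
  have HU: "H y \<in> U" if "y \<in> V" for y using H(6) that unfolding homeomorphism_def by blast
  have HG: "H (G w) = w" if "w \<in> U" for w using H(6) that unfolding homeomorphism_def by blast
  have "cdiff_on cJ cJ H V"
    unfolding cdiff_on_def
  proof (intro ballI exI conjI allI)
    fix y v assume y: "y \<in> V"
    show "(H has_derivative H' y) (at y)" by (rule H(7)[OF y])
    let ?D = "blinfun_apply (DG (H y))"
    have HB: "H y \<in> B" using HU[OF y] H(2) by blast
    have comm: "?D (cJ u) = cJ (?D u)" for u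
      using cdiff_on_commute[OF GB HB] DG[OF HB] by simp
    have "?D (cJ (inv ?D v)) = cJ v"
      by (simp add: comm bij_is_surj[OF H(9)[OF y]] surj_f_inv_f)
    then have "inv ?D (cJ v) = cJ (inv ?D v)"
      by (metis H(9)[OF y] bij_inv_eq_iff)
    then show "H' y (cJ v) = cJ (H' y v)" by (simp add: H(8)[OF y])
  qed
  define S' where "S' = S \<inter> ball p r \<inter> (\<lambda>x. (x, 0)) -` U"
  have S': "open S'" "p \<in> S'"
  proof -
    have "open ((\<lambda>x :: 'e. (x, 0 :: 'e)) -` U)"
      by (rule open_vimage[OF H(1)]) (intro continuous_intros)
    then show "open S'" using S by (simp add: S'_def open_Int)
    show "p \<in> S'" using S H(3) r by (simp add: S'_def)
  qed
  have gS': "continuous_on S' g"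
  proof (rule continuous_on_eq)
    have "continuous_on B G" by (rule cdiff_on_imp_continuous_on[OF GB])
    then have "continuous_on S' (\<lambda>x. G (x, 0))"
      by (rule continuous_on_compose2) (auto intro!: continuous_intros simp: S'_def B_def)
    then show "continuous_on S' (\<lambda>x. fst (G (x, 0)))" by (rule continuous_on_fst)
  qed (use G(2) in \<open>auto simp: S'_def\<close>)
  have "inj_on g S'" by (rule inj_on_inverseI[of _ h]) (use h in \<open>auto simp: S'_def\<close>)
  from invariance_of_domain[OF gS' S'(1) this] have "open (g ` S')" .
  moreover have "g p \<in> g ` S'" using S'(2) by blast
  ultimately obtain e where e: "e > 0" "ball (g p) e \<subseteq> g ` S'" using open_contains_ball by blast
  have "(g p, 0) \<in> V" using H(5) G(2)[of p] r by simp
  then obtain e' where e': "e' > 0" "ball (g p, 0) e' \<subseteq> V" using H(4) open_contains_ball by blast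
  have "H (y, 0) = (h y, 0)" if y: "y \<in> ball (g p) (min e e')" for y
  proof -
    have "y \<in> ball (g p) e" using y by simp
    then obtain x where x: "x \<in> S'" "y = g x" using e(2) by blast
    have "H (G (x, 0)) = (x, 0)" by (rule HG) (use x(1) in \<open>simp add: S'_def\<close>)
    then show ?thesis using G(2)[of x] x h[of x] by (simp add: S'_def)
  qed
  moreover have "cdiff_on cJ cJ H (ball (g p, 0) (min e e'))"
    by (rule cdiff_on_subset[OF \<open>cdiff_on cJ cJ H V\<close>]) (use e'(2) in auto)
  ultimately show ?thesis
    unfolding real_analytic_at_iff_complexification using e(1) e'(1)
    by (intro exI[of _ "min e e'"] conjI exI[of _ H]) auto
qed

section \<open>Charts\<close>

abbreviation chart_inv :: "('m, 'c) chart \<Rightarrow> 'c \<Rightarrow> 'm" where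
  "chart_inv c \<equiv> inv_into (fst c) (snd c)"

lemma is_chart_iff:
  "is_chart c \<longleftrightarrow> open (fst c) \<and> open (snd c ` fst c) \<and>
     homeomorphism (fst c) (snd c ` fst c) (snd c) (chart_inv c)"
  by (cases c) (simp add: is_chart_def)

lemma chart_inv_left: "is_chart c \<Longrightarrow> q \<in> fst c \<Longrightarrow> chart_inv c (snd c q) = q"
  unfolding is_chart_iff homeomorphism_def by blast

lemma chart_inv_right: "\<xi> \<in> snd c ` S \<Longrightarrow> S \<subseteq> fst c \<Longrightarrow> snd c (chart_inv c \<xi>) = \<xi>"
  by (rule f_inv_into_f) blast

lemma chart_inv_in: "is_chart c \<Longrightarrow> S \<subseteq> fst c \<Longrightarrow> \<xi> \<in> snd c ` S \<Longrightarrow> chart_inv c \<xi> \<in> S"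
  using chart_inv_left by (metis (no_types, lifting) imageE subsetD)

lemma chart_inj: "is_chart c \<Longrightarrow> inj_on (snd c) (fst c)"
  by (rule inj_on_inverseI[of _ "chart_inv c"]) (rule chart_inv_left)

lemma chart_open: "is_chart c \<Longrightarrow> open (fst c)"
  unfolding is_chart_iff by blast

lemma chart_continuous: "is_chart c \<Longrightarrow> continuous_on (fst c) (snd c)"
  unfolding is_chart_iff homeomorphism_def by blast

lemma chart_inv_continuous: "is_chart c \<Longrightarrow> continuous_on (snd c ` fst c) (chart_inv c)"
  unfolding is_chart_iff homeomorphism_def by blast

lemma chart_open_image:
  assumes c: "is_chart c" and W: "open W" "W \<subseteq> fst c"
  shows "open (snd c ` W)"
proof -
  have "open (snd c ` fst c \<inter> chart_inv c -` W)"
    by (rule continuous_open_preimage[OF chart_inv_continuous[OF c]]) (use c W in \<open>auto simp: is_chart_iff\<close>)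
  moreover have "snd c ` fst c \<inter> chart_inv c -` W = snd c ` W"
  proof (intro equalityI subsetI)
    fix \<xi> assume "\<xi> \<in> snd c ` fst c \<inter> chart_inv c -` W"
    then show "\<xi> \<in> snd c ` W"
      by (metis IntE image_eqI vimageE chart_inv_right subset_refl)
  next
    fix \<xi> assume "\<xi> \<in> snd c ` W"
    then obtain q where "q \<in> W" "\<xi> = snd c q" by blast
    then show "\<xi> \<in> snd c ` fst c \<inter> chart_inv c -` W"
      using W(2) chart_inv_left[OF c, of q] by auto
  qed
  ultimately show ?thesis by simp
qed

lemma chart_open_preimage:
  assumes "is_chart c" "open S"
  shows "open (fst c \<inter> snd c -` S)"
  by (rule continuous_open_preimage[OF chart_continuous[OF assms(1)] chart_open[OF assms(1)] assms(2)])

lemma maximal_atlas_is_chart: "maximal_atlas P A \<Longrightarrow> c \<in> A \<Longrightarrow> is_chart c"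
  unfolding maximal_atlas_def by blast

lemma maximal_atlas_covers:
  assumes "maximal_atlas P A" obtains c where "c \<in> A" "q \<in> fst c"
  using assms unfolding maximal_atlas_def by blast

lemma maximal_atlas_transition:
  "maximal_atlas P A \<Longrightarrow> c \<in> A \<Longrightarrow> c' \<in> A \<Longrightarrow> P (transition c c') (snd c ` (fst c \<inter> fst c'))"
  unfolding maximal_atlas_def compatible_def by blast

lemma real_analytic_at_in_charts:
  assumes c: "is_chart c" "q \<in> fst c" and d: "is_chart d" "\<phi> q \<in> fst d"
    and \<phi>: "continuous_on UNIV \<phi>"
    and 1: "real_analytic_at (snd d \<circ> \<phi> \<circ> chart_inv c) (snd c q)"
    and 2: "real_analytic_at (g \<circ> chart_inv d) (snd d (\<phi> q))"
  shows "real_analytic_at (g \<circ> \<phi> \<circ> chart_inv c) (snd c q)"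
proof (rule real_analytic_at_cong)
  have q: "(snd d \<circ> \<phi> \<circ> chart_inv c) (snd c q) = snd d (\<phi> q)"
    by (simp add: chart_inv_left[OF c])
  show "real_analytic_at (\<lambda>\<xi>. (g \<circ> chart_inv d) ((snd d \<circ> \<phi> \<circ> chart_inv c) \<xi>)) (snd c q)"
    by (rule real_analytic_at_compose[OF 1]) (simp only: q 2)
  have "open (\<phi> -` fst d)"
    using \<phi> chart_open[OF d(1)] by (simp add: continuous_on_open_vimage)
  then show "open (snd c ` (fst c \<inter> \<phi> -` fst d))"
    using chart_open[OF c(1)] by (intro chart_open_image[OF c(1)]) auto
  show "snd c q \<in> snd c ` (fst c \<inter> \<phi> -` fst d)" using c d by auto
  fix \<xi> assume "\<xi> \<in> snd c ` (fst c \<inter> \<phi> -` fst d)"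
  from chart_inv_in[OF c(1) _ this] have "\<phi> (chart_inv c \<xi>) \<in> fst d" by auto
  then show "(g \<circ> chart_inv d) ((snd d \<circ> \<phi> \<circ> chart_inv c) \<xi>) = (g \<circ> \<phi> \<circ> chart_inv c) \<xi>"
    by (simp add: chart_inv_left[OF d(1)])
qed

lemma real_analytic_at_change_chart:
  assumes c: "is_chart c" "q \<in> fst c" and d: "is_chart d" "q \<in> fst d"
    and 1: "real_analytic_at (snd d \<circ> chart_inv c) (snd c q)"
    and 2: "real_analytic_at (g \<circ> chart_inv d) (snd d q)"
  shows "real_analytic_at (g \<circ> chart_inv c) (snd c q)"
  using real_analytic_at_in_charts[OF c d(1), of "\<lambda>x. x" g] d 1 2 by (simp add: o_def)

section \<open>Lie series on a manifold\<close>

lemma real_analytic_transition: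
  assumes "real_analytic_structure A" "c \<in> A" "c' \<in> A" "q \<in> fst c" "q \<in> fst c'"
  shows "real_analytic_at (snd c' \<circ> chart_inv c) (snd c q)"
  using maximal_atlas_transition[of real_analytic_on A c c'] assms
  unfolding real_analytic_structure_def real_analytic_on_def transition_def by auto

text \<open>The chart chosen in the definition of \<open>vf_apply\<close> is immaterial by the chain rule and the transformation law of
  the vector field.\<close>

lemma vf_apply_in_chart:
  assumes A: "real_analytic_structure A" and X: "real_analytic_vector_field A X"
    and c: "c \<in> A" "q \<in> fst c" and D: "((f \<circ> chart_inv c) has_derivative D) (at (snd c q))"
  shows "vf_apply A X f q = D (X c q)"
proof -
  define c' where "c' = (SOME c. c \<in> A \<and> q \<in> fst c)"
  have c': "c' \<in> A" "q \<in> fst c'"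
    using someI[of "\<lambda>c. c \<in> A \<and> q \<in> fst c" c] c unfolding c'_def by auto
  have ch: "is_chart c" "is_chart c'"
    using A c c' maximal_atlas_is_chart unfolding real_analytic_structure_def by blast+
  let ?T = "transition c' c"
  let ?T' = "frechet_derivative ?T (at (snd c' q))"
  have "?T differentiable (at (snd c' q))"
    using real_analytic_at_imp_differentiable[OF real_analytic_transition[OF A c'(1) c(1) c'(2) c(2)]]
    by (simp add: transition_def)
  then have T: "(?T has_derivative ?T') (at (snd c' q))"
    by (simp add: frechet_derivative_works)
  have Tq: "?T (snd c' q) = snd c q"
    by (simp add: transition_def chart_inv_left[OF ch(2) c'(2)])
  have Xc: "X c q = ?T' (X c' q)"
    by (rule X[unfolded real_analytic_vector_field_def, THEN conjunct1, rule_format, OF c'(1) c(1)])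
       (use c c' in blast)
  have "((\<lambda>\<xi>. (f \<circ> chart_inv c) (?T \<xi>)) has_derivative (\<lambda>v. D (?T' v))) (at (snd c' q))"
    by (rule has_derivative_compose[OF T]) (simp only: Tq D)
  then have "((f \<circ> chart_inv c') has_derivative (\<lambda>v. D (?T' v))) (at (snd c' q))"
  proof (rule has_derivative_transform_within_open)
    show "open (snd c' ` (fst c' \<inter> fst c))"
      by (rule chart_open_image[OF ch(2)]) (auto intro: chart_open ch)
    show "snd c' q \<in> snd c' ` (fst c' \<inter> fst c)" using c c' by auto
    fix \<xi> assume "\<xi> \<in> snd c' ` (fst c' \<inter> fst c)"
    from chart_inv_in[OF ch(2) _ this] have "chart_inv c' \<xi> \<in> fst c" by auto
    then show "(f \<circ> chart_inv c) (?T \<xi>) = (f \<circ> chart_inv c') \<xi>"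
      by (simp add: transition_def chart_inv_left[OF ch(1)])
  qed
  then have "frechet_derivative (f \<circ> chart_inv c') (at (snd c' q)) = (\<lambda>v. D (?T' v))"
    by (rule frechet_derivative_at[symmetric])
  then show ?thesis
    by (simp add: vf_apply_def c'_def[symmetric] Let_def Xc)
qed

definition complexified_field ::
    "(('m, real ^ 'd) chart \<Rightarrow> 'm \<Rightarrow> real ^ 'd) \<Rightarrow> ('m, real ^ 'd) chart \<Rightarrow> real ^ 'd \<Rightarrow> real \<Rightarrow>
     ((real ^ 'd) \<times> (real ^ 'd) \<Rightarrow> (real ^ 'd) \<times> (real ^ 'd)) \<Rightarrow> bool" where
  "complexified_field X c p r a \<longleftrightarrow>
     ball p r \<subseteq> snd c ` fst c \<and> cdiff_on cJ cJ a (ball (p, 0) r) \<and>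
     (\<forall>\<xi>\<in>ball p r. a (\<xi>, 0) = (X c (chart_inv c \<xi>), 0))"

lemma vf_apply_power_eq_lie_deriv:
  assumes A: "real_analytic_structure A" and X: "real_analytic_vector_field A X" and c: "c \<in> A"
    and a: "complexified_field X c p r a"
    and F: "hol_on cJ F (ball (p, 0) r)" "\<And>\<xi>. \<xi> \<in> ball p r \<Longrightarrow> F (\<xi>, 0) = f (chart_inv c \<xi>)"
    and \<xi>: "\<xi> \<in> ball p r"
  shows "(vf_apply A X ^^ k) f (chart_inv c \<xi>) = (lie_deriv a ^^ k) F (\<xi>, 0)"
  using \<xi>
proof (induction k arbitrary: \<xi>)
  case 0
  then show ?case using F(2) by simp
next
  case (Suc k)
  let ?G = "(lie_deriv a ^^ k) F" and ?g = "(vf_apply A X ^^ k) f"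
  have ch: "is_chart c"
    using A c maximal_atlas_is_chart unfolding real_analytic_structure_def by blast
  have in_img: "\<xi> \<in> snd c ` fst c" using a Suc.prems unfolding complexified_field_def by blast
  then have q: "chart_inv c \<xi> \<in> fst c" "snd c (chart_inv c \<xi>) = \<xi>"
    using chart_inv_in[OF ch subset_refl in_img] chart_inv_right[OF in_img subset_refl] by simp_all
  have a': "cdiff_on cJ cJ a (ball (p, 0) r)" using a unfolding complexified_field_def by blast
  have G: "hol_on cJ ?G (ball (p, 0) r)"
    by (rule cJ.hol_on_lie_deriv_power[OF F(1) a' open_ball])
  have "(\<xi>, 0) \<in> ball (p, 0) r" using Suc.prems by simp
  from has_derivative_real_slice[OF cdiff_on_has_derivative[OF G this]]
  have "((?g \<circ> chart_inv c) has_derivative (\<lambda>u. frechet_derivative ?G (at (\<xi>, 0)) (u, 0))) (at \<xi>)"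
    by (rule has_derivative_transform_within_open[OF _ open_ball Suc.prems]) (simp add: Suc.IH)
  then have "vf_apply A X ?g (chart_inv c \<xi>) = frechet_derivative ?G (at (\<xi>, 0)) (X c (chart_inv c \<xi>), 0)"
    by (intro vf_apply_in_chart[OF A X c q(1)]) (simp only: q(2))
  also have "(X c (chart_inv c \<xi>), 0) = a (\<xi>, 0)"
    using a Suc.prems unfolding complexified_field_def by simp
  also have "frechet_derivative ?G (at (\<xi>, 0)) (a (\<xi>, 0)) = lie_deriv a ?G (\<xi>, 0)"
    by (simp only: lie_deriv_def)
  finally show ?case by simp
qed

lemma lie_term_eq:
  assumes "real_analytic_structure A" "real_analytic_vector_field A X" "c \<in> A" "complexified_field X c p r a"
    "hol_on cJ F (ball (p, 0) r)" "\<And>\<xi>. \<xi> \<in> ball p r \<Longrightarrow> F (\<xi>, 0) = f (chart_inv c \<xi>)" "\<xi> \<in> ball p r"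
  shows "lie_term A X \<tau> f k (chart_inv c \<xi>) = fps_nth (lie_fps a F (\<xi>, 0)) k * \<tau> ^ k"
proof -
  have "(vf_apply A X ^^ k) f (chart_inv c \<xi>) = (lie_deriv a ^^ k) F (\<xi>, 0)"
    by (rule vf_apply_power_eq_lie_deriv[OF assms(1-5) _ assms(7)]) (rule assms(6))
  then show ?thesis by (simp add: lie_term_def lie_fps_def)
qed

lemma lie_series_eq_eval_fps:
  assumes "real_analytic_structure A" "real_analytic_vector_field A X" "c \<in> A" "complexified_field X c p r a"
    "hol_on cJ F (ball (p, 0) r)" "\<And>\<xi>. \<xi> \<in> ball p r \<Longrightarrow> F (\<xi>, 0) = f (chart_inv c \<xi>)" "\<xi> \<in> ball p r"
  shows "lie_series A X \<tau> f (chart_inv c \<xi>) = eval_fps (lie_fps a F (\<xi>, 0)) \<tau>"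
proof -
  have "lie_term A X \<tau> f k (chart_inv c \<xi>) = fps_nth (lie_fps a F (\<xi>, 0)) k * \<tau> ^ k" for k
    by (rule lie_term_eq[OF assms(1-5) _ assms(7)]) (rule assms(6))
  then show ?thesis by (simp add: lie_series_def eval_fps_def)
qed

text \<open>The coordinates and the vector field extend to one common complex ball around \<open>q\<close>, on which both are bounded.\<close>

lemma local_extension:
  fixes A :: "('m::t2_space, real ^ 'd) chart set" and J\<^sub>0 :: "('m, complex ^ 'n) chart set"
  assumes A: "real_analytic_structure A" and J: "complex_structure A J\<^sub>0"
    and X: "real_analytic_vector_field A X"
    and z: "(U, z) \<in> J\<^sub>0" and c: "c \<in> A" and q: "q \<in> U" "q \<in> fst c" and W: "open W" "q \<in> W"
  obtains s a Z B C where "s > 0" "ball (snd c q) s \<subseteq> snd c ` (fst c \<inter> U \<inter> W)"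
    "complexified_field X c (snd c q) s a" "\<And>w. w \<in> ball (snd c q, 0) s \<Longrightarrow> norm (a w) \<le> B" "B \<ge> 0"
    "cdiff_on cJ ((*s) \<i>) Z (ball (snd c q, 0) s)"
    "\<And>\<xi>. \<xi> \<in> ball (snd c q) s \<Longrightarrow> Z (\<xi>, 0) = z (chart_inv c \<xi>)"
    "\<And>w i. w \<in> ball (snd c q, 0) s \<Longrightarrow> norm (Z w $ i) \<le> C"
proof -
  define p where "p = snd c q"
  have ch: "is_chart c"
    using A c maximal_atlas_is_chart unfolding real_analytic_structure_def by blast
  have Uo: "open U"
    using J z maximal_atlas_is_chart chart_open unfolding complex_structure_def by (metis fst_conv)
  have "open (snd c ` (fst c \<inter> U \<inter> W))"
    by (rule chart_open_image[OF ch]) (use chart_open[OF ch] Uo W in auto)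
  moreover have "p \<in> snd c ` (fst c \<inter> U \<inter> W)" using q W by (auto simp: p_def)
  ultimately obtain r0 where r0: "r0 > 0" "ball p r0 \<subseteq> snd c ` (fst c \<inter> U \<inter> W)"
    using open_contains_ball by blast
  have "real_analytic_at (X c \<circ> chart_inv c) p"
    using X c q unfolding real_analytic_vector_field_def real_analytic_on_def p_def by blast
  then obtain r1 a where r1: "r1 > 0" and a: "cdiff_on cJ cJ a (ball (p, 0) r1)"
      "\<And>x. x \<in> ball p r1 \<Longrightarrow> a (x, 0) = ((X c \<circ> chart_inv c) x, 0)"
    unfolding real_analytic_at_iff_complexification by blast
  have "(p, 0) \<in> ball (p, 0 :: real ^ 'd) r1" using r1 by simp
  from hol_on_locally_bounded[OF a(1) open_ball this]
  obtain r2 B where r2: "r2 > 0" "ball (p, 0) r2 \<subseteq> ball (p, 0 :: real ^ 'd) r1"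
     and B: "\<And>y. y \<in> ball (p, 0) r2 \<Longrightarrow> norm (a y) \<le> B" by blast
  have B0: "B \<ge> 0" using order_trans[OF norm_ge_zero B[of "(p, 0)"]] r2 by simp
  have "real_analytic_at (z \<circ> chart_inv c) p"
    using J z c q unfolding complex_structure_def transition_def real_analytic_on_def p_def by fastforce
  then have "real_analytic_at (\<lambda>x. (z \<circ> chart_inv c) x $ i) p" for i
    by (rule real_analytic_at_vec_nth)
  then have "\<exists>r F. r > 0 \<and> hol_on cJ F (ball (p, 0) r) \<and> (\<forall>x\<in>ball p r. F (x, 0) = (z \<circ> chart_inv c) x $ i)" for i
    unfolding real_analytic_at_iff_extension by blast
  then obtain r F where F: "\<And>i. r i > 0" "\<And>i. hol_on cJ (F i) (ball (p, 0) (r i))"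
      "\<And>i x. x \<in> ball p (r i) \<Longrightarrow> F i (x, 0) = (z \<circ> chart_inv c) x $ i" by metis
  define r3 where "r3 = Min (range r)"
  have r3: "r3 > 0" "\<And>i. r3 \<le> r i" using F(1) unfolding r3_def by auto
  define Z where "Z w = (\<chi> i. F i w)" for w
  have Z: "cdiff_on cJ ((*s) \<i>) Z (ball (p, 0) r3)"
    unfolding cdiff_on_vec_iff Z_def using cdiff_on_subset[OF F(2) subset_ball[OF r3(2)]] by simp
  have "(p, 0) \<in> ball (p, 0 :: real ^ 'd) r3" using r3 by simp
  from hol_on_locally_bounded[OF Z open_ball this]
  obtain r4 C where r4: "r4 > 0" "ball (p, 0) r4 \<subseteq> ball (p, 0 :: real ^ 'd) r3"
     and C: "\<And>y. y \<in> ball (p, 0) r4 \<Longrightarrow> norm (Z y) \<le> C" by blast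
  define s where "s = Min {r0, r1, r2, r3, r4}"
  have s: "s > 0" "s \<le> r0" "s \<le> r1" "s \<le> r2" "s \<le> r3" "s \<le> r4"
    using r0 r1 r2 r3 r4 unfolding s_def by auto
  show thesis
  proof (rule that[unfolded p_def[symmetric]])
    show "s > 0" by fact
    show sub: "ball p s \<subseteq> snd c ` (fst c \<inter> U \<inter> W)"
      using subset_ball[OF s(2)] r0(2) by blast
    show "complexified_field X c p s a"
      unfolding complexified_field_def
    proof (intro conjI ballI)
      show "ball p s \<subseteq> snd c ` fst c" using sub by blast
      show "cdiff_on cJ cJ a (ball (p, 0) s)" by (rule cdiff_on_subset[OF a(1) subset_ball[OF s(3)]])
    qed (use a(2) s(3) in auto)
    show "norm (a w) \<le> B" if "w \<in> ball (p, 0) s" for w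
      using B[of w] subset_ball[OF s(4)] that by blast
    show "B \<ge> 0" by fact
    show "cdiff_on cJ ((*s) \<i>) Z (ball (p, 0) s)" by (rule cdiff_on_subset[OF Z subset_ball[OF s(5)]])
    show "Z (\<xi>, 0) = z (chart_inv c \<xi>)" if "\<xi> \<in> ball p s" for \<xi>
    proof -
      have "\<xi> \<in> ball p (r i)" for i using that s(5) r3(2)[of i] by simp
      then show ?thesis using F(3) by (simp add: Z_def vec_eq_iff)
    qed
    show "norm (Z w $ i) \<le> C" if "w \<in> ball (p, 0) s" for w i
    proof -
      have "w \<in> ball (p, 0) r4" using subset_ball[OF s(6)] that by blast
      from order_trans[OF Finite_Cartesian_Product.norm_nth_le C[OF this]] show ?thesis .
    qed
  qed
qed

lemma (in complex_space) fps_conv_radius_lie_fps: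
  assumes F: "hol_on J F (ball x r)" and C: "\<And>y. y \<in> ball x r \<Longrightarrow> norm (F y) \<le> C"
    and a: "cdiff_on J J a (ball x r)" and B: "\<And>y. y \<in> ball x r \<Longrightarrow> norm (a y) \<le> B" "B \<ge> 0"
    and w: "w \<in> ball x r"
  shows "fps_conv_radius (lie_fps a F w) > 0"
proof -
  define d where "d = (r - dist x w) / 2"
  have d: "d > 0" "dist x w + d < r" using w by (auto simp: d_def field_simps)
  define K where "K = exp 1 * B / d"
  have K: "K \<ge> 0" using B d by (simp add: K_def)
  define t where "t = inverse (2 * (K + 1))"
  have t: "t > 0" "K * t \<le> 1 / 2" using K by (auto simp: t_def field_simps)
  have "summable (\<lambda>k. fps_nth (lie_fps a F w) k * (of_real t) ^ k)"
  proof (rule summable_comparison_test)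
    have "norm (fps_nth (lie_fps a F w) k * (of_real t) ^ k) \<le> C * (1 / 2) ^ k" for k
    proof -
      have C0: "C \<ge> 0" using order_trans[OF norm_ge_zero C[OF w]] .
      have "norm (fps_nth (lie_fps a F w) k * (of_real t) ^ k)
           = norm ((lie_deriv a ^^ k) F w) / fact k * t ^ k"
        using t(1) by (simp add: lie_fps_def norm_mult norm_divide norm_power)
      also have "\<dots> \<le> C * fact k * K ^ k / fact k * t ^ k"
        unfolding K_def using t(1) d
        by (intro mult_right_mono divide_right_mono lie_deriv_power_bound[OF F C a B]) auto
      also have "\<dots> = C * (K * t) ^ k" by (simp add: power_mult_distrib)
      also have "\<dots> \<le> C * (1 / 2) ^ k"
        using C0 K t by (intro mult_left_mono power_mono) auto
      finally show ?thesis .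
    qed
    then show "\<exists>N. \<forall>k\<ge>N. norm (fps_nth (lie_fps a F w) k * (of_real t) ^ k) \<le> C * (1 / 2) ^ k" by blast
    show "summable (\<lambda>k. C * (1 / 2) ^ k)" by (intro summable_mult summable_geometric) simp
  qed
  from conv_radius_geI[OF this] have "fps_conv_radius (lie_fps a F w) \<ge> t"
    using t(1) by (simp add: fps_conv_radius_def)
  moreover have "ereal t > 0" using t(1) by simp
  ultimately show ?thesis by (rule less_le_trans[rotated])
qed

lemma transition_component_holomorphic:
  fixes z :: "'m::t2_space \<Rightarrow> complex ^ 'n"
  assumes "complex_structure A J\<^sub>0" "(U, z) \<in> J\<^sub>0" "(U', z') \<in> J\<^sub>0"
  shows "hol_on ((*s) \<i>) (\<lambda>\<zeta>. z' (inv_into U z \<zeta>) $ i) (z ` (U \<inter> U'))"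
proof -
  have "holomorphic_map_on (transition (U, z) (U', z')) (z ` (U \<inter> U'))"
    using maximal_atlas_transition[of holomorphic_map_on J\<^sub>0 "(U, z)" "(U', z')"] assms
    unfolding complex_structure_def by simp
  then have "\<forall>i. hol_on ((*s) \<i>) (\<lambda>\<zeta>. transition (U, z) (U', z') \<zeta> $ i) (z ` (U \<inter> U'))"
    unfolding holomorphic_map_on_iff cdiff_on_vec_iff .
  then show ?thesis by (simp add: transition_def)
qed

text \<open>If \<open>h\<close> is the change of coordinates from \<open>z\<close> to \<open>z'\<close>, then the composition of \<open>h\<close> with the holomorphic extension of
  \<open>z\<close> is a holomorphic extension of \<open>z'\<close>. So the Lie series of \<open>z'\<close> is the one of \<open>z\<close> substituted into \<open>h\<close>, at
  least for those small times for which the latter stays in the domain of \<open>h\<close>.\<close>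

lemma lie_series_transition:
  fixes A :: "('m::t2_space, real ^ 'd) chart set" and J\<^sub>0 :: "('m, complex ^ 'n) chart set"
  assumes A: "real_analytic_structure A" and J: "complex_structure A J\<^sub>0"
    and X: "real_analytic_vector_field A X"
    and z: "(U, z) \<in> J\<^sub>0" and z': "(U', z') \<in> J\<^sub>0" and q: "q \<in> U" "q \<in> U'"
  shows "\<forall>\<^sub>F \<tau> in nhds 0. lie_series_coords A X \<tau> z q \<in> z ` (U \<inter> U') \<and>
           z' (inv_into U z (lie_series_coords A X \<tau> z q)) = lie_series_coords A X \<tau> z' q"
proof -
  obtain c where c: "c \<in> A" "q \<in> fst c"
    using A maximal_atlas_covers unfolding real_analytic_structure_def by blast
  have ch: "is_chart c"
    using A c maximal_atlas_is_chart unfolding real_analytic_structure_def by blast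
  have chz: "is_chart (U, z)" "is_chart (U', z')"
    using J z z' maximal_atlas_is_chart unfolding complex_structure_def by blast+
  have op: "open U" "open U'" using chart_open[OF chz(1)] chart_open[OF chz(2)] by simp_all
  define p where "p = snd c q"
  define E where "E \<tau> = lie_series_coords A X \<tau> z q" for \<tau>
  obtain s a Z B C where s: "s > 0" "ball p s \<subseteq> snd c ` (fst c \<inter> U \<inter> U')"
    and a: "complexified_field X c p s a" "\<And>w. w \<in> ball (p, 0) s \<Longrightarrow> norm (a w) \<le> B" "B \<ge> 0"
    and Z: "cdiff_on cJ ((*s) \<i>) Z (ball (p, 0) s)" "\<And>\<xi>. \<xi> \<in> ball p s \<Longrightarrow> Z (\<xi>, 0) = z (chart_inv c \<xi>)"
      "\<And>w i. w \<in> ball (p, 0) s \<Longrightarrow> norm (Z w $ i) \<le> C"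
    using local_extension[OF A J X z c(1) q(1) c(2) op(2) q(2)] unfolding p_def by metis
  define O' where "O' = z ` (U \<inter> U')"
  have O': "open O'"
    unfolding O'_def using chart_open_image[OF chz(1), of "U \<inter> U'"] op by (simp add: open_Int)
  have Zp: "Z (p, 0) = z q" using Z(2)[of p] s(1) chart_inv_left[OF ch c(2)] by (simp add: p_def)
  have contZ: "isCont Z (p, 0)"
    using cdiff_on_imp_continuous_on[OF Z(1)] s(1) by (simp add: continuous_on_eq_continuous_at)
  have zq: "z q \<in> O'" using q by (auto simp: O'_def)
  then have "\<forall>\<^sub>F w in nhds (p, 0). Z w \<in> O'"
    using topological_tendstoD[OF contZ[unfolded isCont_def tendsto_at_iff_tendsto_nhds] O'] by (simp add: Zp)
  then obtain e where e: "e > 0" "\<And>w. dist w (p, 0) < e \<Longrightarrow> Z w \<in> O'"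
    unfolding eventually_nhds_metric by blast
  define t where "t = min s e"
  have t: "t > 0" "t \<le> s" "t \<le> e" using s e by (auto simp: t_def)
  have subt: "ball (p, 0) t \<subseteq> ball (p, 0 :: real ^ 'd) s" "ball p t \<subseteq> ball p s" using t by (auto intro: subset_ball)
  have at: "complexified_field X c p t a"
    using a(1) subt cdiff_on_subset[of cJ cJ a] unfolding complexified_field_def by blast
  have a': "cdiff_on cJ cJ a (ball (p, 0) t)" using at unfolding complexified_field_def by blast
  have ZO: "Z w \<in> O'" if "w \<in> ball (p, 0) t" for w using e(2) that t(3) by (simp add: dist_commute)
  have Zt: "hol_on cJ (\<lambda>w. Z w $ i) (ball (p, 0) t)" for i
    using cdiff_on_subset[OF Z(1) subt(1)] unfolding cdiff_on_vec_iff by blast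
  have pt: "p \<in> ball p t" "(p, 0) \<in> ball (p, 0 :: real ^ 'd) t" using t by auto
  have qp: "chart_inv c p = q" using chart_inv_left[OF ch c(2)] by (simp add: p_def)
  define h where "h i \<zeta> = z' (inv_into U z \<zeta>) $ i" for i \<zeta>
  have h: "hol_on ((*s) \<i>) (h i) O'" for i
    unfolding h_def[abs_def] O'_def by (rule transition_component_holomorphic[OF J z z'])
  have Eval: "E \<tau> $ i = eval_fps (lie_fps a (\<lambda>w. Z w $ i) (p, 0)) \<tau>" for \<tau> i
  proof -
    have "lie_series A X \<tau> (\<lambda>q. z q $ i) (chart_inv c p) = eval_fps (lie_fps a (\<lambda>w. Z w $ i) (p, 0)) \<tau>"
      by (rule lie_series_eq_eval_fps[OF A X c(1) at Zt _ pt(1)]) (use Z(2) subt(2) in auto)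
    then show ?thesis by (simp add: E_def lie_series_coords_def qp)
  qed
  have Eexp: "(\<lambda>\<tau>. E \<tau> $ i) has_fps_expansion lie_fps a (\<lambda>w. Z w $ i) (p, 0)" for i
    unfolding has_fps_expansion_def
  proof
    show "fps_conv_radius (lie_fps a (\<lambda>w. Z w $ i) (p, 0)) > 0"
      by (rule cJ.fps_conv_radius_lie_fps[OF Zt _ a' _ a(3) pt(2)]) (use Z(3) a(2) subt(1) in blast)+
  qed (simp add: Eval)
  have hE: "\<forall>\<^sub>F \<tau> in nhds 0. h i (E \<tau>) = lie_series A X \<tau> (\<lambda>q. z' q $ i) q" for i
  proof -
    have "(\<lambda>\<tau>. h i (E \<tau>)) has_fps_expansion lie_fps a (\<lambda>w. h i (Z w)) (p, 0)"
      by (rule cJ.lie_fps_compose[OF open_ball pt(2) a' Zt O' ZO h Eexp])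
    then have "\<forall>\<^sub>F \<tau> in nhds 0. eval_fps (lie_fps a (\<lambda>w. h i (Z w)) (p, 0)) \<tau> = h i (E \<tau>)"
      unfolding has_fps_expansion_def by blast
    moreover have "lie_series A X \<tau> (\<lambda>q. z' q $ i) (chart_inv c p) = eval_fps (lie_fps a (\<lambda>w. h i (Z w)) (p, 0)) \<tau>" for \<tau>
    proof (rule lie_series_eq_eval_fps[OF A X c(1) at _ _ pt(1)])
      have "cdiff_on cJ ((*s) \<i>) Z (ball (p, 0) t)" by (rule cdiff_on_subset[OF Z(1) subt(1)])
      from cdiff_on_compose[OF this h] show "hol_on cJ (\<lambda>w. h i (Z w)) (ball (p, 0) t)"
        using ZO by blast
      fix \<xi> assume \<xi>: "\<xi> \<in> ball p t"
      then have "\<xi> \<in> snd c ` (fst c \<inter> U \<inter> U')" using subt(2) s(2) by blast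
      from chart_inv_in[OF ch _ this] have "chart_inv c \<xi> \<in> U" by blast
      then have "inv_into U z (z (chart_inv c \<xi>)) = chart_inv c \<xi>"
        using chart_inv_left[OF chz(1)] by simp
      then show "h i (Z (\<xi>, 0)) = z' (chart_inv c \<xi>) $ i"
        using Z(2) \<xi> subt(2) by (simp add: h_def subset_iff)
    qed
    ultimately show ?thesis by (simp add: qp eq_commute)
  qed
  have "isCont (\<lambda>\<tau>. E \<tau> $ i) 0" for i
    using has_fps_expansion_imp_continuous[OF Eexp] by blast
  then have "isCont E 0" unfolding isCont_def using vec_tendstoI by blast
  moreover have "E 0 = z q"
    using has_fps_expansion_imp_0_eq_fps_nth_0[OF Eexp] Zp by (simp add: vec_eq_iff lie_fps_def)
  ultimately have "\<forall>\<^sub>F \<tau> in nhds 0. E \<tau> \<in> O'"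
    unfolding isCont_def tendsto_at_iff_tendsto_nhds
    using topological_tendstoD[OF _ O', of E "z q" "nhds 0"] zq by simp
  moreover have "\<forall>\<^sub>F \<tau> in nhds 0. \<forall>i. h i (E \<tau>) = lie_series A X \<tau> (\<lambda>q. z' q $ i) q"
    by (rule eventually_all_finite) (rule hE)
  ultimately show ?thesis
    by eventually_elim (simp add: E_def[symmetric] O'_def[symmetric] h_def lie_series_coords_def[of A X _ z'] vec_eq_iff)
qed

lemma lie_series_holomorphic:
  assumes "\<And>\<tau>. \<tau> \<in> ball 0 T \<Longrightarrow> summable (\<lambda>k. norm (lie_term A X \<tau> f k q))"
  shows "(\<lambda>\<tau>. lie_series A X \<tau> f q) holomorphic_on ball 0 T"
proof (rule power_series_holomorphic)
  fix \<tau> :: complex assume "\<tau> \<in> ball 0 T"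
  from summable_norm_cancel[OF assms[OF this]]
  have "(\<lambda>k. lie_term A X \<tau> f k q) sums lie_series A X \<tau> f q"
    unfolding lie_series_def by (rule summable_sums)
  then show "(\<lambda>k. ((vf_apply A X ^^ k) f q / fact k) * (\<tau> - 0) ^ k) sums lie_series A X \<tau> f q"
    by (simp add: lie_term_def mult.commute)
qed

text \<open>Both curves are holomorphic maps of the disc into the complex manifold \<open>J\<^sub>0\<close>. They agree for small times
  by naturality of the Lie series. The set of times near which they agree is open, and it is closed in
  the disc: at a limit time the curves meet because the manifold is Hausdorff, and there the identity
  theorem applies in a coordinate system. This is the source both of the independence of the
  flow from the coordinates and of its uniqueness.\<close>

lemma lie_series_curve_unique:
  fixes A :: "('m::t2_space, real ^ 'd) chart set" and J\<^sub>0 :: "('m, complex ^ 'n) chart set"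
    and \<gamma> \<gamma>' :: "complex \<Rightarrow> 'm"
  assumes A: "real_analytic_structure A" and J: "complex_structure A J\<^sub>0"
    and X: "real_analytic_vector_field A X"
    and z: "(U, z) \<in> J\<^sub>0" and z': "(U', z') \<in> J\<^sub>0" and q: "q \<in> U" "q \<in> U'"
    and conv: "\<And>\<tau> i. \<tau> \<in> ball 0 T \<Longrightarrow> summable (\<lambda>k. norm (lie_term A X \<tau> (\<lambda>q. z q $ i) k q))"
      "\<And>\<tau> i. \<tau> \<in> ball 0 T \<Longrightarrow> summable (\<lambda>k. norm (lie_term A X \<tau> (\<lambda>q. z' q $ i) k q))"
    and \<gamma>: "\<And>\<tau>. \<tau> \<in> ball 0 T \<Longrightarrow> \<gamma> \<tau> \<in> U" "\<And>\<tau>. \<tau> \<in> ball 0 T \<Longrightarrow> z (\<gamma> \<tau>) = lie_series_coords A X \<tau> z q"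
    and \<gamma>': "\<And>\<tau>. \<tau> \<in> ball 0 T \<Longrightarrow> \<gamma>' \<tau> \<in> U'" "\<And>\<tau>. \<tau> \<in> ball 0 T \<Longrightarrow> z' (\<gamma>' \<tau>) = lie_series_coords A X \<tau> z' q"
    and \<tau>: "\<tau> \<in> ball 0 T"
  shows "\<gamma> \<tau> = \<gamma>' \<tau>"
proof -
  have chz: "is_chart (U, z)" "is_chart (U', z')"
    using J z z' maximal_atlas_is_chart unfolding complex_structure_def by blast+
  have op: "open U" "open U'" using chart_open[OF chz(1)] chart_open[OF chz(2)] by simp_all
  have inv_z: "inv_into U z (z m) = m" if "m \<in> U" for m using chart_inv_left[OF chz(1)] that by simp
  have inv_z': "inv_into U' z' (z' m) = m" if "m \<in> U'" for m using chart_inv_left[OF chz(2)] that by simp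
  define D where "D = ball (0 :: complex) T"
  have D: "open D" "connected D" "0 \<in> D" using \<tau> by (auto simp: D_def intro: le_less_trans[OF norm_ge_zero])
  note conv = conv[folded D_def] and \<gamma> = \<gamma>[folded D_def] and \<gamma>' = \<gamma>'[folded D_def]
  define E where "E \<tau> = lie_series_coords A X \<tau> z q" for \<tau>
  define E' where "E' \<tau> = lie_series_coords A X \<tau> z' q" for \<tau>
  have holE: "(\<lambda>\<tau>. E \<tau> $ i) holomorphic_on D" for i
    unfolding E_def lie_series_coords_def D_def vec_lambda_beta
    by (rule lie_series_holomorphic[OF conv(1)[unfolded D_def]])
  have holE': "(\<lambda>\<tau>. E' \<tau> $ i) holomorphic_on D" for i
    unfolding E'_def lie_series_coords_def D_def vec_lambda_beta
    by (rule lie_series_holomorphic[OF conv(2)[unfolded D_def]])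
  have contE: "continuous_on D E" "continuous_on D E'"
    using holomorphic_on_imp_continuous_on[OF holE] holomorphic_on_imp_continuous_on[OF holE']
    by (auto simp: continuous_on_def intro: vec_tendstoI)
  have \<gamma>eq: "\<gamma> \<sigma> = inv_into U z (E \<sigma>)" if "\<sigma> \<in> D" for \<sigma>
    using inv_z[OF \<gamma>(1)[OF that]] \<gamma>(2)[OF that] by (simp add: E_def)
  have \<gamma>'eq: "\<gamma>' \<sigma> = inv_into U' z' (E' \<sigma>)" if "\<sigma> \<in> D" for \<sigma>
    using inv_z'[OF \<gamma>'(1)[OF that]] \<gamma>'(2)[OF that] by (simp add: E'_def)
  have E_in: "E \<sigma> \<in> z ` U" if "\<sigma> \<in> D" for \<sigma>
    unfolding E_def \<gamma>(2)[OF that, symmetric] by (rule imageI[OF \<gamma>(1)[OF that]])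
  have E'_in: "E' \<sigma> \<in> z' ` U'" if "\<sigma> \<in> D" for \<sigma>
    unfolding E'_def \<gamma>'(2)[OF that, symmetric] by (rule imageI[OF \<gamma>'(1)[OF that]])
  have cont\<gamma>: "continuous_on D \<gamma>"
  proof (rule continuous_on_eq)
    show "continuous_on D (\<lambda>\<sigma>. inv_into U z (E \<sigma>))"
      by (rule continuous_on_compose2[OF chart_inv_continuous[OF chz(1), simplified] contE(1)])
         (use E_in in blast)
  qed (use \<gamma>eq in simp)
  have cont\<gamma>': "continuous_on D \<gamma>'"
  proof (rule continuous_on_eq)
    show "continuous_on D (\<lambda>\<sigma>. inv_into U' z' (E' \<sigma>))"
      by (rule continuous_on_compose2[OF chart_inv_continuous[OF chz(2), simplified] contE(2)])
         (use E'_in in blast)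
  qed (use \<gamma>'eq in simp)
  define S where "S = {\<sigma> \<in> D. \<forall>\<^sub>F \<sigma>' in nhds \<sigma>. \<gamma> \<sigma>' = \<gamma>' \<sigma>'}"
  have S_eq: "\<gamma> \<sigma> = \<gamma>' \<sigma>" if "\<sigma> \<in> S" for \<sigma>
    using that eventually_nhds_x_imp_x unfolding S_def by blast
  define S' where "S' = {\<sigma>. \<forall>\<^sub>F \<sigma>' in nhds \<sigma>. \<gamma> \<sigma>' = \<gamma>' \<sigma>'}"
  have "\<exists>N. open N \<and> \<sigma> \<in> N \<and> N \<subseteq> S'" if "\<sigma> \<in> S'" for \<sigma>
  proof -
    have "\<exists>N. open N \<and> \<sigma> \<in> N \<and> (\<forall>x\<in>N. \<gamma> x = \<gamma>' x)"
      using that by (simp only: S'_def eventually_nhds mem_Collect_eq)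
    then obtain N where N: "open N" "\<sigma> \<in> N" "\<forall>x\<in>N. \<gamma> x = \<gamma>' x" by (elim exE conjE)
    have "x \<in> S'" if "x \<in> N" for x
      unfolding S'_def eventually_nhds mem_Collect_eq using N that by (intro exI[of _ N] conjI)
    then show ?thesis using N by (intro exI[of _ N] conjI subsetI)
  qed
  then have "open S'" by (intro topological_space_class.openI)
  moreover have "S = D \<inter> S'" by (auto simp: S_def S'_def)
  ultimately have S_open: "open S" using D(1) by (simp add: open_Int)
  have "\<forall>\<^sub>F \<sigma> in nhds 0. \<sigma> \<in> D" using D by (simp add: eventually_nhds_in_open)
  then have "\<forall>\<^sub>F \<sigma> in nhds 0. \<gamma> \<sigma> = \<gamma>' \<sigma>"
    using lie_series_transition[OF A J X z z' q]
  proof eventually_elim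
    case (elim \<sigma>)
    then obtain m where m: "m \<in> U" "m \<in> U'" "E \<sigma> = z m" unfolding E_def by blast
    then have "\<gamma> \<sigma> = m" using \<gamma>eq elim inv_z by simp
    moreover have "z' m = E' \<sigma>" using elim m inv_z by (simp add: E_def[symmetric] E'_def)
    then have "\<gamma>' \<sigma> = m" using \<gamma>'eq elim inv_z' m by metis
    ultimately show ?case by simp
  qed
  then have "0 \<in> S" using D by (simp add: S_def)
  have closed: "\<sigma> \<in> S" if \<sigma>: "\<sigma> \<in> D" "\<sigma> \<in> closure S" for \<sigma>
  proof -
    have iso: "isCont \<gamma> \<sigma>" "isCont \<gamma>' \<sigma>"
      using cont\<gamma> cont\<gamma>' \<sigma>(1) D(1) continuous_on_eq_continuous_at by blast+
    have meets: "\<exists>\<sigma>'\<in>S. P \<sigma>'" if P: "\<forall>\<^sub>F \<sigma>' in nhds \<sigma>. P \<sigma>'" for P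
    proof -
      obtain N where N: "open N" "\<sigma> \<in> N" "\<forall>x\<in>N. P x"
        using P[unfolded eventually_nhds] by (elim exE conjE)
      then have "N \<inter> closure S \<noteq> {}" using \<sigma>(2) by auto
      then have "N \<inter> S \<noteq> {}" using open_Int_closure_eq_empty[OF N(1)] by simp
      then show ?thesis using N(3) by auto
    qed
    have ev: "\<forall>\<^sub>F \<sigma>' in nhds \<sigma>. \<gamma> \<sigma>' \<in> N" if "open N" "\<gamma> \<sigma> \<in> N" for N
      using topological_tendstoD[OF iso(1)[unfolded isCont_def tendsto_at_iff_tendsto_nhds] that] .
    have ev': "\<forall>\<^sub>F \<sigma>' in nhds \<sigma>. \<gamma>' \<sigma>' \<in> N" if "open N" "\<gamma>' \<sigma> \<in> N" for N
      using topological_tendstoD[OF iso(2)[unfolded isCont_def tendsto_at_iff_tendsto_nhds] that] .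
    have eq\<sigma>: "\<gamma> \<sigma> = \<gamma>' \<sigma>"
    proof (rule ccontr)
      assume "\<gamma> \<sigma> \<noteq> \<gamma>' \<sigma>"
      then obtain N N' where N: "open N" "open N'" "\<gamma> \<sigma> \<in> N" "\<gamma>' \<sigma> \<in> N'" "N \<inter> N' = {}"
        using hausdorff by metis
      have "\<forall>\<^sub>F \<sigma>' in nhds \<sigma>. \<gamma> \<sigma>' \<in> N \<and> \<gamma>' \<sigma>' \<in> N'"
        by (rule eventually_conj[OF ev[OF N(1,3)] ev'[OF N(2,4)]])
      from meets[OF this] show False using S_eq N(5) by auto
    qed
    have "\<gamma> \<sigma> \<in> U \<inter> U'" using \<gamma>(1)[OF \<sigma>(1)] \<gamma>'(1)[OF \<sigma>(1)] eq\<sigma> by simp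
    with op have "\<forall>\<^sub>F \<sigma>' in nhds \<sigma>. \<gamma> \<sigma>' \<in> U \<inter> U'" by (intro ev open_Int)
    moreover have "\<forall>\<^sub>F \<sigma>' in nhds \<sigma>. \<sigma>' \<in> D" using D \<sigma> by (simp add: eventually_nhds_in_open)
    ultimately have "\<forall>\<^sub>F \<sigma>' in nhds \<sigma>. \<gamma> \<sigma>' \<in> U \<inter> U' \<and> \<sigma>' \<in> D" by (rule eventually_conj)
    then obtain e where e: "e > 0" "\<And>\<sigma>'. dist \<sigma>' \<sigma> < e \<Longrightarrow> \<gamma> \<sigma>' \<in> U \<inter> U' \<and> \<sigma>' \<in> D"
      unfolding eventually_nhds_metric by blast
    define B where "B = ball \<sigma> e"
    have B: "\<And>\<sigma>'. \<sigma>' \<in> B \<Longrightarrow> \<gamma> \<sigma>' \<in> U \<inter> U'" "B \<subseteq> D" "open B" "connected B" "\<sigma> \<in> B"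
      using e by (auto simp: B_def dist_commute)
    define O' where "O' = z ` (U \<inter> U')"
    define h where "h i \<zeta> = z' (inv_into U z \<zeta>) $ i" for i \<zeta>
    have h: "hol_on ((*s) \<i>) (h i) O'" for i
      unfolding h_def[abs_def] O'_def by (rule transition_component_holomorphic[OF J z z'])
    have EO: "E \<sigma>' \<in> O'" if "\<sigma>' \<in> B" for \<sigma>'
      unfolding E_def O'_def \<gamma>(2)[OF subsetD[OF B(2) that], symmetric] by (rule imageI[OF B(1)[OF that]])
    have hE: "h i (E \<sigma>') = z' (\<gamma> \<sigma>') $ i" if "\<sigma>' \<in> B" for i \<sigma>'
      using \<gamma>eq[of \<sigma>'] B(2) that by (auto simp: h_def)
    have hol: "(\<lambda>\<sigma>. h i (E \<sigma>)) holomorphic_on B" for i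
      unfolding holomorphic_on_def
    proof
      fix \<sigma>' assume s: "\<sigma>' \<in> B"
      have "((\<lambda>t. E t $ j) has_field_derivative (\<chi> j. deriv (\<lambda>t. E t $ j) \<sigma>') $ j) (at \<sigma>')" for j
        using holomorphic_derivI[OF holE D(1)] s B(2) by auto
      from hol_on_chain_has_field_derivative[OF h this EO[OF s]]
      show "(\<lambda>\<sigma>. h i (E \<sigma>)) field_differentiable at \<sigma>' within B"
        unfolding field_differentiable_def using has_field_derivative_at_within by blast
    qed
    have hE': "h i (E \<sigma>') = E' \<sigma>' $ i" if "\<sigma>' \<in> B" for i \<sigma>'
    proof (rule analytic_continuation_open[of "S \<inter> B" B "\<lambda>\<sigma>. h i (E \<sigma>)" "\<lambda>\<sigma>. E' \<sigma> $ i"])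
      show "open (S \<inter> B)" using S_open B(3) by (rule open_Int)
      have "\<forall>\<^sub>F \<sigma>' in nhds \<sigma>. \<sigma>' \<in> B" using B by (simp add: eventually_nhds_in_open)
      from meets[OF this] show "S \<inter> B \<noteq> {}" by blast
      show "(\<lambda>\<sigma>. E' \<sigma> $ i) holomorphic_on B" by (rule holomorphic_on_subset[OF holE' B(2)])
      show "h i (E t) = E' t $ i" if "t \<in> S \<inter> B" for t
      proof -
        have "t \<in> D" using that B(2) by blast
        then have "z' (\<gamma>' t) = E' t" unfolding E'_def by (rule \<gamma>'(2))
        then show ?thesis using hE[of t] S_eq[of t] that by simp
      qed
    qed (use B hol that in auto)
    have eqB: "\<gamma> \<sigma>' = \<gamma>' \<sigma>'" if "\<sigma>' \<in> B" for \<sigma>'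
    proof -
      have "\<sigma>' \<in> D" using that B(2) by blast
      have "z' (\<gamma> \<sigma>') = E' \<sigma>'" using hE'[OF that] hE[OF that] by (simp add: vec_eq_iff)
      then have "\<gamma> \<sigma>' = inv_into U' z' (E' \<sigma>')" using inv_z'[of "\<gamma> \<sigma>'"] B(1)[OF that] by simp
      then show ?thesis using \<gamma>'eq[OF \<open>\<sigma>' \<in> D\<close>] by simp
    qed
    have "\<forall>\<^sub>F \<sigma>' in nhds \<sigma>. \<gamma> \<sigma>' = \<gamma>' \<sigma>'"
      unfolding eventually_nhds using B(3,5) eqB by (intro exI[of _ B]) auto
    then show "\<sigma> \<in> S" using \<sigma>(1) by (simp add: S_def)
  qed
  have "D \<subseteq> S"
  proof (rule ccontr)
    assume "\<not> D \<subseteq> S"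
    then have "(D - closure S) \<inter> D \<noteq> {}" using closed by blast
    moreover have "S \<inter> D \<noteq> {}" using \<open>0 \<in> S\<close> D(3) by blast
    moreover have "open (D - closure S)" using D(1) by (simp add: open_Diff)
    moreover have "S \<inter> (D - closure S) \<inter> D = {}" using closure_subset by blast
    moreover have "D \<subseteq> S \<union> (D - closure S)" using closed by blast
    ultimately show False using connectedD[OF D(2) S_open] by blast
  qed
  then show ?thesis using S_eq \<tau> unfolding D_def by blast
qed

section \<open>The local flow\<close>

abbreviation flow_coords where
  "flow_coords A X U z \<tau> \<zeta> \<equiv> lie_series_coords A X \<tau> z (inv_into U z \<zeta>)"

text \<open>A coordinate system around \<open>p\<close> in which the Lie series define the flow up to time \<open>\<epsilon>\<close>. The flow is defined on the ball of
  radius \<open>2 * \<rho>\<close> and takes values in the ball of radius \<open>3 * \<rho>\<close>, since it moves points by at most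
  \<open>M * \<epsilon>\<close>; and it differs from the identity by a map with Lipschitz constant \<open>1 / 2\<close>.\<close>

definition flow_chart where
  "flow_chart A X J\<^sub>0 p U z \<rho> M \<epsilon> \<longleftrightarrow>
     (U, z) \<in> J\<^sub>0 \<and> p \<in> U \<and> \<rho> > 0 \<and> \<epsilon> > 0 \<and> M \<ge> 0 \<and> M * \<epsilon> \<le> \<rho> / 2 \<and>
     ball (z p) (3 * \<rho>) \<subseteq> z ` U \<and>
     (\<forall>\<tau>\<in>ball 0 \<epsilon>.
        (\<forall>i. lie_series_converges_on A X \<tau> (\<lambda>q. z q $ i) (U \<inter> z -` ball (z p) (2 * \<rho>))) \<and>
        (\<forall>\<zeta>\<in>ball (z p) (2 * \<rho>).
           real_analytic_at (\<lambda>\<zeta>. flow_coords A X U z \<tau> \<zeta>) \<zeta> \<and>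
           norm (flow_coords A X U z \<tau> \<zeta> - \<zeta>) \<le> M * norm \<tau>) \<and>
        (\<forall>\<zeta>\<in>ball (z p) (2 * \<rho>). \<forall>\<zeta>'\<in>ball (z p) (2 * \<rho>).
           norm ((flow_coords A X U z \<tau> \<zeta> - \<zeta>)
                 - (flow_coords A X U z \<tau> \<zeta>' - \<zeta>')) \<le> norm (\<zeta> - \<zeta>') / 2))"

lemma norm_vec_le_card:
  assumes "\<And>i. norm ((v :: complex ^ 'n) $ i) \<le> (b :: real)"
  shows "norm v \<le> real CARD('n) * b"
proof -
  have "norm v \<le> (\<Sum>i\<in>UNIV. norm (v $ i))" unfolding norm_vec_def by (rule L2_set_le_sum) simp
  also have "\<dots> \<le> (\<Sum>i\<in>(UNIV :: 'n set). b)" by (intro sum_mono assms)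
  finally show ?thesis by simp
qed

text \<open>For times with \<open>K * norm \<tau> \<le> 1 / 2\<close> the Lie series is dominated by a geometric series.\<close>

lemma (in complex_space) lie_series_eval_bounds:
  assumes F: "hol_on J F (ball x (2 * r))" and C: "\<And>y. y \<in> ball x (2 * r) \<Longrightarrow> norm (F y) \<le> C"
    and a: "cdiff_on J J a (ball x (2 * r))" and B: "\<And>y. y \<in> ball x (2 * r) \<Longrightarrow> norm (a y) \<le> B" "B \<ge> 0"
    and r: "r > 0" and K: "K = exp 1 * B / r" and \<tau>: "K * norm \<tau> \<le> 1 / 2"
  shows "\<And>w k. w \<in> ball x r \<Longrightarrow> norm (fps_nth (lie_fps a F w) k * \<tau> ^ k) \<le> C * (1 / 2) ^ k" (is "PROP ?A")
    and "hol_on J (\<lambda>w. eval_fps (lie_fps a F w) \<tau>) (ball x r)" (is ?B)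
    and "\<And>w. w \<in> ball x r \<Longrightarrow> norm (eval_fps (lie_fps a F w) \<tau> - F w) \<le> 2 * C * K * norm \<tau>" (is "PROP ?C")
proof -
  have K0: "K \<ge> 0" using K B r by simp
  have sub: "ball x r \<subseteq> ball x (2 * r)" using r by (simp add: subset_ball)
  have C0: "C \<ge> 0" using order_trans[OF norm_ge_zero C[of x]] r by simp
  have bound: "norm (fps_nth (lie_fps a F w) k * \<tau> ^ k) \<le> C * (K * norm \<tau>) ^ k" if w: "w \<in> ball x r" for w k
  proof -
    have d: "dist x w + r < 2 * r" using w by simp
    have "norm (fps_nth (lie_fps a F w) k * \<tau> ^ k) = norm ((lie_deriv a ^^ k) F w) / fact k * norm \<tau> ^ k"
      by (simp add: lie_fps_def norm_mult norm_divide norm_power)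
    also have "\<dots> \<le> C * fact k * K ^ k / fact k * norm \<tau> ^ k"
      unfolding K by (intro mult_right_mono divide_right_mono lie_deriv_power_bound[OF F C a B r d]) auto
    also have "\<dots> = C * (K * norm \<tau>) ^ k" by (simp add: power_mult_distrib)
    finally show ?thesis .
  qed
  have half: "C * (K * norm \<tau>) ^ k \<le> C * (1 / 2) ^ k" for k
    using C0 K0 \<tau> by (intro mult_left_mono power_mono) auto
  have A: "norm (fps_nth (lie_fps a F w) k * \<tau> ^ k) \<le> C * (1 / 2) ^ k" if w: "w \<in> ball x r" for w k
    using bound[OF w] half by (rule order_trans)
  show "PROP ?A" by (rule A)
  have sum_geo: "summable (\<lambda>k. C * (1 / 2 :: real) ^ k)" by (intro summable_mult summable_geometric) simp
  have ul: "uniform_limit (ball x r) (\<lambda>N w. \<Sum>k<N. fps_nth (lie_fps a F w) k * \<tau> ^ k)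
          (\<lambda>w. \<Sum>k. fps_nth (lie_fps a F w) k * \<tau> ^ k) sequentially"
    by (rule Weierstrass_m_test[OF A sum_geo])
  have hs: "hol_on J (\<lambda>w. \<Sum>k<N. fps_nth (lie_fps a F w) k * \<tau> ^ k) (ball x r)" for N
  proof (intro cdiff_on_sum linear_mult_complex)
    fix k
    have "hol_on J (\<lambda>w. (\<tau> ^ k / fact k) * (lie_deriv a ^^ k) F w) (ball x r)"
      by (intro hol_on_cmult cdiff_on_subset[OF hol_on_lie_deriv_power[OF F a open_ball] sub])
    then show "hol_on J (\<lambda>w. fps_nth (lie_fps a F w) k * \<tau> ^ k) (ball x r)"
      by (simp add: lie_fps_def mult.commute)
  qed
  show ?B unfolding eval_fps_def by (rule hol_on_uniform_limit[OF hs ul])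
  show "PROP ?C"
  proof -
    fix w assume w: "w \<in> ball x r"
    let ?f = "\<lambda>k. fps_nth (lie_fps a F w) k * \<tau> ^ k"
    have sf: "summable ?f" by (rule summable_comparison_test[OF _ sum_geo]) (use A[OF w] in blast)
    have "eval_fps (lie_fps a F w) \<tau> - F w = (\<Sum>k. ?f (Suc k))"
      using suminf_split_head[OF sf] by (simp add: eval_fps_def lie_fps_def)
    also have "norm \<dots> \<le> (\<Sum>k. C * (K * norm \<tau>) * (1 / 2) ^ k)"
    proof (rule norm_suminf_le)
      show "summable (\<lambda>k. C * (K * norm \<tau>) * (1 / 2 :: real) ^ k)"
        by (intro summable_mult summable_geometric) simp
      fix k
      have "norm (?f (Suc k)) \<le> C * (K * norm \<tau>) ^ Suc k" by (rule bound[OF w])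
      also have "\<dots> = C * (K * norm \<tau>) * (K * norm \<tau>) ^ k" by simp
      also have "\<dots> \<le> C * (K * norm \<tau>) * (1 / 2) ^ k"
        using C0 K0 \<tau> by (intro mult_left_mono power_mono mult_nonneg_nonneg) auto
      finally show "norm (?f (Suc k)) \<le> C * (K * norm \<tau>) * (1 / 2) ^ k" .
    qed
    also have "\<dots> = C * (K * norm \<tau>) * 2"
      using suminf_mult[of "\<lambda>k. (1 / 2 :: real) ^ k" "C * (K * norm \<tau>)"] suminf_geometric[of "1 / 2 :: real"]
        summable_geometric[of "1 / 2 :: real"] by simp
    finally show "norm (eval_fps (lie_fps a F w) \<tau> - F w) \<le> 2 * C * K * norm \<tau>" by (simp add: mult_ac)
  qed
qed

text \<open>In a real analytic chart the Lie series of the coordinates extends to a complex ball and differs there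
  from the coordinates by at most a constant times \<open>norm \<tau>\<close>. By the Cauchy estimates the difference has a
  Lipschitz constant of the same order, and the change of coordinates \<open>T\<close> from \<open>z\<close> to the chart, being
  locally Lipschitz, carries both bounds to the coordinates \<open>z\<close>.\<close>

lemma flow_chart_exists:
  fixes A :: "('m::t2_space, real ^ 'd) chart set" and J\<^sub>0 :: "('m, complex ^ 'n) chart set"
  assumes A: "real_analytic_structure A" and J: "complex_structure A J\<^sub>0"
    and X: "real_analytic_vector_field A X"
  shows "\<exists>U z \<rho> M \<epsilon>. flow_chart A X J\<^sub>0 p U z \<rho> M \<epsilon>"
proof -
  obtain c where c: "c \<in> A" "p \<in> fst c"
    using A maximal_atlas_covers unfolding real_analytic_structure_def by blast
  have ch: "is_chart c"
    using A c maximal_atlas_is_chart unfolding real_analytic_structure_def by blast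
  obtain Uz where Uz: "Uz \<in> J\<^sub>0" "p \<in> fst Uz"
    using J maximal_atlas_covers unfolding complex_structure_def by blast
  define U z where "U = fst Uz" and "z = snd Uz"
  have z: "(U, z) \<in> J\<^sub>0" "p \<in> U" using Uz by (auto simp: U_def z_def)
  have chz: "is_chart (U, z)"
    using J z maximal_atlas_is_chart unfolding complex_structure_def by blast
  have Uo: "open U" using chart_open[OF chz] by simp
  have inv_z: "inv_into U z (z m) = m" if "m \<in> U" for m using chart_inv_left[OF chz] that by simp
  define x0 where "x0 = snd c p"
  obtain s a Z B C where s: "s > 0" "ball x0 s \<subseteq> snd c ` (fst c \<inter> U \<inter> UNIV)"
    and a: "complexified_field X c x0 s a" "\<And>w. w \<in> ball (x0, 0) s \<Longrightarrow> norm (a w) \<le> B" "B \<ge> 0"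
    and Z: "cdiff_on cJ ((*s) \<i>) Z (ball (x0, 0) s)" "\<And>\<xi>. \<xi> \<in> ball x0 s \<Longrightarrow> Z (\<xi>, 0) = z (chart_inv c \<xi>)"
      "\<And>w i. w \<in> ball (x0, 0) s \<Longrightarrow> norm (Z w $ i) \<le> C"
    using local_extension[OF A J X z(1) c(1) z(2) c(2) open_UNIV UNIV_I] unfolding x0_def by metis
  define r where "r = s / 2"
  have r: "r > 0" "s = 2 * r" using s by (auto simp: r_def)
  have a': "cdiff_on cJ cJ a (ball (x0, 0) s)" using a(1) unfolding complexified_field_def by blast
  have Zi: "hol_on cJ (\<lambda>w. Z w $ i) (ball (x0, 0) s)" for i
    using Z(1) unfolding cdiff_on_vec_iff by blast
  define K where "K = exp 1 * B / r"
  have K0: "K \<ge> 0" using a(3) r by (simp add: K_def)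
  have "x0 \<in> ball x0 s" using s by simp
  then have C0: "C \<ge> 0" using order_trans[OF norm_ge_zero Z(3)[of "(x0, 0)"]] by simp
  define H where "H \<tau> i w = eval_fps (lie_fps a (\<lambda>w. Z w $ i) w) \<tau>" for \<tau> i w
  note bounds = cJ.lie_series_eval_bounds[OF Zi[unfolded r(2)] Z(3)[unfolded r(2)] a'[unfolded r(2)]
      a(2)[unfolded r(2)] a(3) r(1) K_def]
  define T where "T = snd c \<circ> inv_into U z"
  have Tra: "real_analytic_at T \<zeta>" if "\<zeta> \<in> z ` (fst c \<inter> U)" for \<zeta>
    using J z(1) c(1) that unfolding complex_structure_def transition_def real_analytic_on_def T_def by fastforce
  have zp: "z p \<in> z ` (fst c \<inter> U)" using z c by blast
  obtain r1 L where r1: "r1 > 0" and L: "L \<ge> 0"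
      "\<And>x y. x \<in> ball (z p) r1 \<Longrightarrow> y \<in> ball (z p) r1 \<Longrightarrow> norm (T x - T y) \<le> L * norm (x - y)"
    using real_analytic_at_locally_lipschitz[OF Tra[OF zp]] by blast
  have "open (z ` (fst c \<inter> U))"
    using chart_open_image[OF chz, of "fst c \<inter> U"] Uo chart_open[OF ch] by (simp add: open_Int)
  then obtain r2 where r2: "r2 > 0" "ball (z p) r2 \<subseteq> z ` (fst c \<inter> U)"
    using zp open_contains_ball by blast
  \<comment> \<open>The third bound makes \<open>T\<close> map the ball of radius \<open>2 * \<rho>\<close> into the ball of radius \<open>r / 2\<close>.\<close>
  define \<rho> where "\<rho> = Min {r1, r2, (r / 2) / (L + 1)} / 3"
  have \<rho>: "\<rho> > 0" "3 * \<rho> \<le> r1" "3 * \<rho> \<le> r2" "3 * \<rho> \<le> (r / 2) / (L + 1)"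
    using r1 r2 r L unfolding \<rho>_def by auto
  have sub1: "ball (z p) (2 * \<rho>) \<subseteq> ball (z p) r1" "ball (z p) (2 * \<rho>) \<subseteq> z ` (fst c \<inter> U)"
    using \<rho> r2(2) subset_ball[of "2 * \<rho>" r2 "z p"] by (auto simp: subset_ball)
  have Tp: "T (z p) = x0" using inv_z z by (simp add: T_def x0_def)
  have Tball: "T \<zeta> \<in> ball x0 (r / 2)" if \<zeta>: "\<zeta> \<in> ball (z p) (2 * \<rho>)" for \<zeta>
  proof -
    have "norm (T (z p) - T \<zeta>) \<le> L * norm (z p - \<zeta>)"
      using L(2)[of "z p" \<zeta>] \<zeta> sub1 r1 by auto
    also have "\<dots> \<le> (L + 1) * (2 * \<rho>)" using \<zeta> L \<rho> by (intro mult_mono) (auto simp: dist_norm)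
    also have "\<dots> < (L + 1) * (3 * \<rho>)" using L \<rho> by simp
    also have "\<dots> \<le> r / 2" using \<rho>(4) L by (simp add: field_simps)
    finally show ?thesis using Tp by (simp add: dist_norm)
  qed
  have inU: "inv_into U z \<zeta> \<in> fst c \<inter> U" "z (inv_into U z \<zeta>) = \<zeta>" "chart_inv c (T \<zeta>) = inv_into U z \<zeta>"
    if \<zeta>: "\<zeta> \<in> ball (z p) (2 * \<rho>)" for \<zeta>
  proof -
    obtain m where m: "m \<in> fst c" "m \<in> U" "\<zeta> = z m" using sub1(2) \<zeta> by blast
    then show "inv_into U z \<zeta> \<in> fst c \<inter> U" "z (inv_into U z \<zeta>) = \<zeta>" "chart_inv c (T \<zeta>) = inv_into U z \<zeta>"
      using inv_z chart_inv_left[OF ch] by (auto simp: T_def)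
  qed
  have term_eq: "lie_term A X \<tau> (\<lambda>q. z q $ i) k (chart_inv c \<xi>) = fps_nth (lie_fps a (\<lambda>w. Z w $ i) (\<xi>, 0)) k * \<tau> ^ k"
    if "\<xi> \<in> ball x0 s" for \<tau> i k \<xi>
    by (rule lie_term_eq[OF A X c(1) a(1) Zi _ that]) (simp add: Z(2))
  have series_eq: "lie_series A X \<tau> (\<lambda>q. z q $ i) (inv_into U z \<zeta>) = H \<tau> i (T \<zeta>, 0)"
    if "\<zeta> \<in> ball (z p) (2 * \<rho>)" for \<tau> i \<zeta>
  proof -
    have "T \<zeta> \<in> ball x0 s" using Tball[OF that] r by simp
    then have "lie_series A X \<tau> (\<lambda>q. z q $ i) (chart_inv c (T \<zeta>)) = H \<tau> i (T \<zeta>, 0)"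
      unfolding H_def by (rule lie_series_eq_eval_fps[OF A X c(1) a(1) Zi, rotated]) (simp add: Z(2))
    then show ?thesis by (simp add: inU(3)[OF that])
  qed
  have Zeq: "Z (T \<zeta>, 0) = \<zeta>" if "\<zeta> \<in> ball (z p) (2 * \<rho>)" for \<zeta>
  proof -
    have "T \<zeta> \<in> ball x0 s" using Tball[OF that] r by simp
    then show ?thesis using Z(2) inU[OF that] by simp
  qed
  define n where "n = real CARD('n)"
  define M where "M = n * (2 * C * K)"
  have M0: "M \<ge> 0" using C0 K0 by (simp add: M_def n_def)
  \<comment> \<open>The three bounds give, in this order, convergence, a displacement of at most \<open>\<rho> / 2\<close>, and the Lipschitz constant \<open>1 / 2\<close>.\<close>
  define \<epsilon> where "\<epsilon> = Min {1 / (2 * (K + 1)), \<rho> / (2 * (M + 1)), r / (4 * (M * L + 1))}"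
  have LM0: "M * L \<ge> 0" using M0 L by simp
  have \<epsilon>: "\<epsilon> > 0" "\<epsilon> \<le> 1 / (2 * (K + 1))" "\<epsilon> \<le> \<rho> / (2 * (M + 1))" "\<epsilon> \<le> r / (4 * (M * L + 1))"
    unfolding \<epsilon>_def using K0 \<rho>(1) M0 r LM0 by auto
  have "flow_chart A X J\<^sub>0 p U z \<rho> M \<epsilon>"
    unfolding flow_chart_def
  proof (intro conjI ballI allI)
    show "(U, z) \<in> J\<^sub>0" "p \<in> U" "\<rho> > 0" "\<epsilon> > 0" "M \<ge> 0" by fact+
    have "M * \<epsilon> \<le> (M + 1) * (\<rho> / (2 * (M + 1)))" using M0 \<epsilon> \<rho> by (intro mult_mono) auto
    also have "\<dots> = \<rho> / 2" using M0 by (simp add: field_simps)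
    finally show "M * \<epsilon> \<le> \<rho> / 2" .
    show "ball (z p) (3 * \<rho>) \<subseteq> z ` U" using subset_ball[OF \<rho>(3), of "z p"] r2(2) by blast
    fix \<tau> :: complex assume "\<tau> \<in> ball 0 \<epsilon>"
    then have \<tau>: "norm \<tau> < \<epsilon>" by simp
    have K\<tau>: "K * norm \<tau> \<le> 1 / 2"
    proof -
      have "K * norm \<tau> \<le> (K + 1) * (1 / (2 * (K + 1)))" using K0 \<tau> \<epsilon> by (intro mult_mono) auto
      also have "\<dots> = 1 / 2" using K0 by (simp add: field_simps)
      finally show ?thesis .
    qed
    have bd1: "norm (fps_nth (lie_fps a (\<lambda>w. Z w $ i) w) k * \<tau> ^ k) \<le> C * (1 / 2) ^ k"
      if "w \<in> ball (x0, 0) r" for w k i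
      by (rule bounds(1)[OF _ _ K\<tau> that])
    have bd2: "hol_on cJ (\<lambda>w. eval_fps (lie_fps a (\<lambda>w. Z w $ i) w) \<tau>) (ball (x0, 0) r)" for i
      by (rule bounds(2)[OF _ _ K\<tau>])
    have bd3: "norm (eval_fps (lie_fps a (\<lambda>w. Z w $ i) w) \<tau> - Z w $ i) \<le> 2 * C * K * norm \<tau>"
      if "w \<in> ball (x0, 0) r" for w i
      by (rule bounds(3)[OF _ _ K\<tau> that])
    have r_s: "ball x0 r \<subseteq> ball x0 s" "ball x0 (r / 2) \<subseteq> ball x0 r" using r by (auto simp: subset_ball)
    show "lie_series_converges_on A X \<tau> (\<lambda>q. z q $ i) (U \<inter> z -` ball (z p) (2 * \<rho>))" for i
    proof -
      have geo: "summable (\<lambda>k. C * (1 / 2 :: real) ^ k)" by (intro summable_mult summable_geometric) simp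
      have lt: "norm (lie_term A X \<tau> (\<lambda>q. z q $ i) k q) \<le> C * (1 / 2) ^ k"
        if q: "q \<in> U \<inter> z -` ball (z p) (2 * \<rho>)" for k q
      proof -
        have zq: "z q \<in> ball (z p) (2 * \<rho>)" "inv_into U z (z q) = q" using q inv_z by auto
        have Tq: "T (z q) \<in> ball x0 r" using Tball[OF zq(1)] r_s(2) by blast
        have "chart_inv c (T (z q)) = q" using inU(3)[OF zq(1)] zq(2) by simp
        then have "lie_term A X \<tau> (\<lambda>q. z q $ i) k q = fps_nth (lie_fps a (\<lambda>w. Z w $ i) (T (z q), 0)) k * \<tau> ^ k"
          using term_eq[of "T (z q)" \<tau> i k] Tq r_s(1) by auto
        moreover have "(T (z q), 0) \<in> ball (x0, 0) r" using Tq by simp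
        ultimately show ?thesis using bd1 by simp
      qed
      show ?thesis unfolding lie_series_converges_on_def
      proof (intro conjI ballI allI impI)
        fix q assume q: "q \<in> U \<inter> z -` ball (z p) (2 * \<rho>)"
        show "summable (\<lambda>k. norm (lie_term A X \<tau> (\<lambda>q. z q $ i) k q))"
          by (rule summable_comparison_test[OF _ geo]) (use lt[OF q] in auto)
      next
        fix K' :: "'m set" assume "compact K' \<and> K' \<subseteq> U \<inter> z -` ball (z p) (2 * \<rho>)"
        then have "uniform_limit K' (\<lambda>N q. \<Sum>k<N. lie_term A X \<tau> (\<lambda>q. z q $ i) k q)
            (\<lambda>q. \<Sum>k. lie_term A X \<tau> (\<lambda>q. z q $ i) k q) sequentially"
          by (intro Weierstrass_m_test[OF _ geo] lt) blast
        then show "uniformly_convergent_on K' (\<lambda>N q. \<Sum>k<N. lie_term A X \<tau> (\<lambda>q. z q $ i) k q)"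
          unfolding uniformly_convergent_on_def by blast
      qed
    qed
    have diff_eq: "(flow_coords A X U z \<tau> \<zeta> - \<zeta>) $ i = H \<tau> i (T \<zeta>, 0) - Z (T \<zeta>, 0) $ i"
      if "\<zeta> \<in> ball (z p) (2 * \<rho>)" for \<zeta> i
      using series_eq[OF that] Zeq[OF that] by (simp add: lie_series_coords_def)
    have near: "norm (H \<tau> i w - Z w $ i) \<le> 2 * C * K * norm \<tau>" if "w \<in> ball (x0, 0) r" for w i
      unfolding H_def by (rule bd3[OF that])
    have holH: "hol_on cJ (H \<tau> i) (ball (x0, 0) r)" for i
      unfolding H_def[abs_def] by (rule bd2)
    show "norm (flow_coords A X U z \<tau> \<zeta> - \<zeta>) \<le> M * norm \<tau>"
      if "\<zeta> \<in> ball (z p) (2 * \<rho>)" for \<zeta>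
    proof -
      have "norm (flow_coords A X U z \<tau> \<zeta> - \<zeta>) \<le> real CARD('n) * (2 * C * K * norm \<tau>)"
      proof (rule norm_vec_le_card)
        fix i
        have "(T \<zeta>, 0) \<in> ball (x0, 0) r" using Tball[OF that] r_s(2) by auto
        then show "norm ((flow_coords A X U z \<tau> \<zeta> - \<zeta>) $ i) \<le> 2 * C * K * norm \<tau>"
          unfolding diff_eq[OF that] by (rule near)
      qed
      then show ?thesis by (simp add: M_def n_def mult_ac)
    qed
    show "real_analytic_at (\<lambda>\<zeta>. flow_coords A X U z \<tau> \<zeta>) \<zeta>"
      if \<zeta>: "\<zeta> \<in> ball (z p) (2 * \<rho>)" for \<zeta>
    proof (rule real_analytic_at_cong[OF _ open_ball \<zeta>])
      show "real_analytic_at (\<lambda>\<zeta>. \<chi> i. H \<tau> i (T \<zeta>, 0)) \<zeta>"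
      proof (rule real_analytic_at_vec, unfold vec_lambda_beta)
        fix i
        have "T \<zeta> \<in> ball x0 r" using Tball[OF \<zeta>] r_s(2) by blast
        then have pos: "r - dist x0 (T \<zeta>) > 0" by simp
        have "ball (T \<zeta>, 0) (r - dist x0 (T \<zeta>)) \<subseteq> ball (x0, 0 :: real ^ 'd) r"
          by (simp add: ball_subset_ball_iff dist_commute)
        from cdiff_on_subset[OF holH this]
        have "real_analytic_at (\<lambda>\<xi>. H \<tau> i (\<xi>, 0)) (T \<zeta>)"
          by (rule extension_imp_real_analytic_at[OF pos]) simp
        then show "real_analytic_at (\<lambda>\<zeta>. H \<tau> i (T \<zeta>, 0)) \<zeta>"
          using real_analytic_at_compose[OF Tra] \<zeta> sub1(2) by blast
      qed
    qed (simp add: series_eq lie_series_coords_def)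
    show "norm ((flow_coords A X U z \<tau> \<zeta> - \<zeta>)
             - (flow_coords A X U z \<tau> \<zeta>' - \<zeta>')) \<le> norm (\<zeta> - \<zeta>') / 2"
      if \<zeta>: "\<zeta> \<in> ball (z p) (2 * \<rho>)" "\<zeta>' \<in> ball (z p) (2 * \<rho>)" for \<zeta> \<zeta>'
    proof -
      have "norm ((flow_coords A X U z \<tau> \<zeta> - \<zeta>)
             - (flow_coords A X U z \<tau> \<zeta>' - \<zeta>'))
            \<le> real CARD('n) * ((2 * C * K * norm \<tau>) / (r / 2) * (L * norm (\<zeta> - \<zeta>')))"
      proof (rule norm_vec_le_card)
        fix i
        have hd: "hol_on cJ (\<lambda>w. H \<tau> i w - Z w $ i) (ball (x0, 0) (r / 2 + r / 2))"
          using r(1) r(2) by (intro hol_on_diff) (use holH[of i] cdiff_on_subset[OF Zi[of i] subset_ball[of r s]] in auto)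
        have "norm ((H \<tau> i (T \<zeta>, 0) - Z (T \<zeta>, 0) $ i) - (H \<tau> i (T \<zeta>', 0) - Z (T \<zeta>', 0) $ i))
           \<le> (2 * C * K * norm \<tau>) / (r / 2) * norm ((T \<zeta>, 0) - (T \<zeta>', 0 :: real ^ 'd))"
          by (rule cJ.hol_lipschitz[OF hd]) (use near r(1) Tball \<zeta> in auto)
        also have "norm ((T \<zeta>, 0) - (T \<zeta>', 0 :: real ^ 'd)) = norm (T \<zeta> - T \<zeta>')" by (simp add: norm_Pair)
        also have "(2 * C * K * norm \<tau>) / (r / 2) * norm (T \<zeta> - T \<zeta>')
            \<le> (2 * C * K * norm \<tau>) / (r / 2) * (L * norm (\<zeta> - \<zeta>'))"
        proof (rule mult_left_mono)
          show "norm (T \<zeta> - T \<zeta>') \<le> L * norm (\<zeta> - \<zeta>')" by (rule L(2)) (use \<zeta> sub1(1) in blast)+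
        qed (use C0 K0 r(1) in simp)
        finally show "norm (((flow_coords A X U z \<tau> \<zeta> - \<zeta>)
             - (flow_coords A X U z \<tau> \<zeta>' - \<zeta>')) $ i)
            \<le> (2 * C * K * norm \<tau>) / (r / 2) * (L * norm (\<zeta> - \<zeta>'))"
          unfolding vector_minus_component[of "_ - \<zeta>"] diff_eq[OF \<zeta>(1)] diff_eq[OF \<zeta>(2)] .
      qed
      also have "\<dots> = (M * L * norm \<tau>) * (2 / r) * norm (\<zeta> - \<zeta>')"
        by (simp add: M_def n_def)
      also have "\<dots> \<le> 1 / 2 * norm (\<zeta> - \<zeta>')"
      proof (rule mult_right_mono)
        have "M * L * norm \<tau> \<le> (M * L + 1) * (r / (4 * (M * L + 1)))"
          using LM0 \<tau> \<epsilon> by (intro mult_mono) auto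
        also have "\<dots> = r / 4" using LM0 by (simp add: field_simps)
        finally show "M * L * norm \<tau> * (2 / r) \<le> 1 / 2" using r by (simp add: field_simps)
      qed simp
      finally show ?thesis by simp
    qed
  qed
  then show ?thesis by blast
qed

section \<open>Transport of a maximal atlas\<close>

definition push_chart :: "('m \<Rightarrow> 'm) \<Rightarrow> ('m, 'c) chart \<Rightarrow> ('m, 'c) chart" where
  "push_chart \<phi> c = (\<phi> ` fst c, snd c \<circ> inv \<phi>)"

lemma bij_inv_cancel: "bij \<phi> \<Longrightarrow> inv \<phi> (\<phi> q) = q" "bij \<phi> \<Longrightarrow> \<phi> (inv \<phi> q) = q"
  by (simp_all add: bij_is_inj inv_f_f bij_is_surj surj_f_inv_f)

lemma push_chart_image: "bij \<phi> \<Longrightarrow> S \<subseteq> fst c \<Longrightarrow> snd (push_chart \<phi> c) ` (\<phi> ` S) = snd c ` S"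
  by (simp add: push_chart_def image_image bij_inv_cancel)

lemma inj_on_push_chart:
  assumes "bij \<phi>" "inj_on (snd c) (fst c)"
  shows "inj_on (snd (push_chart \<phi> c)) (fst (push_chart \<phi> c))"
  using assms by (auto simp: push_chart_def inj_on_def bij_inv_cancel)

lemma push_chart_inv:
  assumes "bij \<phi>" "inj_on (snd c) (fst c)" "\<xi> \<in> snd c ` fst c"
  shows "chart_inv (push_chart \<phi> c) \<xi> = \<phi> (chart_inv c \<xi>)"
proof -
  obtain q where q: "q \<in> fst c" "\<xi> = snd c q" using assms(3) by blast
  have "chart_inv (push_chart \<phi> c) (snd (push_chart \<phi> c) (\<phi> q)) = \<phi> q"
    by (rule inv_into_f_f[OF inj_on_push_chart[OF assms(1,2)]]) (use q in \<open>simp add: push_chart_def\<close>)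
  moreover have "snd (push_chart \<phi> c) (\<phi> q) = \<xi>"
    using q assms(1) by (simp add: push_chart_def bij_inv_cancel)
  moreover have "chart_inv c \<xi> = q" using q assms(2) by simp
  ultimately show ?thesis by simp
qed

lemma is_chart_push_chart:
  assumes \<phi>: "bij \<phi>" "continuous_on UNIV \<phi>" "continuous_on UNIV (inv \<phi>)" and c: "is_chart c"
  shows "is_chart (push_chart \<phi> c)"
proof -
  have img: "snd (push_chart \<phi> c) ` fst (push_chart \<phi> c) = snd c ` fst c"
    using push_chart_image[OF \<phi>(1), of "fst c" c] by (simp add: push_chart_def)
  have "\<phi> ` fst c = inv \<phi> -` fst c" using \<phi>(1) by (simp add: bij_vimage_eq_inv_image bij_imp_bij_inv inv_inv_eq)
  then have op: "open (fst (push_chart \<phi> c))"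
    using \<phi>(3) chart_open[OF c] by (simp add: push_chart_def continuous_on_open_vimage)
  have inj: "inj_on (snd c) (fst c)" by (rule chart_inj[OF c])
  show ?thesis
    unfolding is_chart_iff homeomorphism_def img
  proof (intro conjI ballI)
    show "open (fst (push_chart \<phi> c))" by (rule op)
    show "open (snd c ` fst c)" using c by (simp add: is_chart_iff)
    show "chart_inv (push_chart \<phi> c) (snd (push_chart \<phi> c) q) = q" if "q \<in> fst (push_chart \<phi> c)" for q
      by (rule inv_into_f_f[OF inj_on_push_chart[OF \<phi>(1) inj] that])
    show "snd c ` fst c = snd c ` fst c" by (rule refl)
    from img show "chart_inv (push_chart \<phi> c) ` (snd c ` fst c) = fst (push_chart \<phi> c)"
      using inj_on_push_chart[OF \<phi>(1) inj] by (metis inj_on_imp_bij_betw bij_betw_inv_into bij_betw_imp_surj_on)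
    show "snd (push_chart \<phi> c) (chart_inv (push_chart \<phi> c) \<xi>) = \<xi>" if "\<xi> \<in> snd c ` fst c" for \<xi>
      by (rule f_inv_into_f) (use that img in simp)
    show "continuous_on (fst (push_chart \<phi> c)) (snd (push_chart \<phi> c))"
      unfolding push_chart_def fst_conv snd_conv
      by (rule continuous_on_compose[OF continuous_on_subset[OF \<phi>(3) subset_UNIV]])
         (use chart_continuous[OF c] \<phi>(1) in \<open>simp add: image_image bij_inv_cancel\<close>)
    have "continuous_on (snd c ` fst c) (\<lambda>\<xi>. \<phi> (chart_inv c \<xi>))"
      by (rule continuous_on_compose2[OF \<phi>(2) chart_inv_continuous[OF c]]) simp
    then show "continuous_on (snd c ` fst c) (chart_inv (push_chart \<phi> c))"
      by (rule continuous_on_eq) (simp add: push_chart_inv[OF \<phi>(1) inj])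
  qed
qed

lemma push_chart_inverse:
  assumes "bij \<phi>" shows "push_chart \<phi> (push_chart (inv \<phi>) c) = c" "push_chart (inv \<phi>) (push_chart \<phi> c) = c"
  using assms by (auto simp: push_chart_def image_image bij_inv_cancel inv_inv_eq o_def intro!: prod_eqI)

lemma transition_push_chart:
  assumes "bij \<phi>" "inj_on (snd c) (fst c)" "\<xi> \<in> snd c ` fst c"
  shows "transition (push_chart \<phi> c) (push_chart \<phi> c') \<xi> = transition c c' \<xi>"
  using push_chart_inv[OF assms] assms(1)
  by (simp add: transition_def push_chart_def bij_inv_cancel)

lemma holomorphic_map_on_cong_open:
  assumes "open S" "\<And>x. x \<in> S \<Longrightarrow> f x = g x" "holomorphic_map_on f S"
  shows "holomorphic_map_on g S"
  using cdiff_on_cong[of _ _ f S g] assms unfolding holomorphic_map_on_iff by blast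

lemma compatible_push_chart:
  assumes \<phi>: "bij \<phi>" "continuous_on UNIV \<phi>" "continuous_on UNIV (inv \<phi>)"
    and c: "is_chart c" "is_chart c'"
    and P: "\<And>f g S. open S \<Longrightarrow> (\<And>x. x \<in> S \<Longrightarrow> f x = g x) \<Longrightarrow> P f S \<Longrightarrow> P g S"
  shows "compatible P (push_chart \<phi> c) (push_chart \<phi> c') \<longleftrightarrow> compatible P c c'"
proof -
  have dom: "fst (push_chart \<phi> c) \<inter> fst (push_chart \<phi> c') = \<phi> ` (fst c \<inter> fst c')"
    using \<phi>(1) by (simp add: push_chart_def image_Int bij_is_inj)
  have img: "snd (push_chart \<phi> c) ` (\<phi> ` (fst c \<inter> fst c')) = snd c ` (fst c \<inter> fst c')"
     "snd (push_chart \<phi> c') ` (\<phi> ` (fst c \<inter> fst c')) = snd c' ` (fst c \<inter> fst c')"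
    by (rule push_chart_image[OF \<phi>(1)], blast)+
  have op: "open (snd c ` (fst c \<inter> fst c'))" "open (snd c' ` (fst c \<inter> fst c'))"
    using chart_open_image[OF c(1), of "fst c \<inter> fst c'"] chart_open_image[OF c(2), of "fst c \<inter> fst c'"]
      chart_open[OF c(1)] chart_open[OF c(2)] by (simp_all add: open_Int)
  have eq: "transition (push_chart \<phi> c) (push_chart \<phi> c') \<xi> = transition c c' \<xi>"
    if "\<xi> \<in> snd c ` (fst c \<inter> fst c')" for \<xi>
    by (rule transition_push_chart[OF \<phi>(1) chart_inj[OF c(1)]]) (use that in blast)
  have eq': "transition (push_chart \<phi> c') (push_chart \<phi> c) \<xi> = transition c' c \<xi>"
    if "\<xi> \<in> snd c' ` (fst c \<inter> fst c')" for \<xi>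
    by (rule transition_push_chart[OF \<phi>(1) chart_inj[OF c(2)]]) (use that in blast)
  have "P (transition (push_chart \<phi> c) (push_chart \<phi> c')) (snd c ` (fst c \<inter> fst c'))
          \<longleftrightarrow> P (transition c c') (snd c ` (fst c \<inter> fst c'))"
    using P[OF op(1), of "transition c c'" "transition (push_chart \<phi> c) (push_chart \<phi> c')"]
      P[OF op(1), of "transition (push_chart \<phi> c) (push_chart \<phi> c')" "transition c c'"] eq by metis
  moreover have "P (transition (push_chart \<phi> c') (push_chart \<phi> c)) (snd c' ` (fst c \<inter> fst c'))
          \<longleftrightarrow> P (transition c' c) (snd c' ` (fst c \<inter> fst c'))"
    using P[OF op(2), of "transition c' c" "transition (push_chart \<phi> c') (push_chart \<phi> c)"]
      P[OF op(2), of "transition (push_chart \<phi> c') (push_chart \<phi> c)" "transition c' c"] eq' by metis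
  ultimately show ?thesis unfolding compatible_def dom img by blast
qed

text \<open>The push-forward of charts under a homeomorphism is a bijection between all charts that preserves
  compatibility, because it does not change the transition maps. The hypothesis on \<open>P\<close> is needed since transition maps
  are total functions whose values outside their domains may change.\<close>

lemma maximal_atlas_pull_back:
  assumes \<phi>: "bij \<phi>" "continuous_on UNIV \<phi>" "continuous_on UNIV (inv \<phi>)"
    and P: "\<And>f g S. open S \<Longrightarrow> (\<And>x. x \<in> S \<Longrightarrow> f x = g x) \<Longrightarrow> P f S \<Longrightarrow> P g S"
    and A: "maximal_atlas P A"
  shows "maximal_atlas P {c. push_chart \<phi> c \<in> A}"
proof -
  have \<phi>': "bij (inv \<phi>)" "continuous_on UNIV (inv \<phi>)" "continuous_on UNIV (inv (inv \<phi>))"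
    using \<phi> by (simp_all add: bij_imp_bij_inv inv_inv_eq)
  have ch: "is_chart (push_chart \<phi> c) \<longleftrightarrow> is_chart c" for c :: "('a, 'b) chart"
    using is_chart_push_chart[OF \<phi>, of c] is_chart_push_chart[OF \<phi>', of "push_chart \<phi> c"]
      push_chart_inverse(2)[OF \<phi>(1), of c] by auto
  have comp: "compatible P (push_chart \<phi> c) (push_chart \<phi> c') \<longleftrightarrow> compatible P c c'"
    if "is_chart c" "is_chart c'" for c c'
    by (rule compatible_push_chart[OF \<phi> that P])
  show ?thesis
    unfolding maximal_atlas_def
  proof (intro conjI ballI allI impI)
    fix c assume "c \<in> {c. push_chart \<phi> c \<in> A}"
    then show "is_chart c" using maximal_atlas_is_chart[OF A] ch by blast
  next
    show "(\<Union>c\<in>{c. push_chart \<phi> c \<in> A}. fst c) = UNIV"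
    proof (intro equalityI subsetI UNIV_I)
      fix q
      obtain c where c: "c \<in> A" "\<phi> q \<in> fst c" using maximal_atlas_covers[OF A] by blast
      have "push_chart (inv \<phi>) c \<in> {c. push_chart \<phi> c \<in> A}"
        using c(1) push_chart_inverse(1)[OF \<phi>(1), of c] by simp
      moreover have "q \<in> fst (push_chart (inv \<phi>) c)"
        using c(2) \<phi>(1) by (auto simp: push_chart_def image_iff bij_inv_cancel intro!: bexI[of _ "\<phi> q"])
      ultimately show "q \<in> (\<Union>c\<in>{c. push_chart \<phi> c \<in> A}. fst c)" by blast
    qed
  next
    fix c c' assume c: "c \<in> {c. push_chart \<phi> c \<in> A}" "c' \<in> {c. push_chart \<phi> c \<in> A}"
    then have "compatible P (push_chart \<phi> c) (push_chart \<phi> c')"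
      using A unfolding maximal_atlas_def by blast
    then show "compatible P c c'"
      using comp maximal_atlas_is_chart[OF A] ch c by blast
  next
    fix c assume c: "is_chart c \<and> (\<forall>c'\<in>{c. push_chart \<phi> c \<in> A}. compatible P c c')"
    have "compatible P (push_chart \<phi> c) d" if d: "d \<in> A" for d
    proof -
      let ?c' = "push_chart (inv \<phi>) d"
      have d': "push_chart \<phi> ?c' = d" by (rule push_chart_inverse(1)[OF \<phi>(1)])
      have "is_chart ?c'" using maximal_atlas_is_chart[OF A d] ch[of ?c'] d' by simp
      moreover have "?c' \<in> {c. push_chart \<phi> c \<in> A}" using d d' by simp
      then have "compatible P c ?c'" using c by blast
      ultimately show ?thesis using comp[of c ?c'] c d' by simp
    qed
    moreover have "is_chart (push_chart \<phi> c)" using c ch by blast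
    ultimately have "push_chart \<phi> c \<in> A" using A unfolding maximal_atlas_def by blast
    then show "c \<in> {c. push_chart \<phi> c \<in> A}" by blast
  qed
qed

text \<open>A chart of a maximal atlas may be restricted to a smaller open set and redefined arbitrarily outside of it.\<close>

lemma chart_inv_restrict:
  assumes "is_chart c" "W \<subseteq> fst c" "\<And>q. q \<in> W \<Longrightarrow> z q = snd c q" "\<xi> \<in> snd c ` W"
  shows "inv_into W z \<xi> = chart_inv c \<xi>"
proof -
  obtain q where q: "q \<in> W" "\<xi> = snd c q" using assms(4) by blast
  have "inj_on z W"
    using chart_inj[OF assms(1)] assms(2,3) by (metis inj_on_cong inj_on_subset)
  then have "inv_into W z (z q) = q" using q(1) by simp
  then show ?thesis using q assms(2,3) chart_inv_left[OF assms(1), of q] by auto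
qed

lemma maximal_atlas_restrict:
  assumes P: "\<And>f g S. open S \<Longrightarrow> (\<And>x. x \<in> S \<Longrightarrow> f x = g x) \<Longrightarrow> P f S \<Longrightarrow> P g S"
    and P': "\<And>f S S'. P f S \<Longrightarrow> S' \<subseteq> S \<Longrightarrow> P f S'"
    and A: "maximal_atlas P A" and c: "c \<in> A"
    and W: "open W" "W \<subseteq> fst c" and z: "\<And>q. q \<in> W \<Longrightarrow> z q = snd c q"
  shows "(W, z) \<in> A"
proof -
  have ch: "is_chart c" by (rule maximal_atlas_is_chart[OF A c])
  have img: "z ` W' = snd c ` W'" if "W' \<subseteq> W" for W' using z that by (auto intro!: image_cong)
  have inv: "inv_into W z \<xi> = chart_inv c \<xi>" if "\<xi> \<in> snd c ` W" for \<xi>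
    by (rule chart_inv_restrict[OF ch W(2) z that])
  have "is_chart (W, z)"
    unfolding is_chart_iff homeomorphism_def fst_conv snd_conv img[OF order_refl]
  proof (intro conjI ballI)
    show "open W" by (rule W(1))
    show "open (snd c ` W)" by (rule chart_open_image[OF ch W])
    show "inv_into W z (z q) = q" if "q \<in> W" for q
      using inv[of "snd c q"] z[OF that] that chart_inv_left[OF ch, of q] W(2) by auto
    show "snd c ` W = snd c ` W" by (rule refl)
    show "z (inv_into W z \<xi>) = \<xi>" if "\<xi> \<in> snd c ` W" for \<xi>
      by (rule f_inv_into_f) (use that img[of W] in simp)
    show "inv_into W z ` (snd c ` W) = W"
    proof -
      have "inv_into W z (snd c q) = q" if "q \<in> W" for q
        using inv[of "snd c q"] that chart_inv_left[OF ch, of q] W(2) by auto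
      then show ?thesis by (simp add: image_image)
    qed
    show "continuous_on W z"
      using continuous_on_subset[OF chart_continuous[OF ch] W(2)] by (rule continuous_on_eq) (simp add: z)
    show "continuous_on (snd c ` W) (inv_into W z)"
      using continuous_on_subset[OF chart_inv_continuous[OF ch] image_mono[OF W(2)]]
      by (rule continuous_on_eq) (simp only: inv)
  qed
  moreover have "compatible P (W, z) d" if d: "d \<in> A" for d
  proof -
    have chd: "is_chart d" by (rule maximal_atlas_is_chart[OF A d])
    have 1: "P (transition c d) (snd c ` (fst c \<inter> fst d))" "P (transition d c) (snd d ` (fst d \<inter> fst c))"
      by (rule maximal_atlas_transition[OF A c d], rule maximal_atlas_transition[OF A d c])
    have "P (transition (W, z) d) (snd c ` (W \<inter> fst d))"
    proof (rule P)
      show "open (snd c ` (W \<inter> fst d))"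
        by (rule chart_open_image[OF ch]) (use W chart_open[OF chd] in auto)
      show "P (transition c d) (snd c ` (W \<inter> fst d))" by (rule P'[OF 1(1)]) (use W in blast)
      show "transition c d \<xi> = transition (W, z) d \<xi>" if "\<xi> \<in> snd c ` (W \<inter> fst d)" for \<xi>
        using inv[of \<xi>] that by (auto simp: transition_def)
    qed
    moreover have "P (transition d (W, z)) (snd d ` (W \<inter> fst d))"
    proof (rule P)
      show "open (snd d ` (W \<inter> fst d))"
        by (rule chart_open_image[OF chd]) (use W chart_open[OF chd] in auto)
      show "P (transition d c) (snd d ` (W \<inter> fst d))" by (rule P'[OF 1(2)]) (use W in blast)
      show "transition d c \<xi> = transition d (W, z) \<xi>" if "\<xi> \<in> snd d ` (W \<inter> fst d)" for \<xi>
      proof -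
        have "chart_inv d \<xi> \<in> W \<inter> fst d" by (rule chart_inv_in[OF chd _ that]) blast
        then show ?thesis by (simp add: transition_def z)
      qed
    qed
    ultimately show ?thesis unfolding compatible_def using img[of "W \<inter> fst d"] by simp
  qed
  ultimately show ?thesis using A unfolding maximal_atlas_def by blast
qed

lemma holomorphic_map_on_subset: "holomorphic_map_on f S \<Longrightarrow> S' \<subseteq> S \<Longrightarrow> holomorphic_map_on f S'"
  unfolding holomorphic_map_on_def by blast

text \<open>In the coordinates of the pulled back atlas, the map is given by transition maps of the original one.\<close>

lemma biholomorphism_pull_back:
  fixes J\<^sub>0 :: "('m::t2_space, complex ^ 'n) chart set"
  assumes \<phi>: "bij \<phi>" "continuous_on UNIV \<phi>" "continuous_on UNIV (inv \<phi>)"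
    and J: "maximal_atlas holomorphic_map_on J\<^sub>0"
  shows "biholomorphism {c. push_chart \<phi> c \<in> J\<^sub>0} J\<^sub>0 \<phi>"
proof -
  have inv\<phi>: "inv \<phi> (\<phi> q) = q" "\<phi> (inv \<phi> q) = q" for q
    using \<phi>(1) by (simp_all add: bij_inv_cancel)
  have pull: "maximal_atlas holomorphic_map_on {c. push_chart \<phi> c \<in> J\<^sub>0}"
    by (rule maximal_atlas_pull_back[OF \<phi> _ J]) (rule holomorphic_map_on_cong_open)
  have trans: "inj_on (snd c) (fst c)" "is_chart c" if "push_chart \<phi> c \<in> J\<^sub>0" for c
    using maximal_atlas_is_chart[OF pull, of c] chart_inj[of c] that by simp_all
  have "holomorphic_map_on (snd d \<circ> \<phi> \<circ> chart_inv c) (snd c ` (fst c \<inter> \<phi> -` fst d))"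
    if c: "push_chart \<phi> c \<in> J\<^sub>0" and d: "d \<in> J\<^sub>0" for c d
  proof (rule holomorphic_map_on_cong_open)
    have op: "open (\<phi> -` fst d)"
      using chart_open[OF maximal_atlas_is_chart[OF J d]] \<phi>(2) by (simp add: continuous_on_open_vimage)
    show "open (snd c ` (fst c \<inter> \<phi> -` fst d))"
      by (rule chart_open_image[OF trans(2)[OF c]]) (use op chart_open[OF trans(2)[OF c]] in auto)
    have "holomorphic_map_on (transition (push_chart \<phi> c) d)
            (snd (push_chart \<phi> c) ` (fst (push_chart \<phi> c) \<inter> fst d))"
      by (rule maximal_atlas_transition[OF J c d])
    moreover have "fst (push_chart \<phi> c) \<inter> fst d = \<phi> ` (fst c \<inter> \<phi> -` fst d)"
      by (auto simp: push_chart_def)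
    moreover have "snd (push_chart \<phi> c) ` (\<phi> ` (fst c \<inter> \<phi> -` fst d)) = snd c ` (fst c \<inter> \<phi> -` fst d)"
      by (rule push_chart_image[OF \<phi>(1)]) blast
    ultimately show "holomorphic_map_on (transition (push_chart \<phi> c) d) (snd c ` (fst c \<inter> \<phi> -` fst d))"
      by simp
    show "transition (push_chart \<phi> c) d \<xi> = (snd d \<circ> \<phi> \<circ> chart_inv c) \<xi>"
      if "\<xi> \<in> snd c ` (fst c \<inter> \<phi> -` fst d)" for \<xi>
    proof -
      have "\<xi> \<in> snd c ` fst c" using that by blast
      from push_chart_inv[OF \<phi>(1) trans(1)[OF c] this] show ?thesis by (simp add: transition_def)
    qed
  qed
  then have 1: "holomorphic_between {c. push_chart \<phi> c \<in> J\<^sub>0} J\<^sub>0 \<phi>"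
    unfolding holomorphic_between_def using \<phi>(2) by fastforce
  have "holomorphic_map_on (snd c \<circ> inv \<phi> \<circ> chart_inv d) (snd d ` (fst d \<inter> inv \<phi> -` fst c))"
    if c: "push_chart \<phi> c \<in> J\<^sub>0" and d: "d \<in> J\<^sub>0" for c d
  proof -
    have "transition d (push_chart \<phi> c) = snd c \<circ> inv \<phi> \<circ> chart_inv d"
      by (simp add: transition_def push_chart_def o_assoc)
    moreover have "fst d \<inter> fst (push_chart \<phi> c) = fst d \<inter> inv \<phi> -` fst c"
      using inv\<phi> by (auto simp: push_chart_def image_iff) metis
    ultimately show ?thesis using maximal_atlas_transition[OF J d c] by simp
  qed
  then have 2: "holomorphic_between J\<^sub>0 {c. push_chart \<phi> c \<in> J\<^sub>0} (inv \<phi>)"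
    unfolding holomorphic_between_def using \<phi>(3) by fastforce
  show ?thesis unfolding biholomorphism_def using \<phi>(1) 1 2 by blast
qed

section \<open>The global flow\<close>

lemma flow_chart_mono:
  assumes "flow_chart A X J\<^sub>0 p U z \<rho> M \<epsilon>" "0 < \<epsilon>'" "\<epsilon>' \<le> \<epsilon>"
  shows "flow_chart A X J\<^sub>0 p U z \<rho> M \<epsilon>'"
proof -
  have "M * \<epsilon>' \<le> M * \<epsilon>" using assms unfolding flow_chart_def by (intro mult_left_mono) auto
  moreover have "ball 0 \<epsilon>' \<subseteq> (ball 0 \<epsilon> :: complex set)" using assms(3) by (rule subset_ball)
  ultimately show ?thesis using assms unfolding flow_chart_def by (meson order_trans subsetD)
qed

text \<open>Such a map shrinks distances from \<open>x\<close> by at most the factor \<open>1 / 2\<close>, hence its derivative has no kernel.\<close>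

lemma inj_derivative_near_identity:
  fixes f :: "'e::real_normed_vector \<Rightarrow> 'e"
  assumes f: "(f has_derivative f') (at x)" and S: "open S" "x \<in> S"
    and lip: "\<And>y. y \<in> S \<Longrightarrow> norm ((f y - y) - (f x - x)) \<le> norm (y - x) / 2"
  shows "inj f'"
proof -
  have lin: "linear f'" using f has_derivative_linear by blast
  have "v = 0" if v: "f' v = 0" for v
  proof (rule ccontr)
    assume v0: "v \<noteq> 0"
    have "\<forall>e>0. \<exists>d>0. \<forall>y. norm (y - x) < d \<longrightarrow> norm (f y - f x - f' (y - x)) \<le> e * norm (y - x)"
      using f unfolding has_derivative_at_alt by (rule conjunct2)
    then obtain d where d: "d > 0" "\<And>y. norm (y - x) < d \<Longrightarrow> norm (f y - f x - f' (y - x)) \<le> 1 / 4 * norm (y - x)"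
      by (metis zero_less_divide_1_iff zero_less_numeral)
    obtain e where e: "e > 0" "ball x e \<subseteq> S" using S open_contains_ball by blast
    define t where "t = min d e / (2 * norm v)"
    have t: "t > 0" "t * norm v = min d e / 2" using d(1) e(1) v0 by (auto simp: t_def)
    define y where "y = x + t *\<^sub>R v"
    have nyx: "norm (y - x) = min d e / 2" using t by (simp add: y_def)
    then have lt: "norm (y - x) < d" "norm (y - x) < e" "norm (y - x) > 0" using d(1) e(1) by auto
    have "y \<in> S" using e(2) lt(2) by (auto simp: dist_norm norm_minus_commute)
    have "f' (y - x) = 0" using v lin by (simp add: y_def linear_scale)
    then have "norm (f y - f x) \<le> 1 / 4 * norm (y - x)" using d(2)[OF lt(1)] by simp
    moreover have "norm (y - x) - norm (f y - f x) \<le> norm ((f y - y) - (f x - x))"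
      using norm_triangle_ineq2[of "y - x" "f y - f x"] by (simp add: algebra_simps norm_minus_commute)
    ultimately show False using lip[OF \<open>y \<in> S\<close>] lt(3) by linarith
  qed
  then show ?thesis using linear_injective_0[OF lin] by blast
qed

lemma holomorphic_transition_real_analytic:
  assumes A: "real_analytic_structure A" and J: "complex_structure A J\<^sub>0"
    and z: "z \<in> J\<^sub>0" "z' \<in> J\<^sub>0" and q: "q \<in> fst z" "q \<in> fst z'"
  shows "real_analytic_at (snd z' \<circ> chart_inv z) (snd z q)"
proof -
  obtain c where c: "c \<in> A" "q \<in> fst c"
    using A maximal_atlas_covers unfolding real_analytic_structure_def by blast
  have ch: "is_chart c" "is_chart z"
    using A J c z maximal_atlas_is_chart unfolding real_analytic_structure_def complex_structure_def by blast+
  have 1: "real_analytic_at (snd c \<circ> chart_inv z) (snd z q)" "real_analytic_at (snd z' \<circ> chart_inv c) (snd c q)"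
    using J c z q unfolding complex_structure_def transition_def real_analytic_on_def by auto
  show ?thesis by (rule real_analytic_at_change_chart[OF ch(2) q(1) ch(1) c(2) 1])
qed

text \<open>Flow charts with a common time \<open>T\<close> whose inner balls, of radius \<open>\<rho> p\<close>, cover the manifold. The flow is given by
  its Lie series on the balls of twice the radius; the margin is used for surjectivity.\<close>

locale flow_cover =
  fixes A :: "('m::t2_space, real ^ 'd) chart set" and J\<^sub>0 :: "('m, complex ^ 'n) chart set"
    and X :: "('m, real ^ 'd) chart \<Rightarrow> 'm \<Rightarrow> real ^ 'd"
    and P :: "'m set" and U :: "'m \<Rightarrow> 'm set" and z :: "'m \<Rightarrow> 'm \<Rightarrow> complex ^ 'n"
    and \<rho> M :: "'m \<Rightarrow> real" and T :: real
  assumes A: "real_analytic_structure A" and J: "complex_structure A J\<^sub>0"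
    and X: "real_analytic_vector_field A X"
    and flow_charts: "\<And>p. p \<in> P \<Longrightarrow> flow_chart A X J\<^sub>0 p (U p) (z p) (\<rho> p) (M p) T"
    and cover: "\<And>q. \<exists>p\<in>P. q \<in> U p \<and> z p q \<in> ball (z p p) (\<rho> p)"
begin

definition flow_dom :: "'m \<Rightarrow> 'm set" where
  "flow_dom p = U p \<inter> z p -` ball (z p p) (2 * \<rho> p)"

definition flow :: "complex \<Rightarrow> 'm \<Rightarrow> 'm" where
  "flow \<tau> q = (let p = (SOME p. p \<in> P \<and> q \<in> flow_dom p)
     in inv_into (U p) (z p) (lie_series_coords A X \<tau> (z p) q))"

lemma chart: "p \<in> P \<Longrightarrow> (U p, z p) \<in> J\<^sub>0"
  and \<rho>_pos: "p \<in> P \<Longrightarrow> \<rho> p > 0" and M_nonneg: "p \<in> P \<Longrightarrow> M p \<ge> 0"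
  and M_small: "p \<in> P \<Longrightarrow> M p * T \<le> \<rho> p / 2"
  and image_ball: "p \<in> P \<Longrightarrow> ball (z p p) (3 * \<rho> p) \<subseteq> z p ` U p"
  using flow_charts[of p] unfolding flow_chart_def by blast+

lemma
  assumes "p \<in> P" "\<tau> \<in> ball 0 T"
  shows converges: "lie_series_converges_on A X \<tau> (\<lambda>q. z p q $ i) (flow_dom p)"
    and coords_analytic: "\<zeta> \<in> ball (z p p) (2 * \<rho> p) \<Longrightarrow>
        real_analytic_at (\<lambda>\<zeta>. flow_coords A X (U p) (z p) \<tau> \<zeta>) \<zeta>"
    and coords_near: "\<zeta> \<in> ball (z p p) (2 * \<rho> p) \<Longrightarrow>
        norm (flow_coords A X (U p) (z p) \<tau> \<zeta> - \<zeta>) \<le> M p * norm \<tau>"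
    and coords_lipschitz: "\<zeta> \<in> ball (z p p) (2 * \<rho> p) \<Longrightarrow> \<zeta>' \<in> ball (z p p) (2 * \<rho> p) \<Longrightarrow>
        norm ((flow_coords A X (U p) (z p) \<tau> \<zeta> - \<zeta>)
             - (flow_coords A X (U p) (z p) \<tau> \<zeta>' - \<zeta>')) \<le> norm (\<zeta> - \<zeta>') / 2"
  using flow_charts[OF assms(1)] assms(2) unfolding flow_chart_def flow_dom_def by blast+

lemma coords_continuous:
  assumes "p \<in> P" "\<tau> \<in> ball 0 T"
  shows "continuous_on (ball (z p p) (2 * \<rho> p)) (\<lambda>\<zeta>. flow_coords A X (U p) (z p) \<tau> \<zeta>)"
  by (intro continuous_at_imp_continuous_on ballI differentiable_imp_continuous_within
      real_analytic_at_imp_differentiable coords_analytic[OF assms])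

lemma is_chart: "p \<in> P \<Longrightarrow> is_chart (U p, z p)"
  using chart J maximal_atlas_is_chart unfolding complex_structure_def by blast

lemma inv_z: "p \<in> P \<Longrightarrow> q \<in> U p \<Longrightarrow> inv_into (U p) (z p) (z p q) = q"
  using chart_inv_left[OF is_chart] by simp

lemma open_U: "p \<in> P \<Longrightarrow> open (U p)"
  using chart_open[OF is_chart] by simp

lemma open_dom: "p \<in> P \<Longrightarrow> open (flow_dom p)"
  unfolding flow_dom_def using chart_open_preimage[OF is_chart open_ball] by simp

lemma covered: obtains p where "p \<in> P" "q \<in> flow_dom p"
proof -
  obtain p where "p \<in> P" "q \<in> U p" "z p q \<in> ball (z p p) (\<rho> p)" using cover by blast
  then show thesis using that[of p] \<rho>_pos[of p] by (auto simp: flow_dom_def)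
qed

lemma ball_in_chart:
  assumes "p \<in> P" "\<zeta> \<in> ball (z p p) (3 * \<rho> p)"
  shows "inv_into (U p) (z p) \<zeta> \<in> U p" "z p (inv_into (U p) (z p) \<zeta>) = \<zeta>"
proof -
  have "\<zeta> \<in> z p ` U p" using image_ball[OF assms(1)] assms(2) by blast
  then show "inv_into (U p) (z p) \<zeta> \<in> U p" "z p (inv_into (U p) (z p) \<zeta>) = \<zeta>"
    by (rule inv_into_into, intro f_inv_into_f)
qed

lemma ball_in_dom:
  assumes "p \<in> P" "\<zeta> \<in> ball (z p p) (2 * \<rho> p)"
  shows "inv_into (U p) (z p) \<zeta> \<in> flow_dom p" "z p (inv_into (U p) (z p) \<zeta>) = \<zeta>"
proof -
  have "\<zeta> \<in> ball (z p p) (3 * \<rho> p)" using assms \<rho>_pos[OF assms(1)] by auto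
  then show "inv_into (U p) (z p) \<zeta> \<in> flow_dom p" "z p (inv_into (U p) (z p) \<zeta>) = \<zeta>"
    using ball_in_chart[OF assms(1)] assms(2) by (auto simp: flow_dom_def)
qed

lemma coords_in_ball:
  assumes p: "p \<in> P" "q \<in> flow_dom p" and \<tau>: "\<tau> \<in> ball 0 T"
  shows "norm (lie_series_coords A X \<tau> (z p) q - z p q) \<le> M p * norm \<tau>"
    and "lie_series_coords A X \<tau> (z p) q \<in> ball (z p p) (3 * \<rho> p)"
proof -
  have zq: "z p q \<in> ball (z p p) (2 * \<rho> p)" "inv_into (U p) (z p) (z p q) = q"
    using p inv_z by (auto simp: flow_dom_def)
  show near: "norm (lie_series_coords A X \<tau> (z p) q - z p q) \<le> M p * norm \<tau>"
    using coords_near[OF p(1) \<tau> zq(1)] zq(2) by simp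
  have "M p * norm \<tau> \<le> M p * T" using \<tau> M_nonneg[OF p(1)] by (intro mult_left_mono) auto
  then have "norm (lie_series_coords A X \<tau> (z p) q - z p q) < \<rho> p"
    using near M_small[OF p(1)] \<rho>_pos[OF p(1)] by linarith
  then show "lie_series_coords A X \<tau> (z p) q \<in> ball (z p p) (3 * \<rho> p)"
    using zq(1) dist_triangle[of "z p p" "lie_series_coords A X \<tau> (z p) q" "z p q"]
    by (simp add: dist_norm norm_minus_commute)
qed

lemma local_flow:
  assumes "p \<in> P" "q \<in> flow_dom p" "\<tau> \<in> ball 0 T"
  shows "inv_into (U p) (z p) (lie_series_coords A X \<tau> (z p) q) \<in> U p"
    and "z p (inv_into (U p) (z p) (lie_series_coords A X \<tau> (z p) q)) = lie_series_coords A X \<tau> (z p) q"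
  using ball_in_chart[OF assms(1) coords_in_ball(2)[OF assms]] by auto

text \<open>The choice of the chart in the definition of the flow is immaterial: the curves obtained from two charts
  agree.\<close>

lemma flow_eq:
  assumes p: "p \<in> P" "q \<in> flow_dom p" and \<tau>: "\<tau> \<in> ball 0 T"
  shows "flow \<tau> q = inv_into (U p) (z p) (lie_series_coords A X \<tau> (z p) q)"
proof -
  define p' where "p' = (SOME p. p \<in> P \<and> q \<in> flow_dom p)"
  have p': "p' \<in> P" "q \<in> flow_dom p'"
    using someI[of "\<lambda>p. p \<in> P \<and> q \<in> flow_dom p" p] p unfolding p'_def by auto
  have conv: "summable (\<lambda>k. norm (lie_term A X \<tau> (\<lambda>q. z p q $ i) k q))"
    if "p \<in> P" "q \<in> flow_dom p" "\<tau> \<in> ball 0 T" for p \<tau> i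
    using converges[OF that(1,3)] that(2) unfolding lie_series_converges_on_def by blast
  have qU: "q \<in> U p" "q \<in> U p'" using p p' by (auto simp: flow_dom_def)
  have "inv_into (U p') (z p') (lie_series_coords A X \<tau> (z p') q)
      = inv_into (U p) (z p) (lie_series_coords A X \<tau> (z p) q)"
    by (rule lie_series_curve_unique[OF A J X chart[OF p'(1)] chart[OF p(1)] qU(2,1) conv[OF p'] conv[OF p]
          local_flow[OF p'] local_flow[OF p] \<tau>])
  then show ?thesis by (simp add: flow_def p'_def[symmetric] Let_def)
qed

lemma flow_in_chart:
  assumes "p \<in> P" "q \<in> flow_dom p" "\<tau> \<in> ball 0 T"
  shows "flow \<tau> q \<in> U p" "z p (flow \<tau> q) = lie_series_coords A X \<tau> (z p) q"
  using local_flow[OF assms] flow_eq[OF assms] by simp_all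

text \<open>The flow at small times moves points only slightly, locally uniformly.\<close>

lemma flow_near:
  assumes N: "open N" "q \<in> N"
  shows "\<exists>W \<eta>. open W \<and> q \<in> W \<and> \<eta> > 0 \<and> (\<forall>\<tau>\<in>ball 0 T. norm \<tau> < \<eta> \<longrightarrow> flow \<tau> ` W \<subseteq> N)"
proof -
  obtain p where p: "p \<in> P" "q \<in> flow_dom p" by (rule covered)
  have "open (z p ` (N \<inter> U p))"
    using chart_open_image[OF is_chart[OF p(1)], of "N \<inter> U p"] N open_U[OF p(1)] by (simp add: open_Int)
  moreover have "z p q \<in> z p ` (N \<inter> U p)" using N p by (auto simp: flow_dom_def)
  ultimately obtain e where e: "e > 0" "ball (z p q) e \<subseteq> z p ` (N \<inter> U p)"
    using open_contains_ball by blast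
  define W where "W = flow_dom p \<inter> (U p \<inter> z p -` ball (z p q) (e / 2))"
  define \<eta> where "\<eta> = e / (2 * (M p + 1))"
  have "open (U p \<inter> z p -` ball (z p q) (e / 2))"
    using chart_open_preimage[OF is_chart[OF p(1)] open_ball] by simp
  then have "open W" unfolding W_def using open_dom[OF p(1)] by (rule open_Int[rotated])
  moreover have "q \<in> W" using p e by (auto simp: W_def flow_dom_def)
  moreover have "\<eta> > 0" using e M_nonneg[OF p(1)] by (simp add: \<eta>_def)
  moreover have "flow \<tau> a \<in> N" if \<tau>: "\<tau> \<in> ball 0 T" "norm \<tau> < \<eta>" and a: "a \<in> W" for \<tau> a
  proof -
    have ad: "a \<in> flow_dom p" and za: "dist (z p q) (z p a) < e / 2" using a by (auto simp: W_def)
    have "M p * norm \<tau> \<le> (M p + 1) * \<eta>" using M_nonneg[OF p(1)] \<tau>(2) by (intro mult_mono) auto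
    also have "\<dots> = e / 2" using M_nonneg[OF p(1)] by (simp add: \<eta>_def field_simps)
    finally have "dist (z p a) (z p (flow \<tau> a)) \<le> e / 2"
      using coords_in_ball(1)[OF p(1) ad \<tau>(1)] flow_in_chart(2)[OF p(1) ad \<tau>(1)]
      by (simp add: dist_norm norm_minus_commute)
    then have "dist (z p q) (z p (flow \<tau> a)) < e"
      using za dist_triangle[of "z p q" "z p (flow \<tau> a)" "z p a"] by linarith
    then have "z p (flow \<tau> a) \<in> z p ` (N \<inter> U p)" using e(2) by auto
    then obtain b where b: "b \<in> N" "b \<in> U p" "z p (flow \<tau> a) = z p b" by blast
    then have "flow \<tau> a = b"
      using inv_z[OF p(1)] flow_in_chart(1)[OF p(1) ad \<tau>(1)] by metis
    then show ?thesis using b by simp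
  qed
  ultimately show ?thesis by (intro exI[of _ W] exI[of _ \<eta>]) auto
qed

lemma flow_continuous:
  assumes \<tau>: "\<tau> \<in> ball 0 T" shows "continuous_on UNIV (flow \<tau>)"
proof -
  have "continuous_on (flow_dom p) (flow \<tau>)" if p: "p \<in> P" for p
  proof (rule continuous_on_eq)
    have "continuous_on (ball (z p p) (2 * \<rho> p)) (\<lambda>\<zeta>. flow_coords A X (U p) (z p) \<tau> \<zeta>)"
      by (rule coords_continuous[OF p \<tau>])
    moreover have "continuous_on (flow_dom p) (z p)"
      using continuous_on_subset[OF chart_continuous[OF is_chart[OF p]], of "flow_dom p"] by (auto simp: flow_dom_def)
    ultimately have 1: "continuous_on (flow_dom p) (\<lambda>q. flow_coords A X (U p) (z p) \<tau> (z p q))"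
      by (rule continuous_on_compose2) (auto simp: flow_dom_def)
    show "continuous_on (flow_dom p) (\<lambda>q. inv_into (U p) (z p) (flow_coords A X (U p) (z p) \<tau> (z p q)))"
    proof (rule continuous_on_compose2[OF _ 1])
      show "continuous_on (z p ` U p) (inv_into (U p) (z p))"
        using chart_inv_continuous[OF is_chart[OF p]] by simp
      show "(\<lambda>q. flow_coords A X (U p) (z p) \<tau> (z p q)) ` flow_dom p \<subseteq> z p ` U p"
      proof (rule image_subsetI)
        fix q assume q: "q \<in> flow_dom p"
        then have "inv_into (U p) (z p) (z p q) = q" using inv_z[OF p] by (auto simp: flow_dom_def)
        then show "flow_coords A X (U p) (z p) \<tau> (z p q) \<in> z p ` U p"
          using coords_in_ball(2)[OF p q \<tau>] image_ball[OF p] by auto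
      qed
    qed
    fix q assume q: "q \<in> flow_dom p"
    then have "inv_into (U p) (z p) (z p q) = q" using inv_z[OF p] by (auto simp: flow_dom_def)
    then show "inv_into (U p) (z p) (flow_coords A X (U p) (z p) \<tau> (z p q)) = flow \<tau> q"
      using flow_eq[OF p q \<tau>] by simp
  qed
  then have "continuous_on (\<Union>p\<in>P. flow_dom p) (flow \<tau>)"
    by (intro continuous_on_open_UN open_dom) auto
  moreover have "(\<Union>p\<in>P. flow_dom p) = UNIV" using covered by blast
  ultimately show ?thesis by simp
qed

text \<open>In a flow chart the flow moves the points of the closed ball of radius \<open>\<rho> p / 2\<close> around the coordinates of \<open>y\<close> by at most \<open>\<rho> p / 2\<close>,
  so by Brouwer's fixed point theorem it attains the centre.\<close>

lemma flow_surj: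
  assumes \<tau>: "\<tau> \<in> ball 0 T" shows "surj (flow \<tau>)"
proof -
  have "\<exists>q. flow \<tau> q = y" for y
  proof -
    obtain p where p: "p \<in> P" "y \<in> U p" "z p y \<in> ball (z p p) (\<rho> p)" using cover by blast
    let ?e = "\<lambda>\<zeta>. flow_coords A X (U p) (z p) \<tau> \<zeta>"
    have sub: "cball (z p y) (\<rho> p / 2) \<subseteq> ball (z p p) (2 * \<rho> p)"
    proof
      fix \<zeta> assume "\<zeta> \<in> cball (z p y) (\<rho> p / 2)"
      then show "\<zeta> \<in> ball (z p p) (2 * \<rho> p)"
        using p(3) \<rho>_pos[OF p(1)] dist_triangle[of "z p p" \<zeta> "z p y"] by simp
    qed
    have "\<exists>\<zeta>\<in>cball (z p y) (\<rho> p / 2). ?e \<zeta> = z p y"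
    proof (rule brouwer_surjective_cball[where S = "{z p y}"])
      show "continuous_on (cball (z p y) (\<rho> p / 2)) ?e"
        by (rule continuous_on_subset[OF coords_continuous[OF p(1) \<tau>] sub])
      show "\<rho> p / 2 > 0" using \<rho>_pos[OF p(1)] by simp
      fix x \<zeta> assume x: "x \<in> {z p y}" and \<zeta>: "\<zeta> \<in> cball (z p y) (\<rho> p / 2)"
      have "M p * norm \<tau> \<le> M p * T" using \<tau> M_nonneg[OF p(1)] by (intro mult_left_mono) auto
      moreover have "norm (?e \<zeta> - \<zeta>) \<le> M p * norm \<tau>" by (rule coords_near[OF p(1) \<tau>]) (use sub \<zeta> in blast)
      ultimately have "norm (?e \<zeta> - \<zeta>) \<le> \<rho> p / 2" using M_small[OF p(1)] by linarith
      then show "x + (\<zeta> - ?e \<zeta>) \<in> cball (z p y) (\<rho> p / 2)"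
        using x by (simp add: dist_norm norm_minus_commute)
    qed simp
    then obtain \<zeta> where \<zeta>: "\<zeta> \<in> ball (z p p) (2 * \<rho> p)" "?e \<zeta> = z p y" using sub by blast
    have "flow \<tau> (inv_into (U p) (z p) \<zeta>) = inv_into (U p) (z p) (?e \<zeta>)"
      by (rule flow_eq[OF p(1) ball_in_dom(1)[OF p(1) \<zeta>(1)] \<tau>])
    also have "\<dots> = y" using \<zeta>(2) inv_z[OF p(1,2)] by simp
    finally show ?thesis by blast
  qed
  then show ?thesis by (metis surjI)
qed

lemma flow_inj_on_dom:
  assumes p: "p \<in> P" and \<tau>: "\<tau> \<in> ball 0 T" shows "inj_on (flow \<tau>) (flow_dom p)"
proof (rule inj_onI)
  fix a b assume ab: "a \<in> flow_dom p" "b \<in> flow_dom p" "flow \<tau> a = flow \<tau> b"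
  have in_ball: "z p a \<in> ball (z p p) (2 * \<rho> p)" "z p b \<in> ball (z p p) (2 * \<rho> p)"
    "inv_into (U p) (z p) (z p a) = a" "inv_into (U p) (z p) (z p b) = b"
    using ab inv_z[OF p] by (auto simp: flow_dom_def)
  have eq: "lie_series_coords A X \<tau> (z p) a = lie_series_coords A X \<tau> (z p) b"
    using flow_in_chart(2)[OF p ab(1) \<tau>] flow_in_chart(2)[OF p ab(2) \<tau>] ab(3) by simp
  have "norm ((lie_series_coords A X \<tau> (z p) b - z p a) - (lie_series_coords A X \<tau> (z p) b - z p b))
      \<le> norm (z p a - z p b) / 2"
    using coords_lipschitz[OF p \<tau> in_ball(1,2)] unfolding in_ball(3,4) eq .
  then have "norm (z p b - z p a) \<le> norm (z p a - z p b) / 2" by simp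
  then have "norm (z p a - z p b) \<le> 0" using norm_minus_commute[of "z p a" "z p b"] by linarith
  then have "z p a = z p b" by simp
  from arg_cong[OF this, of "inv_into (U p) (z p)"] show "a = b" unfolding in_ball(3,4) .
qed

text \<open>Points in a common flow chart are separated by the Lipschitz bound. Two distinct points have disjoint
  neighbourhoods, and for small times the flow keeps points near them inside these. Since the square of the manifold
  is compact, finitely many of these situations occur, and they have a common time.\<close>

lemma flow_inj:
  assumes "compact (UNIV :: 'm set)" and T: "T > 0"
  shows "\<exists>T'>0. T' \<le> T \<and> (\<forall>\<tau>\<in>ball 0 T'. inj (flow \<tau>))"
proof -
  define separated where "separated N \<eta> \<longleftrightarrow>
      (\<forall>\<tau>\<in>ball 0 T. norm \<tau> < \<eta> \<longrightarrow> (\<forall>y\<in>N. flow \<tau> (fst y) = flow \<tau> (snd y) \<longrightarrow> fst y = snd y))"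
    for N :: "('m \<times> 'm) set" and \<eta> :: real
  have local: "\<exists>N \<eta>. open N \<and> x \<in> N \<and> \<eta> > 0 \<and> separated N \<eta>" for x :: "'m \<times> 'm"
  proof (cases "fst x = snd x")
    case True
    obtain p where p: "p \<in> P" "fst x \<in> flow_dom p" by (rule covered)
    show ?thesis unfolding separated_def
    proof (intro exI[of _ "flow_dom p \<times> flow_dom p"] exI[of _ T] conjI ballI impI)
      show "open (flow_dom p \<times> flow_dom p)" using open_dom[OF p(1)] by (intro open_Times)
      show "x \<in> flow_dom p \<times> flow_dom p" using p True by (simp add: mem_Times_iff)
      fix \<tau> y assume "\<tau> \<in> ball 0 T" "y \<in> flow_dom p \<times> flow_dom p" "flow \<tau> (fst y) = flow \<tau> (snd y)"
      then show "fst y = snd y" using inj_onD[OF flow_inj_on_dom[OF p(1)]] by (auto simp: mem_Times_iff)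
    qed (rule T)
  next
    case False
    then obtain N N' where N: "open N" "open N'" "fst x \<in> N" "snd x \<in> N'" "N \<inter> N' = {}"
      using hausdorff by metis
    obtain W \<eta> where W: "open W" "fst x \<in> W" "\<eta> > 0" "\<And>\<tau>. \<tau> \<in> ball 0 T \<Longrightarrow> norm \<tau> < \<eta> \<Longrightarrow> flow \<tau> ` W \<subseteq> N"
      using flow_near[OF N(1,3)] by blast
    obtain W' \<eta>' where W': "open W'" "snd x \<in> W'" "\<eta>' > 0" "\<And>\<tau>. \<tau> \<in> ball 0 T \<Longrightarrow> norm \<tau> < \<eta>' \<Longrightarrow> flow \<tau> ` W' \<subseteq> N'"
      using flow_near[OF N(2,4)] by blast
    show ?thesis unfolding separated_def
    proof (intro exI[of _ "W \<times> W'"] exI[of _ "min \<eta> \<eta>'"] conjI ballI impI)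
      show "open (W \<times> W')" using W(1) W'(1) by (rule open_Times)
      show "x \<in> W \<times> W'" using W(2) W'(2) by (simp add: mem_Times_iff)
      show "min \<eta> \<eta>' > 0" using W(3) W'(3) by simp
      fix \<tau> :: complex and y
      assume a: "\<tau> \<in> ball 0 T" "norm \<tau> < min \<eta> \<eta>'" "y \<in> W \<times> W'" "flow \<tau> (fst y) = flow \<tau> (snd y)"
      have "flow \<tau> (fst y) \<in> N" "flow \<tau> (snd y) \<in> N'"
        using W(4)[OF a(1)] W'(4)[OF a(1)] a(2,3) by (auto simp: mem_Times_iff)
      then show "fst y = snd y" using a(4) N(5) by auto
    qed
  qed
  then obtain N \<eta> where N: "\<And>x. open (N x)" "\<And>x. x \<in> N x" "\<And>x. \<eta> x > 0" "\<And>x. separated (N x) (\<eta> x)"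
    by metis
  have cM: "compact (UNIV :: ('m \<times> 'm) set)"
    using compact_Times[OF assms(1) assms(1)] by simp
  have "UNIV \<subseteq> (\<Union>x\<in>UNIV. N x)" using N(2) by blast
  from compactE_image[OF cM N(1) this]
  obtain D where D: "finite D" "UNIV \<subseteq> (\<Union>x\<in>D. N x)" by metis
  define T' where "T' = Min (insert T (\<eta> ` D))"
  have T': "T' > 0" "T' \<le> T" "\<And>x. x \<in> D \<Longrightarrow> T' \<le> \<eta> x"
    using D(1) N(3) T unfolding T'_def by auto
  have "inj (flow \<tau>)" if \<tau>: "\<tau> \<in> ball 0 T'" for \<tau>
  proof (rule injI)
    fix a b assume ab: "flow \<tau> a = flow \<tau> b"
    obtain x where x: "x \<in> D" "(a, b) \<in> N x" using D(2) by blast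
    have "\<tau> \<in> ball 0 T" "norm \<tau> < \<eta> x" using \<tau> T'(2) T'(3)[OF x(1)] by auto
    then show "a = b" using N(4)[of x, unfolded separated_def, rule_format, OF _ _ x(2)] ab by simp
  qed
  then show ?thesis using T'(1,2) by blast
qed

lemma flow_analytic:
  assumes p: "p \<in> P" "q \<in> flow_dom p" and \<tau>: "\<tau> \<in> ball 0 T"
  shows "real_analytic_at (z p \<circ> flow \<tau> \<circ> inv_into (U p) (z p)) (z p q)"
proof -
  have zq: "z p q \<in> ball (z p p) (2 * \<rho> p)" using p by (auto simp: flow_dom_def)
  show ?thesis
  proof (rule real_analytic_at_cong[OF coords_analytic[OF p(1) \<tau> zq] open_ball zq])
    fix \<zeta> assume "\<zeta> \<in> ball (z p p) (2 * \<rho> p)"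
    from ball_in_dom(1)[OF p(1) this]
    show "flow_coords A X (U p) (z p) \<tau> \<zeta> = (z p \<circ> flow \<tau> \<circ> inv_into (U p) (z p)) \<zeta>"
      using flow_in_chart(2)[OF p(1) _ \<tau>] by simp
  qed
qed

text \<open>In flow charts the flow has an injective derivative, so the real analytic inverse function theorem
  applies.\<close>

lemma flow_inverse_analytic:
  assumes p: "p \<in> P" "q \<in> flow_dom p" and \<tau>: "\<tau> \<in> ball 0 T" and inj: "inj (flow \<tau>)"
  shows "real_analytic_at (z p \<circ> inv (flow \<tau>) \<circ> inv_into (U p) (z p)) (z p (flow \<tau> q))"
proof -
  let ?e = "\<lambda>\<zeta>. flow_coords A X (U p) (z p) \<tau> \<zeta>"
  have zq: "z p q \<in> ball (z p p) (2 * \<rho> p)" "inv_into (U p) (z p) (z p q) = q"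
    using p inv_z by (auto simp: flow_dom_def)
  have an: "real_analytic_at ?e (z p q)" by (rule coords_analytic[OF p(1) \<tau> zq(1)])
  then have der: "(?e has_derivative frechet_derivative ?e (at (z p q))) (at (z p q))"
    using real_analytic_at_imp_differentiable frechet_derivative_works by blast
  have "inj (frechet_derivative ?e (at (z p q)))"
    by (rule inj_derivative_near_identity[OF der open_ball zq(1)]) (rule coords_lipschitz[OF p(1) \<tau> _ zq(1)])
  then have "real_analytic_at (z p \<circ> inv (flow \<tau>) \<circ> inv_into (U p) (z p)) (?e (z p q))"
  proof (rule real_analytic_at_inverse[OF an der _ open_ball zq(1)])
    fix \<zeta> assume \<zeta>: "\<zeta> \<in> ball (z p p) (2 * \<rho> p)"
    let ?m = "inv_into (U p) (z p) \<zeta>"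
    have m: "?m \<in> flow_dom p" "z p ?m = \<zeta>" using ball_in_dom[OF p(1) \<zeta>] by auto
    have "inv_into (U p) (z p) (?e \<zeta>) = flow \<tau> ?m" using flow_eq[OF p(1) m(1) \<tau>] by simp
    then show "(z p \<circ> inv (flow \<tau>) \<circ> inv_into (U p) (z p)) (?e \<zeta>) = \<zeta>"
      using m(2) inv_f_f[OF inj] by simp
  qed
  then show ?thesis using flow_in_chart(2)[OF p \<tau>] zq(2) by simp
qed

lemma acts_on_coords_dom:
  assumes p: "p \<in> P" and T': "T' \<le> T"
  shows "acts_on_coords A X J\<^sub>0 T' flow (U p) (z p) (flow_dom p)"
  unfolding acts_on_coords_def
proof (intro conjI ballI allI)
  show "(U p, z p) \<in> J\<^sub>0" by (rule chart[OF p])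
  show "open (flow_dom p)" by (rule open_dom[OF p])
  show "flow_dom p \<subseteq> U p" by (auto simp: flow_dom_def)
  fix \<tau> :: complex assume "\<tau> \<in> ball 0 T'"
  then have \<tau>: "\<tau> \<in> ball 0 T" using T' by auto
  show "lie_series_converges_on A X \<tau> (\<lambda>q. z p q $ i) (flow_dom p)" for i by (rule converges[OF p \<tau>])
  show "flow \<tau> ` flow_dom p \<subseteq> U p" using flow_in_chart(1)[OF p _ \<tau>] by blast
  show "z p (flow \<tau> q) $ i = lie_series A X \<tau> (\<lambda>q. z p q $ i) q" if "q \<in> flow_dom p" for q i
    using flow_in_chart(2)[OF p that \<tau>] by (simp add: lie_series_coords_def)
qed

end

section \<open>The complex structures along the flow\<close>

context flow_cover
begin

text \<open>The pull-back of \<open>J\<^sub>0\<close> under the flow, which makes the flow a biholomorphism onto \<open>J\<^sub>0\<close>.\<close>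

definition J_flow :: "complex \<Rightarrow> ('m, complex ^ 'n) chart set" where
  "J_flow \<tau> = {c. push_chart (flow \<tau>) c \<in> J\<^sub>0}"

lemma flow_homeo:
  assumes "compact (UNIV :: 'm set)" "\<tau> \<in> ball 0 T" "inj (flow \<tau>)"
  shows "bij (flow \<tau>)" "continuous_on UNIV (flow \<tau>)" "continuous_on UNIV (inv (flow \<tau>))"
proof -
  show bij: "bij (flow \<tau>)" using flow_surj[OF assms(2)] assms(3) by (simp add: bij_def)
  show cont: "continuous_on UNIV (flow \<tau>)" by (rule flow_continuous[OF assms(2)])
  have "continuous_on (flow \<tau> ` UNIV) (inv (flow \<tau>))"
    by (rule continuous_on_inv[OF cont assms(1)]) (simp add: inv_f_f[OF assms(3)])
  then show "continuous_on UNIV (inv (flow \<tau>))" using flow_surj[OF assms(2)] by simp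
qed

text \<open>The transition maps between \<open>A\<close> and the pulled back charts are compositions of the flow or its inverse,
  both real analytic in flow charts, with real analytic changes of charts.\<close>

lemma J_flow_complex_structure:
  assumes comp: "compact (UNIV :: 'm set)" and \<tau>: "\<tau> \<in> ball 0 T" and inj: "inj (flow \<tau>)"
  shows "complex_structure A (J_flow \<tau>)"
proof -
  note homeo = flow_homeo[OF comp \<tau> inj]
  have J0: "maximal_atlas holomorphic_map_on J\<^sub>0" using J unfolding complex_structure_def by blast
  have max: "maximal_atlas holomorphic_map_on (J_flow \<tau>)"
    unfolding J_flow_def
    by (rule maximal_atlas_pull_back[OF homeo _ J0]) (rule holomorphic_map_on_cong_open)
  have A_chart: "is_chart c" if "c \<in> A" for c
    using A that maximal_atlas_is_chart unfolding real_analytic_structure_def by blast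
  have mixed: "real_analytic_at (snd w \<circ> chart_inv c) (snd c q)" "real_analytic_at (snd c \<circ> chart_inv w) (snd w q)"
    if "c \<in> A" "w \<in> J\<^sub>0" "q \<in> fst c" "q \<in> fst w" for c w q
    using J that unfolding complex_structure_def transition_def real_analytic_on_def by auto
  show ?thesis unfolding complex_structure_def
  proof (intro conjI ballI)
    show "maximal_atlas holomorphic_map_on (J_flow \<tau>)" by (rule max)
    fix c w assume c: "c \<in> A" and w: "w \<in> J_flow \<tau>"
    define w' where "w' = push_chart (flow \<tau>) w"
    have w': "w' \<in> J\<^sub>0" using w by (simp add: J_flow_def w'_def)
    have ch: "is_chart c" "is_chart w" "is_chart w'"
      using A_chart[OF c] maximal_atlas_is_chart[OF max w] maximal_atlas_is_chart[OF J0 w'] by auto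
    have fst_w': "flow \<tau> q \<in> fst w'" if "q \<in> fst w" for q
      using that by (simp add: w'_def push_chart_def)
    have snd_w: "snd w q = snd w' (flow \<tau> q)" for q
      by (simp add: w'_def push_chart_def inv_f_f[OF inj])
    show "real_analytic_on (transition c w) (snd c ` (fst c \<inter> fst w))"
      unfolding real_analytic_on_def
    proof
      fix \<xi> assume "\<xi> \<in> snd c ` (fst c \<inter> fst w)"
      then obtain q where q: "q \<in> fst c" "q \<in> fst w" "\<xi> = snd c q" by blast
      obtain p where p: "p \<in> P" "q \<in> flow_dom p" by (rule covered)
      have qU: "q \<in> fst (U p, z p)" "flow \<tau> q \<in> fst (U p, z p)"
        using p flow_in_chart(1)[OF p \<tau>] by (auto simp: flow_dom_def)
      have "real_analytic_at (snd w' \<circ> flow \<tau> \<circ> chart_inv (U p, z p)) (snd (U p, z p) q)"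
      proof (rule real_analytic_at_in_charts[OF is_chart[OF p(1)] qU(1) is_chart[OF p(1)] qU(2) homeo(2)])
        show "real_analytic_at (snd (U p, z p) \<circ> flow \<tau> \<circ> chart_inv (U p, z p)) (snd (U p, z p) q)"
          using flow_analytic[OF p \<tau>] by simp
        show "real_analytic_at (snd w' \<circ> chart_inv (U p, z p)) (snd (U p, z p) (flow \<tau> q))"
          by (rule holomorphic_transition_real_analytic[OF A J chart[OF p(1)] w' qU(2) fst_w'[OF q(2)]])
      qed
      from real_analytic_at_change_chart[OF ch(1) q(1) is_chart[OF p(1)] qU(1) mixed(1)[OF c chart[OF p(1)] q(1) qU(1)] this]
      have "real_analytic_at (snd w' \<circ> flow \<tau> \<circ> chart_inv c) (snd c q)" .
      moreover have "snd w' \<circ> flow \<tau> \<circ> chart_inv c = transition c w"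
        by (rule ext) (simp add: transition_def snd_w)
      ultimately show "real_analytic_at (transition c w) \<xi>" by (simp add: q(3))
    qed
    show "real_analytic_on (transition w c) (snd w ` (fst c \<inter> fst w))"
      unfolding real_analytic_on_def
    proof
      fix \<xi> assume "\<xi> \<in> snd w ` (fst c \<inter> fst w)"
      then obtain q where q: "q \<in> fst c" "q \<in> fst w" "\<xi> = snd w q" by blast
      obtain p where p: "p \<in> P" "q \<in> flow_dom p" by (rule covered)
      let ?q' = "flow \<tau> q"
      have qU: "q \<in> fst (U p, z p)" "?q' \<in> fst (U p, z p)"
        using p flow_in_chart(1)[OF p \<tau>] by (auto simp: flow_dom_def)
      have inv_q': "inv (flow \<tau>) ?q' = q" by (rule inv_f_f[OF inj])
      have "real_analytic_at (snd c \<circ> inv (flow \<tau>) \<circ> chart_inv (U p, z p)) (snd (U p, z p) ?q')"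
      proof (rule real_analytic_at_in_charts[OF is_chart[OF p(1)] qU(2) is_chart[OF p(1)] _ homeo(3)])
        show "inv (flow \<tau>) ?q' \<in> fst (U p, z p)" using qU(1) inv_q' by simp
        show "real_analytic_at (snd (U p, z p) \<circ> inv (flow \<tau>) \<circ> chart_inv (U p, z p)) (snd (U p, z p) ?q')"
          using flow_inverse_analytic[OF p \<tau> inj] by simp
        show "real_analytic_at (snd c \<circ> chart_inv (U p, z p)) (snd (U p, z p) (inv (flow \<tau>) ?q'))"
          unfolding inv_q' by (rule mixed(2)[OF c chart[OF p(1)] q(1) qU(1)])
      qed
      from real_analytic_at_change_chart[OF ch(3) fst_w'[OF q(2)] is_chart[OF p(1)] qU(2)
          holomorphic_transition_real_analytic[OF A J w' chart[OF p(1)] fst_w'[OF q(2)] qU(2)] this]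
      have "real_analytic_at (snd c \<circ> inv (flow \<tau>) \<circ> chart_inv w') \<xi>" by (simp add: q(3) snd_w)
      then show "real_analytic_at (transition w c) \<xi>"
      proof (rule real_analytic_at_cong)
        show "open (snd w ` fst w)" using ch(2) by (simp add: is_chart_iff)
        show "\<xi> \<in> snd w ` fst w" using q by blast
        fix \<eta> assume "\<eta> \<in> snd w ` fst w"
        from push_chart_inv[OF homeo(1) chart_inj[OF ch(2)] this]
        show "(snd c \<circ> inv (flow \<tau>) \<circ> chart_inv w') \<eta> = transition w c \<eta>"
          by (simp add: w'_def transition_def inv_f_f[OF inj])
      qed
    qed
  qed
qed

text \<open>On \<open>W\<close> the Lie series of the coordinates \<open>w\<close> is the composition of \<open>w\<close> with the flow, hence the pull-back of
  a restriction of the chart \<open>(V, w)\<close>.\<close>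

lemma J_flow_extends:
  assumes comp: "compact (UNIV :: 'm set)" and T': "T' \<le> T" and inj: "\<And>\<tau>. \<tau> \<in> ball 0 T' \<Longrightarrow> inj (flow \<tau>)"
  shows "extends_local_structures A X J\<^sub>0 T' flow J_flow"
  unfolding extends_local_structures_def
proof (intro allI impI ballI)
  fix V w W and \<tau> :: complex
  assume acts: "acts_on_coords A X J\<^sub>0 T' flow V w W" and \<tau>': "\<tau> \<in> ball 0 T'"
  have \<tau>: "\<tau> \<in> ball 0 T" using \<tau>' T' by auto
  note homeo = flow_homeo[OF comp \<tau> inj[OF \<tau>']]
  have W: "(V, w) \<in> J\<^sub>0" "open W" "flow \<tau> ` W \<subseteq> V"
      "\<And>q. q \<in> W \<Longrightarrow> w (flow \<tau> q) = lie_series_coords A X \<tau> w q"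
    using acts \<tau>' unfolding acts_on_coords_def by (auto simp: vec_eq_iff lie_series_coords_def)
  have "(flow \<tau> ` W, lie_series_coords A X \<tau> w \<circ> inv (flow \<tau>)) \<in> J\<^sub>0"
  proof (rule maximal_atlas_restrict[OF holomorphic_map_on_cong_open holomorphic_map_on_subset _ W(1)])
    show "maximal_atlas holomorphic_map_on J\<^sub>0" using J unfolding complex_structure_def by blast
    have "flow \<tau> ` W = inv (flow \<tau>) -` W"
      using homeo(1) by (simp add: bij_vimage_eq_inv_image bij_imp_bij_inv inv_inv_eq)
    then show "open (flow \<tau> ` W)" using homeo(3) W(2) by (simp add: continuous_on_open_vimage)
    show "flow \<tau> ` W \<subseteq> fst (V, w)" using W(3) by simp
    show "(lie_series_coords A X \<tau> w \<circ> inv (flow \<tau>)) q = snd (V, w) q" if "q \<in> flow \<tau> ` W" for q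
      using that W(4) inv_f_f[OF inj[OF \<tau>']] by auto
  qed
  then show "(W, lie_series_coords A X \<tau> w) \<in> J_flow \<tau>"
    by (simp add: J_flow_def push_chart_def)
qed

lemma flow_acts_as_lie_series:
  assumes "T' \<le> T" shows "acts_as_lie_series A X J\<^sub>0 T' flow"
  unfolding acts_as_lie_series_def
proof
  fix q obtain p where "p \<in> P" "q \<in> flow_dom p" by (rule covered)
  then show "\<exists>U z V. q \<in> V \<and> acts_on_coords A X J\<^sub>0 T' flow U z V"
    using acts_on_coords_dom[OF _ assms] by blast
qed

end

text \<open>For every point, the two families move it along two curves that are given by Lie series of coordinates, and such
  curves agree.\<close>

lemma acts_as_lie_series_unique:
  fixes A :: "('m::t2_space, real ^ 'd) chart set" and J\<^sub>0 :: "('m, complex ^ 'n) chart set"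
  assumes A: "real_analytic_structure A" and J: "complex_structure A J\<^sub>0"
    and X: "real_analytic_vector_field A X"
    and acts: "acts_as_lie_series A X J\<^sub>0 T \<phi>" "acts_as_lie_series A X J\<^sub>0 T \<psi>" and \<tau>: "\<tau> \<in> ball 0 T"
  shows "\<psi> \<tau> = \<phi> \<tau>"
proof
  fix q
  obtain U z V where V: "q \<in> V" "acts_on_coords A X J\<^sub>0 T \<phi> U z V"
    using acts(1) unfolding acts_as_lie_series_def by blast
  obtain U' z' V' where V': "q \<in> V'" "acts_on_coords A X J\<^sub>0 T \<psi> U' z' V'"
    using acts(2) unfolding acts_as_lie_series_def by blast
  have curve: "(U, z) \<in> J\<^sub>0" "q \<in> U"
      "\<And>\<tau> i. \<tau> \<in> ball 0 T \<Longrightarrow> summable (\<lambda>k. norm (lie_term A X \<tau> (\<lambda>q. z q $ i) k q))"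
      "\<And>\<tau>. \<tau> \<in> ball 0 T \<Longrightarrow> \<phi> \<tau> q \<in> U" "\<And>\<tau>. \<tau> \<in> ball 0 T \<Longrightarrow> z (\<phi> \<tau> q) = lie_series_coords A X \<tau> z q"
    if q: "q \<in> V" and acts: "acts_on_coords A X J\<^sub>0 T \<phi> U z V" for \<phi> U z V
  proof -
    note acts' = acts[unfolded acts_on_coords_def lie_series_converges_on_def]
    show "(U, z) \<in> J\<^sub>0" "q \<in> U" using acts' q by blast+
    fix \<tau> :: complex assume "\<tau> \<in> ball 0 T"
    with acts' have *: "\<forall>i. \<forall>p\<in>V. summable (\<lambda>k. norm (lie_term A X \<tau> (\<lambda>q. z q $ i) k p))"
      "\<phi> \<tau> ` V \<subseteq> U" "\<forall>p\<in>V. \<forall>i. z (\<phi> \<tau> p) $ i = lie_series A X \<tau> (\<lambda>q. z q $ i) p"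
      by blast+
    show "summable (\<lambda>k. norm (lie_term A X \<tau> (\<lambda>q. z q $ i) k q))" for i using *(1) q by blast
    show "\<phi> \<tau> q \<in> U" using *(2) q by blast
    show "z (\<phi> \<tau> q) = lie_series_coords A X \<tau> z q"
      using *(3) q by (simp add: vec_eq_iff lie_series_coords_def)
  qed
  show "\<psi> \<tau> q = \<phi> \<tau> q"
    by (rule lie_series_curve_unique[where \<gamma> = "\<lambda>\<tau>. \<psi> \<tau> q" and \<gamma>' = "\<lambda>\<tau>. \<phi> \<tau> q", OF A J X
          curve(1)[OF V'] curve(1)[OF V] curve(2)[OF V'] curve(2)[OF V] curve(3)[OF V'] curve(3)[OF V]
          curve(4)[OF V'] curve(5)[OF V'] curve(4)[OF V] curve(5)[OF V] \<tau>])
qed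

theorem theorem2p6:
  fixes A :: "('m::t2_space, real ^ 'd) chart set"
    and J\<^sub>0 :: "('m, complex ^ 'n) chart set"
    and X :: "('m, real ^ 'd) chart \<Rightarrow> 'm \<Rightarrow> real ^ 'd"
  assumes "compact (UNIV :: 'm set)"
    and "CARD('d) = 2 * CARD('n)"
    and "real_analytic_structure A"
    and "complex_structure A J\<^sub>0"
    and "real_analytic_vector_field A X"
  shows "\<exists>T>0. \<exists>(J :: complex \<Rightarrow> ('m, complex ^ 'n) chart set) (\<phi> :: complex \<Rightarrow> 'm \<Rightarrow> 'm).
           (\<forall>\<tau>\<in>ball 0 T. complex_structure A (J \<tau>)) \<and>
           extends_local_structures A X J\<^sub>0 T \<phi> J \<and>
           (\<forall>\<tau>\<in>ball 0 T. biholomorphism (J \<tau>) J\<^sub>0 (\<phi> \<tau>)) \<and>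
           acts_as_lie_series A X J\<^sub>0 T \<phi> \<and>
           (\<forall>\<psi>. (\<forall>\<tau>\<in>ball 0 T. biholomorphism (J \<tau>) J\<^sub>0 (\<psi> \<tau>)) \<and>
                 acts_as_lie_series A X J\<^sub>0 T \<psi> \<longrightarrow>
                 (\<forall>\<tau>\<in>ball 0 T. \<psi> \<tau> = \<phi> \<tau>))"
proof -
  note comp = assms(1) and A = assms(3) and J0 = assms(4) and X = assms(5)
  have "\<forall>p. \<exists>U z \<rho> M \<epsilon>. flow_chart A X J\<^sub>0 p U z \<rho> M \<epsilon>"
    using flow_chart_exists[OF A J0 X] by blast
  then obtain U z \<rho> M \<epsilon> where fc: "\<And>p. flow_chart A X J\<^sub>0 p (U p) (z p) (\<rho> p) (M p) (\<epsilon> p)" by metis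
  define W where "W p = U p \<inter> z p -` ball (z p p) (\<rho> p)" for p
  have W: "open (W p)" "p \<in> W p" for p
  proof -
    have "(U p, z p) \<in> J\<^sub>0" "p \<in> U p" "\<rho> p > 0" using fc[of p] unfolding flow_chart_def by blast+
    moreover from this have "is_chart (U p, z p)"
      using J0 maximal_atlas_is_chart unfolding complex_structure_def by blast
    ultimately show "open (W p)" "p \<in> W p"
      using chart_open_preimage[of "(U p, z p)", OF _ open_ball] by (simp_all add: W_def)
  qed
  have "UNIV \<subseteq> (\<Union>p\<in>UNIV. W p)" using W(2) by blast
  from compactE_image[OF comp W(1) this]
  obtain P where P: "finite P" "UNIV \<subseteq> (\<Union>p\<in>P. W p)" by metis
  define T\<^sub>0 where "T\<^sub>0 = Min (insert 1 (\<epsilon> ` P))"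
  have T\<^sub>0: "T\<^sub>0 > 0" "\<And>p. p \<in> P \<Longrightarrow> T\<^sub>0 \<le> \<epsilon> p"
    using P(1) fc unfolding T\<^sub>0_def flow_chart_def by auto
  interpret F: flow_cover A J\<^sub>0 X P U z \<rho> M T\<^sub>0
  proof
    show "flow_chart A X J\<^sub>0 p (U p) (z p) (\<rho> p) (M p) T\<^sub>0" if "p \<in> P" for p
      by (rule flow_chart_mono[OF fc T\<^sub>0(1) T\<^sub>0(2)[OF that]])
    show "\<exists>p\<in>P. q \<in> U p \<and> z p q \<in> ball (z p p) (\<rho> p)" for q
      using P(2) unfolding W_def by blast
  qed (rule A J0 X)+
  obtain T where T: "T > 0" "T \<le> T\<^sub>0" "\<And>\<tau>. \<tau> \<in> ball 0 T \<Longrightarrow> inj (F.flow \<tau>)"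
    using F.flow_inj[OF comp T\<^sub>0(1)] by blast
  have sub: "\<tau> \<in> ball 0 T\<^sub>0" if "\<tau> \<in> ball 0 T" for \<tau> :: complex using that T(2) by auto
  have J0': "maximal_atlas holomorphic_map_on J\<^sub>0" using J0 unfolding complex_structure_def by blast
  have acts: "acts_as_lie_series A X J\<^sub>0 T F.flow" by (rule F.flow_acts_as_lie_series[OF T(2)])
  show ?thesis
  proof (intro exI[of _ T] exI[of _ F.J_flow] exI[of _ F.flow] conjI ballI allI impI)
    show "T > 0" by (rule T(1))
    show "complex_structure A (F.J_flow \<tau>)" if "\<tau> \<in> ball 0 T" for \<tau>
      by (rule F.J_flow_complex_structure[OF comp sub[OF that] T(3)[OF that]])
    show "extends_local_structures A X J\<^sub>0 T F.flow F.J_flow"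
      by (rule F.J_flow_extends[OF comp T(2,3)])
    show "biholomorphism (F.J_flow \<tau>) J\<^sub>0 (F.flow \<tau>)" if "\<tau> \<in> ball 0 T" for \<tau>
      unfolding F.J_flow_def
      by (rule biholomorphism_pull_back[OF F.flow_homeo[OF comp sub[OF that] T(3)[OF that]] J0'])
    show "acts_as_lie_series A X J\<^sub>0 T F.flow" by (rule acts)
    show "\<psi> \<tau> = F.flow \<tau>"
      if "(\<forall>\<tau>\<in>ball 0 T. biholomorphism (F.J_flow \<tau>) J\<^sub>0 (\<psi> \<tau>)) \<and> acts_as_lie_series A X J\<^sub>0 T \<psi>"
         "\<tau> \<in> ball 0 T" for \<psi> \<tau>
      by (rule acts_as_lie_series_unique[OF A J0 X acts conjunct2[OF that(1)] that(2)])
  qed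
qed

end
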